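(* Let $bM_*>1$. The distortion exponent achieved by the hybrid digital-analog list decoding (HDA-LD) scheme is $$\Delta_h(b,\nu)=\begin{cases}\nu & \text{if } \frac{1}{M_*}\le b<\frac{\nu}{M_*},\\[2pt] 1+\dfrac{(bM_*-1)(\Phi_k+k\Upsilon_k-1+\nu)}{bM_*-1+M_*\Upsilon_k} & \text{if } b\in\left[\frac{\Phi_{k+1}-1+\nu}{k+1}+\frac{1}{M_*},\ \frac{\Phi_k-1+\nu}{k}+\frac{1}{M_*}\right),\ k=0,\dots,M_*-1\end{cases}$$ (for $k=0$ the right endpoint is $+\infty$).
   Context: All logarithms are base 2. Let $M_t,M_r\ge1$ be integers, $M^*=\max\{M_t,M_r\}$, $M_*=\min\{M_t,M_r\}$. A block $S^m$ of i.i.d. $\mathcal{CN}(0,1)$ source samples is sent over one block of $n$ uses of the MIMO channel $\mathbf Y_i=\sqrt{\rho/M_t}\,\mathbf H\mathbf x_i+\mathbf N_i$, with SNR $\rho>0$, $\mathbf H\in\mathbb C^{M_r\times M_t}$ with i.i.d. $\mathcal{CN}(0,1)$ entries constant over the block, $\mathbf N_i\sim\mathcal{CN}(0,\mathbf I)$ i.i.d., and power constraint $\sum_i\mathrm{Tr}\,\mathbb E[\mathbf X_i^H\mathbf X_i]\le nM_t$. The receiver also observes $T^m=\sqrt{\rho_s}\Gamma_cS^m+Z^m$, $\Gamma_c\sim\mathcal{CN}(0,1)$ constant over the block, $Z^m$ unit-variance Gaussian noise; $\Gamma=|\Gamma_c|^2$ with density $e^{-\gamma}$. All random quantities are independent;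 the receiver knows $\mathbf H,\gamma$, the transmitter only their distributions. $b=n/m$; $\rho_s\doteq\rho^\nu$, $\nu\ge0$ ($\doteq$ is equality of exponential order in $\rho$). The distortion exponent of $\mathbb E[D]$ is $-\lim_{\rho\to\infty}\log\mathbb E[D]/\log\rho$. Let $\lambda_1,\dots,\lambda_{M_*}$ be the nonzero eigenvalues of $\mathbf H\mathbf H^H$. HDA-LD scheme (for $bM_*>1$): the source is quantized with test channel $W=S+Q$, $Q\sim\mathcal{CN}(0,\sigma_Q^2)$, at rate $R_h$ with $\sigma_Q^2=(2^{R_h-\epsilon}-1)^{-1}$ ($\epsilon>0$ arbitrarily small); in the first $m/M_*$ channel uses the scaled quantization error $(\mathbf S_i-\mathbf W_i)/\sigma_Q$ is sent uncoded over the $M_*$ antennas, in the remaining $n-m/M_*$ uses an i.i.d. Gaussian codeword associated with the quantization index is sent; the receiver list-decodes jointly with $T^m$. Its outage event is $\mathcal O_h=\{(\mathbf H,\gamma):(1+\sigma_Q^{-2})^{M_*}\ge ((1+\rho_s\gamma)(1+\sigma_Q^2))^{M_*}\frac{\prod_{i=1}^{M_*}(1+\frac{\rho}{M_*}\lambda_i)^{bM_*}}{\prod_{i=1}^{M_*}(1+\frac{\rho}{M_*}\lambda_i+(1+\rho_s\gamma)\sigma_Q^2)}\}$; on $\mathcal O_h^c$ the distortion is $D_h=\frac1{M_*}\sum_{i=1}^{M_*}\big(1+\rho_s\gamma+\sigma_Q^{-2}(1+\frac{\rho}{M_*}\lambda_i)\big)^{-1}$, and on $\mathcal O_h$ it is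 $(1+\rho_s\gamma)^{-1}$. The expected distortion $ED_h(R_h)$ is the expectation of this over $\mathbf H,\Gamma$, and the distortion exponent achieved by HDA-LD is the supremum over $r\ge0$ of the distortion exponent of $ED_h(r\log\rho)$. For $k=0,\dots,M_*$: $\Phi_k=(M^*-k)(M_*-k)$, $\Upsilon_k=M^*+M_*-2k-1$. *)

theory Defs
  imports "HOL-Probability.Probability" "Jordan_Normal_Form.Schur_Decomposition"
begin

definition cgauss :: "complex measure" where
  "cgauss = density lborel (\<lambda>z. ennreal (exp (- (cmod z * cmod z)) / pi))"

definition chan_measure :: "nat \<Rightarrow> nat \<Rightarrow> (nat \<times> nat \<Rightarrow> complex) measure" where
  "chan_measure Mr Mt = PiM ({..<Mr} \<times> {..<Mt}) (\<lambda>_. cgauss)"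

text \<open>Law of Gamma = |Gamma_c|^2: density exp(-gamma) on [0,inf).\<close>
definition gamma_measure :: "real measure" where
  "gamma_measure = density lborel (\<lambda>g. ennreal (exponential_density 1 g))"

definition chan_mat :: "nat \<Rightarrow> nat \<Rightarrow> (nat \<times> nat \<Rightarrow> complex) \<Rightarrow> complex mat" where
  "chan_mat Mr Mt H = mat Mr Mt (\<lambda>(i,j). H (i,j))"

text \<open>The multiset of eigenvalues of H H^H (roots of its characteristic polynomial, with
  multiplicity) with M_r - M_min zero eigenvalues removed: the eigenvalues lambda_1..lambda_{M_min}
  (the nonzero ones, almost surely).\<close>
definition nz_eigs :: "nat \<Rightarrow> nat \<Rightarrow> (nat \<times> nat \<Rightarrow> complex) \<Rightarrow> real multiset" where
  "nz_eigs Mr Mt H =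
     image_mset Re (proots (char_poly (chan_mat Mr Mt H * mat_adjoint (chan_mat Mr Mt H)))
                    - replicate_mset (Mr - min Mr Mt) 0)"

definition Phi :: "nat \<Rightarrow> nat \<Rightarrow> nat \<Rightarrow> real" where
  "Phi Mt Mr k = (real (max Mt Mr) - real k) * (real (min Mt Mr) - real k)"

definition Upsilon :: "nat \<Rightarrow> nat \<Rightarrow> nat \<Rightarrow> real" where
  "Upsilon Mt Mr k = real (max Mt Mr) + real (min Mt Mr) - 2 * real k - 1"

definition hda_sigma2 :: "real \<Rightarrow> real \<Rightarrow> real" where
  "hda_sigma2 eps R = 1 / (2 powr (R - eps) - 1)"

text \<open>Outage event O_h of HDA-LD (rho = SNR, rs = rho_s, s2 = sigma_Q^2, lam = eigenvalues, g = gamma).\<close>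
definition hda_outage :: "nat \<Rightarrow> nat \<Rightarrow> real \<Rightarrow> real \<Rightarrow> real \<Rightarrow> real \<Rightarrow> real multiset \<Rightarrow> real \<Rightarrow> bool" where
  "hda_outage Mt Mr b rho rs s2 lam g \<longleftrightarrow>
     (let M = min Mt Mr in
      power (1 + 1 / s2) M \<ge>
        power ((1 + rs * g) * (1 + s2)) M *
        (\<Prod>l\<in>#lam. (1 + rho / real M * l) powr (b * real M)) /
        (\<Prod>l\<in>#lam. 1 + rho / real M * l + (1 + rs * g) * s2))"

definition hda_D :: "nat \<Rightarrow> nat \<Rightarrow> real \<Rightarrow> real \<Rightarrow> real \<Rightarrow> real \<Rightarrow> real multiset \<Rightarrow> real \<Rightarrow> real" where
  "hda_D Mt Mr b rho rs s2 lam g =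
     (if hda_outage Mt Mr b rho rs s2 lam g then 1 / (1 + rs * g)
      else (let M = min Mt Mr in
            (1 / real M) * (\<Sum>l\<in>#lam. 1 / (1 + rs * g + (1 / s2) * (1 + rho / real M * l)))))"

text \<open>Expected distortion ED_h(R_h) at SNR rho, side-information SNR rs, rate R.\<close>
definition hda_ED :: "nat \<Rightarrow> nat \<Rightarrow> real \<Rightarrow> real \<Rightarrow> real \<Rightarrow> real \<Rightarrow> real \<Rightarrow> real" where
  "hda_ED Mt Mr b eps rho rs R =
     (\<integral>H. (\<integral>g. hda_D Mt Mr b rho rs (hda_sigma2 eps R) (nz_eigs Mr Mt H) g \<partial>gamma_measure)
        \<partial>chan_measure Mr Mt)"

end

theory Submission
  imports Defs
begin

text \<open>Writing \<open>u = 1 + \<rho>\<^sub>s \<gamma>\<close> and \<open>a\<^sub>i = 1 + \<rho> \<lambda>\<^sub>i / M\<close>, outage forces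
  \<open>(\<Prod>i. a\<^sub>i) powr (b M - 1) \<le> (1 + 1 / \<sigma>\<^sup>2) ^ M\<close>, whatever the side information is, and
  the distortion always lies between \<open>(1 / M) (\<Sum>i. 1 / (u + a\<^sub>i / \<sigma>\<^sup>2))\<close> and \<open>1 / u\<close>. Hence the exponent at
  rate \<open>r log \<rho>\<close> is \<open>min (max \<nu> (r + 1)) (\<nu> + d (r M / (b M - 1)))\<close>, where \<open>d\<close> is the
  diversity-multiplexing tradeoff curve, and its supremum over \<open>r\<close> is the common value of the increasing and the
  decreasing term where they cross.

  The curve \<open>d\<close> is obtained without the joint density of the eigenvalues. The inverse of
  \<open>det (1 + \<beta> H H\<^sup>H)\<close> is a Gaussian integral over an auxiliary vector, and in that integral one step of Gaussian
  elimination with pivot \<open>h\<close> splits off, up to constants, a factor \<open>1 / (1 + \<beta> \<bar>h\<bar>\<^sup>2)\<close> and leaves the same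
  integral for the Schur complement. If \<open>h\<close> dominates its row and column, these \<open>n + m - 1\<close> entries contribute
  probability \<open>\<bar>h\<bar> ^ (2 (n + m - 1))\<close>, which is where the exponents of the curve come from: complete pivoting and
  Chernoff's bound give the upper bound on the probability of a small determinant, a fixed pivot position the lower bound.\<close>

section \<open>Integrals over the complex plane\<close>

text \<open>At step \<open>l\<close>, a pivot of squared modulus \<open>rho powr (- t)\<close> costs
  probability \<open>rho powr (- t (n + m - 1 - 2 l))\<close> and gives the determinant a factor
  \<open>rho powr (1 - t)\<close>. The tradeoff curve at \<open>x\<close> is therefore a linear
  program: least total cost with the exponents \<open>1 - t\<close> adding up to at most
  \<open>x\<close>. The moment of order \<open>s\<close> of the inverse determinant is its dual:
  step \<open>l\<close> contributes an exponent arbitrarily close to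
  \<open>min s (n + m - 1 - 2 l)\<close>. Elimination preserves the Gaussian weight only up to
  constants in the exponent. Hence the inductions run over Lebesgue measure with an explicit weight
  and quantify over all constants. The eigenvalues form an unordered multiset of roots, so
  measurability of their functions is reached through determinants; a sum of reciprocals is a
  logarithmic derivative. At rate zero \<open>hda_sigma2\<close> is negative, so the exponent is
  computed for \<open>r > 0\<close>. The crossing point may lie at zero; the supremum is then
  approached by continuity.\<close>

lemma nn_integral_lborel_translate:
  fixes f :: "'a::euclidean_space \<Rightarrow> ennreal"
  assumes [measurable]: "f \<in> borel_measurable borel"
  shows "(\<integral>\<^sup>+x. f (x + c) \<partial>lborel) = (\<integral>\<^sup>+x. f x \<partial>lborel)"
proof -
  have "(\<integral>\<^sup>+x. f x \<partial>lborel) = (\<integral>\<^sup>+x. f x \<partial>(distr lborel borel ((+) c)))"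
    by (simp add: lborel_distr_plus)
  also have "\<dots> = (\<integral>\<^sup>+x. f (c + x) \<partial>lborel)"
    by (simp add: nn_integral_distr)
  finally show ?thesis by (simp add: add.commute)
qed

lemma nn_integral_exp_square:
  assumes "a > 0"
  shows "(\<integral>\<^sup>+(x::real). ennreal (exp (- (a * x\<^sup>2))) \<partial>lborel) = ennreal (sqrt (pi / a))"
proof -
  define s where "s = sqrt (1 / (2 * a))"
  have s: "s > 0" "s\<^sup>2 = 1 / (2 * a)" using assms by (auto simp: s_def)
  have nd: "ennreal (exp (- (a * x\<^sup>2))) = ennreal (sqrt (pi / a)) * ennreal (normal_density 0 s x)" for x
  proof -
    have "sqrt (pi / a) * normal_density 0 s x = exp (- (a * x\<^sup>2))"
      using assms by (simp add: normal_density_def s field_simps)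
    then have "ennreal (exp (- (a * x\<^sup>2))) = ennreal (sqrt (pi / a) * normal_density 0 s x)" by simp
    then show ?thesis by (simp add: ennreal_mult'')
  qed
  have "(\<integral>\<^sup>+x. ennreal (normal_density 0 s x) \<partial>lborel) = 1"
  proof -
    have "has_bochner_integral lborel (normal_density 0 s) 1"
      using s by (simp add: has_bochner_integral_iff)
    then show ?thesis
      by (subst nn_integral_eq_integral) (auto simp: has_bochner_integral_iff)
  qed
  then show ?thesis by (simp add: nd nn_integral_cmult)
qed

lemma nn_integral_complex_split:
  assumes [measurable]: "f \<in> borel_measurable borel" "g \<in> borel_measurable borel"
  shows "(\<integral>\<^sup>+z. f (Re z) * g (Im z) \<partial>lborel) = (\<integral>\<^sup>+x. f x \<partial>lborel) * (\<integral>\<^sup>+x. g x \<partial>lborel)"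
proof -
  have ne: "(1::complex) \<noteq> \<i>" by (simp add: complex_eq_iff)
  define F where "F b = (if b = (1::complex) then f else g)" for b
  have "(\<integral>\<^sup>+z. f (Re z) * g (Im z) \<partial>lborel) = (\<integral>\<^sup>+z. (\<Prod>b\<in>Basis. F b (z \<bullet> b)) \<partial>lborel)"
    using ne by (intro nn_integral_cong) (auto simp: Basis_complex_def F_def inner_complex_def)
  also have "\<dots> = (\<Prod>b\<in>Basis. (\<integral>\<^sup>+x. F b x \<partial>lborel))"
    by (rule nn_integral_lborel_prod) (auto simp: F_def)
  also have "\<dots> = (\<integral>\<^sup>+x. f x \<partial>lborel) * (\<integral>\<^sup>+x. g x \<partial>lborel)"
    using ne by (auto simp: Basis_complex_def F_def)
  finally show ?thesis .
qed

lemma nn_integral_complex_gauss: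
  assumes "a > 0"
  shows "(\<integral>\<^sup>+z. ennreal (exp (- (a * (cmod z)\<^sup>2))) \<partial>lborel) = ennreal (pi / a)"
proof -
  have "(\<integral>\<^sup>+z. ennreal (exp (- (a * (cmod z)\<^sup>2))) \<partial>lborel)
     = (\<integral>\<^sup>+z. ennreal (exp (- (a * (Re z)\<^sup>2))) * ennreal (exp (- (a * (Im z)\<^sup>2))) \<partial>lborel)"
    by (intro nn_integral_cong)
       (simp add: cmod_power2 distrib_left exp_add[symmetric] flip: ennreal_mult')
  also have "\<dots> = ennreal (sqrt (pi / a)) * ennreal (sqrt (pi / a))"
    using assms by (simp add: nn_integral_complex_split[where f="\<lambda>x. ennreal (exp (- (a * x\<^sup>2)))" and g="\<lambda>x. ennreal (exp (- (a * x\<^sup>2)))"] nn_integral_exp_square)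
  also have "\<dots> = ennreal (pi / a)"
    using assms by (simp flip: ennreal_mult')
  finally show ?thesis .
qed

lemma emeasure_complex_box:
  assumes "a \<le> b" "c \<le> d"
  shows "emeasure lborel {z. a \<le> Re z \<and> Re z \<le> b \<and> c \<le> Im z \<and> Im z \<le> d} = ennreal ((b - a) * (d - c))"
proof -
  have ne: "(1::complex) \<noteq> \<i>" by (simp add: complex_eq_iff)
  have "{z. a \<le> Re z \<and> Re z \<le> b \<and> c \<le> Im z \<and> Im z \<le> d} = cbox (Complex a c) (Complex b d)"
    by (auto simp: cbox_def Basis_complex_def inner_complex_def)
  then show ?thesis
    using assms ne by (simp add: emeasure_lborel_cbox_eq Basis_complex_def inner_complex_def)
qed

text \<open>Only the order \<open>r^2\<close> matters later, so this bound and the next two compare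
  with squares instead of computing areas in polar coordinates.\<close>

lemma emeasure_complex_disc_le:
  assumes "r \<ge> 0"
  shows "emeasure lborel {z. cmod z \<le> r} \<le> ennreal (4 * r\<^sup>2)"
proof -
  have "emeasure lborel {z. cmod z \<le> r} \<le> emeasure lborel {z. - r \<le> Re z \<and> Re z \<le> r \<and> - r \<le> Im z \<and> Im z \<le> r}"
    using abs_Re_le_cmod abs_Im_le_cmod
    by (intro emeasure_mono) (auto simp: abs_le_iff intro: order_trans, (smt (verit) abs_Re_le_cmod abs_Im_le_cmod)+)
  also have "\<dots> = ennreal (4 * r\<^sup>2)"
    using assms by (subst emeasure_complex_box) (auto simp: power2_eq_square)
  finally show ?thesis .
qed

lemma emeasure_complex_disc_ge:
  assumes "r \<ge> 0"
  shows "emeasure lborel {z. cmod z \<le> r} \<ge> ennreal (r\<^sup>2 / 4)"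
proof -
  have "ennreal (r\<^sup>2 / 4) = emeasure lborel {z. 0 \<le> Re z \<and> Re z \<le> r/2 \<and> 0 \<le> Im z \<and> Im z \<le> r/2}"
    using assms by (subst emeasure_complex_box) (auto simp: power2_eq_square)
  also have "\<dots> \<le> emeasure lborel {z. cmod z \<le> r}"
  proof (intro emeasure_mono subsetI CollectI)
    fix z assume "z \<in> {z. 0 \<le> Re z \<and> Re z \<le> r/2 \<and> 0 \<le> Im z \<and> Im z \<le> r/2}"
    then show "cmod z \<le> r" using cmod_le[of z] by auto
  qed auto
  finally show ?thesis .
qed

lemma emeasure_complex_annulus_ge:
  assumes "r \<ge> 0"
  shows "emeasure lborel {z. r \<le> cmod z \<and> cmod z \<le> 2 * r} \<ge> ennreal (r\<^sup>2 / 4)"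
proof -
  have "ennreal (r\<^sup>2 / 4) = emeasure lborel {z. r \<le> Re z \<and> Re z \<le> 3 * r/2 \<and> 0 \<le> Im z \<and> Im z \<le> r/2}"
    using assms by (subst emeasure_complex_box) (auto simp: power2_eq_square)
  also have "\<dots> \<le> emeasure lborel {z. r \<le> cmod z \<and> cmod z \<le> 2 * r}"
  proof (intro emeasure_mono subsetI CollectI)
    fix z assume z: "z \<in> {z. r \<le> Re z \<and> Re z \<le> 3 * r/2 \<and> 0 \<le> Im z \<and> Im z \<le> r/2}"
    then show "r \<le> cmod z \<and> cmod z \<le> 2 * r" using cmod_le[of z] complex_Re_le_cmod[of z] by auto
  qed auto
  finally show ?thesis .
qed

text \<open>Near the origin the power is integrable because \<open>d - 1 > -1\<close>. Beyond
  modulus 1 it is at most 1 because \<open>d \<le> 1\<close>, and the Gaussian factor takes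
  over.\<close>

lemma nn_integral_abs_powr_finite:
  assumes "d > 0" "d \<le> 1" "k > 0"
  shows "(\<integral>\<^sup>+(x::real). ennreal (\<bar>x\<bar> powr (d - 1) * exp (- (k * x\<^sup>2))) \<partial>lborel) < \<infinity>"
proof -
  let ?p = "\<lambda>x::real. ennreal (indicator {0..1} x * x powr (d - 1))"
  let ?n = "\<lambda>x::real. ennreal (indicator {-1..0} x * (- x) powr (d - 1))"
  have pw: "(\<integral>\<^sup>+x. ?p x \<partial>lborel) < \<infinity>"
  proof -
    have "((\<lambda>x. x powr (d - 1)) has_integral (1 powr (d - 1 + 1) / (d - 1 + 1))) {0..1}"
      using assms by (intro has_integral_powr_from_0) auto
    then show ?thesis
      by (subst nn_integral_has_integral_lebesgue) auto
  qed
  have pw2: "(\<integral>\<^sup>+x. ?n x \<partial>lborel) < \<infinity>"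
  proof -
    have "(\<integral>\<^sup>+x. ?p x \<partial>lborel) = ennreal \<bar>- 1\<bar> * (\<integral>\<^sup>+x. ?p (0 + (-1) * x) \<partial>lborel)"
      by (rule nn_integral_real_affine) auto
    also have "\<dots> = (\<integral>\<^sup>+x. ?n x \<partial>lborel)"
      by (simp, intro nn_integral_cong) (auto simp: indicator_def)
    finally show ?thesis using pw by simp
  qed
  have "(\<integral>\<^sup>+(x::real). ennreal (\<bar>x\<bar> powr (d - 1) * exp (- (k * x\<^sup>2))) \<partial>lborel)
      \<le> (\<integral>\<^sup>+x. (?p x + ?n x) + ennreal (exp (- (k * x\<^sup>2))) \<partial>lborel)"
  proof (intro nn_integral_mono)
    fix x :: real
    have "\<bar>x\<bar> powr (d - 1) * exp (- (k * x\<^sup>2)) \<le> indicator {0..1} x * x powr (d - 1) + indicator {-1..0} x * (- x) powr (d - 1) + exp (- (k * x\<^sup>2))"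
    proof (cases "\<bar>x\<bar> \<le> 1")
      case True
      have "exp (- (k * x\<^sup>2)) \<le> 1" using assms by simp
      then have "\<bar>x\<bar> powr (d - 1) * exp (- (k * x\<^sup>2)) \<le> \<bar>x\<bar> powr (d - 1)"
        by (simp add: mult_left_le)
      moreover have "\<bar>x\<bar> powr (d - 1) \<le> indicator {0..1} x * x powr (d - 1) + indicator {-1..0} x * (- x) powr (d - 1)"
        using True by (cases "x < 0") (auto simp: indicator_def)
      ultimately show ?thesis using exp_ge_zero[of "- (k * x\<^sup>2)"] by linarith
    next
      case False
      have "\<bar>x\<bar> powr (d - 1) \<le> \<bar>x\<bar> powr 0"
        using False assms by (intro powr_mono) auto
      then have "\<bar>x\<bar> powr (d - 1) * exp (- (k * x\<^sup>2)) \<le> 1 * exp (- (k * x\<^sup>2))"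
        using False by (intro mult_right_mono) (auto split: if_splits)
      then show ?thesis using False by (auto simp: indicator_def)
    qed
    then show "ennreal (\<bar>x\<bar> powr (d - 1) * exp (- (k * x\<^sup>2))) \<le> (?p x + ?n x) + ennreal (exp (- (k * x\<^sup>2)))"
      by (simp flip: ennreal_plus)
  qed
  also have "\<dots> = (\<integral>\<^sup>+x. ?p x \<partial>lborel) + (\<integral>\<^sup>+x. ?n x \<partial>lborel) + ennreal (sqrt (pi / k))"
    using nn_integral_exp_square[OF \<open>k > 0\<close>] by (simp add: nn_integral_add)
  also have "\<dots> < \<infinity>" using pw pw2 by simp
  finally show ?thesis .
qed

lemma power_le_exp:
  fixes y :: real assumes "y \<ge> 0" shows "y ^ n \<le> fact n * exp y"
proof -
  have s: "summable (\<lambda>i. y ^ i /\<^sub>R fact i)" by (rule summable_exp_generic)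
  have "y ^ n /\<^sub>R fact n \<le> (\<Sum>i. y ^ i /\<^sub>R fact i)"
    using sum_le_suminf[OF s, of "{n}"] assms by simp
  then show ?thesis by (simp add: exp_def field_simps)
qed

text \<open>A substitute for polar coordinates: the squared modulus is at least the product of the
  moduli of real and imaginary part, and the nonpositive exponent \<open>d - 1\<close> turns this
  into an upper bound by a product of one-dimensional integrands.\<close>

lemma nn_integral_complex_powr_finite:
  assumes "d > 0" "d \<le> 1" "k > 0"
  shows "(\<integral>\<^sup>+z. ennreal ((cmod z)\<^sup>2 powr (d - 1) * exp (- (k * (cmod z)\<^sup>2))) \<partial>lborel) < \<infinity>"
proof -
  let ?f = "\<lambda>x::real. ennreal (\<bar>x\<bar> powr (d - 1) * exp (- (k * x\<^sup>2)))"
  have "(\<integral>\<^sup>+z. ennreal ((cmod z)\<^sup>2 powr (d - 1) * exp (- (k * (cmod z)\<^sup>2))) \<partial>lborel)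
     \<le> (\<integral>\<^sup>+z. ?f (Re z) * ?f (Im z) \<partial>lborel)"
  proof (rule nn_integral_mono_AE)
    \<comment> \<open>On the coordinate axes the dominating product vanishes because
      \<open>0 powr e = 0\<close>, so the comparison can hold only almost everywhere.\<close>
    have n1: "AE z in lborel. Re z \<noteq> 0" and n2: "AE z in lborel. Im z \<noteq> 0"
    proof -
      have "(\<integral>\<^sup>+z. indicator {0} (Re z) * (\<lambda>_. 1) (Im z) \<partial>lborel) = (\<integral>\<^sup>+x. indicator {0} (x::real) \<partial>lborel) * (\<integral>\<^sup>+(x::real). 1 \<partial>lborel)"
        by (rule nn_integral_complex_split) auto
      then have "(\<integral>\<^sup>+z. indicator {0} (Re z) \<partial>lborel) = 0" by simp
      then have "AE z in lborel. indicator {0} (Re z) = (0::ennreal)"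
        by (subst (asm) nn_integral_0_iff_AE) auto
      then show "AE z in lborel. Re z \<noteq> 0" by eventually_elim (auto simp: indicator_def split: if_splits)
      have "(\<integral>\<^sup>+z. (\<lambda>_. 1) (Re z) * indicator {0} (Im z) \<partial>lborel) = (\<integral>\<^sup>+(x::real). 1 \<partial>lborel) * (\<integral>\<^sup>+x. indicator {0} (x::real) \<partial>lborel)"
        by (rule nn_integral_complex_split) auto
      then have "(\<integral>\<^sup>+z. indicator {0} (Im z) \<partial>lborel) = 0" by simp
      then have "AE z in lborel. indicator {0} (Im z) = (0::ennreal)"
        by (subst (asm) nn_integral_0_iff_AE) auto
      then show "AE z in lborel. Im z \<noteq> 0" by eventually_elim (auto simp: indicator_def split: if_splits)
    qed
    from n1 n2 show "AE z in lborel. ennreal ((cmod z)\<^sup>2 powr (d - 1) * exp (- (k * (cmod z)\<^sup>2))) \<le> ?f (Re z) * ?f (Im z)"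
    proof eventually_elim
      case (elim z)
      have "\<bar>Re z\<bar> * \<bar>Im z\<bar> \<le> cmod z * cmod z"
        by (intro mult_mono abs_Re_le_cmod abs_Im_le_cmod) auto
      then have "\<bar>Re z\<bar> * \<bar>Im z\<bar> \<le> (cmod z)\<^sup>2" by (simp add: power2_eq_square)
      then have "(cmod z)\<^sup>2 powr (d - 1) \<le> (\<bar>Re z\<bar> * \<bar>Im z\<bar>) powr (d - 1)"
        using elim assms by (intro powr_mono2') auto
      then have "(cmod z)\<^sup>2 powr (d - 1) * exp (- (k * (cmod z)\<^sup>2)) \<le>
         (\<bar>Re z\<bar> * \<bar>Im z\<bar>) powr (d - 1) * exp (- (k * (cmod z)\<^sup>2))"
        by (intro mult_right_mono) auto
      also have "\<dots> = (\<bar>Re z\<bar> powr (d - 1) * exp (- (k * (Re z)\<^sup>2))) * (\<bar>Im z\<bar> powr (d - 1) * exp (- (k * (Im z)\<^sup>2)))"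
        by (simp add: cmod_power2 powr_mult distrib_left exp_add[symmetric] mult_ac)
      finally show ?case by (simp flip: ennreal_mult')
    qed
  qed
  also have "\<dots> = (\<integral>\<^sup>+x. ?f x \<partial>lborel) * (\<integral>\<^sup>+x. ?f x \<partial>lborel)"
    by (rule nn_integral_complex_split) auto
  also have "\<dots> < \<infinity>"
    using nn_integral_abs_powr_finite[OF assms] by (simp add: ennreal_mult_less_top)
  finally show ?thesis .
qed

text \<open>The estimate keeps back a factor \<open>t powr (d - 1)\<close> with \<open>d > 0\<close>, the most singular one that is
  integrable at the origin.\<close>
lemma radial_integral_bound:
  fixes s p :: nat and q k c :: real
  assumes "0 \<le> q" "q \<le> s" "q < p + 1" "k > 0" "c > 0"
  shows "\<exists>C\<ge>0. \<forall>rho\<ge>1. (\<integral>\<^sup>+z. ennreal ((c / (1 + rho * (cmod z)\<^sup>2)) ^ s * (4 * (cmod z)\<^sup>2) ^ p * exp (- (k * (cmod z)\<^sup>2))) \<partial>lborel)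
     \<le> ennreal (C * rho powr (- q))"
proof -
  define d where "d = min 1 (p + 1 - q)"
  have d: "d > 0" "d \<le> 1" "real p - q \<ge> d - 1" using assms by (auto simp: d_def)
  define n where "n = nat \<lceil>p - q - (d - 1)\<rceil>"
  have n: "real p - q - (d - 1) \<le> n" using d by (simp add: n_def)
  let ?J = "(\<integral>\<^sup>+z. ennreal ((cmod z)\<^sup>2 powr (d - 1) * exp (- (k/2 * (cmod z)\<^sup>2))) \<partial>lborel)"
  have J: "?J < \<infinity>" using d assms by (intro nn_integral_complex_powr_finite) auto
  obtain K where K: "?J = ennreal K" "K \<ge> 0"
    using J by (cases ?J) auto
  \<comment> \<open>The excess power \<open>p - q - (d - 1)\<close> is nonnegative: below 1 it is
    harmless, above 1 half of the exponential absorbs it through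
    \<open>power_le_exp\<close>.\<close>
  have tp: "t powr (real p - q) * exp (- (k * t)) \<le> (1 + fact n * (2 / k) ^ n) * (t powr (d - 1) * exp (- (k/2 * t)))"
    if t: "t \<ge> 0" for t
  proof (cases "t = 0")
    case False
    then have t: "t > 0" using t by simp
    have "t powr (real p - q) = t powr (real p - q - (d - 1)) * t powr (d - 1)"
      by (simp flip: powr_add)
    also have "t powr (real p - q - (d - 1)) \<le> (1 + fact n * (2 / k) ^ n) * exp (k/2 * t)"
    proof (cases "t \<le> 1")
      case True
      have "t powr (real p - q - (d - 1)) \<le> 1 powr (real p - q - (d - 1))"
        using True t d by (intro powr_mono2) auto
      also have "\<dots> \<le> (1 + fact n * (2 / k) ^ n) * exp (k/2 * t)"
      proof -
        have "1 * 1 \<le> (1 + fact n * (2 / k) ^ n) * exp (k/2 * t)"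
          using assms t by (intro mult_mono) auto
        then show ?thesis by simp
      qed
      finally show ?thesis .
    next
      case False
      have "t powr (real p - q - (d - 1)) \<le> t powr n"
        using False n by (intro powr_mono) auto
      also have "\<dots> = (2 / k) ^ n * (k/2 * t) ^ n"
        using t assms by (simp add: powr_realpow field_simps)
      also have "\<dots> \<le> (2 / k) ^ n * (fact n * exp (k/2 * t))"
        using t assms by (intro mult_left_mono power_le_exp) auto
      also have "\<dots> \<le> (1 + fact n * (2 / k) ^ n) * exp (k/2 * t)"
        by (simp add: algebra_simps)
      finally show ?thesis .
    qed
    finally have "t powr (real p - q) * exp (- (k * t)) \<le> (1 + fact n * (2 / k) ^ n) * exp (k/2 * t) * t powr (d - 1) * exp (- (k * t))"
      by (simp add: mult_right_mono)
    also have "\<dots> = (1 + fact n * (2 / k) ^ n) * (t powr (d - 1) * (exp (k/2 * t) * exp (- (k * t))))"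
      by simp
    also have "exp (k/2 * t) * exp (- (k * t)) = exp (- (k/2 * t))"
      by (simp flip: exp_add)
    finally show ?thesis .
  qed simp
  define C where "C = c ^ s * 4 ^ p * (1 + fact n * (2 / k) ^ n) * K"
  have "(\<integral>\<^sup>+z. ennreal ((c / (1 + rho * (cmod z)\<^sup>2)) ^ s * (4 * (cmod z)\<^sup>2) ^ p * exp (- (k * (cmod z)\<^sup>2))) \<partial>lborel)
     \<le> ennreal (C * rho powr (- q))" if rho: "rho \<ge> 1" for rho
  proof -
    \<comment> \<open>Interpolation: since \<open>0 \<le> q\<close> and \<open>q \<le> s\<close>,
      \<open>(1 + y) ^ s\<close> is at least \<open>y powr q\<close> with
      \<open>y = rho * t\<close>. Decay of order \<open>q\<close> in \<open>rho\<close> is bought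
      with a singularity of order \<open>q\<close> at the origin, and \<open>t ^ p\<close> with the
      area element pays for it as long as \<open>q < p + 1\<close>.\<close>
    have pt: "(c / (1 + rho * t)) ^ s * (4 * t) ^ p * exp (- (k * t)) \<le>
       c ^ s * 4 ^ p * (1 + fact n * (2 / k) ^ n) * rho powr (- q) * (t powr (d - 1) * exp (- (k/2 * t)))"
      if t: "t > 0" for t
    proof -
      have y: "rho * t > 0" using t rho by simp
      have "(rho * t) powr q \<le> (1 + rho * t) powr q"
        using y assms by (intro powr_mono2) auto
      also have "\<dots> \<le> (1 + rho * t) powr s" using y assms by (intro powr_mono) auto
      also have "\<dots> = (1 + rho * t) ^ s" using y by (simp add: powr_realpow)
      finally have le: "1 / (1 + rho * t) ^ s \<le> 1 / (rho * t) powr q"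
        using y zero_less_power[of "1 + rho * t" s] by (intro divide_left_mono mult_pos_pos) auto
      have "(c / (1 + rho * t)) ^ s * (4 * t) ^ p * exp (- (k * t)) = c ^ s * 4 ^ p * (1 / (1 + rho * t) ^ s * (t ^ p * exp (- (k * t))))"
        by (simp add: power_divide power_mult_distrib)
      also have "\<dots> \<le> c ^ s * 4 ^ p * (1 / (rho * t) powr q * (t ^ p * exp (- (k * t))))"
        using le t assms by (intro mult_left_mono mult_right_mono) auto
      also have "1 / (rho * t) powr q * (t ^ p * exp (- (k * t))) = rho powr (- q) * (t powr (real p - q) * exp (- (k * t)))"
        using t rho by (simp add: powr_mult powr_diff powr_minus powr_realpow field_simps)
      also have "c ^ s * 4 ^ p * (rho powr (- q) * (t powr (real p - q) * exp (- (k * t)))) \<le>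
         c ^ s * 4 ^ p * (rho powr (- q) * ((1 + fact n * (2 / k) ^ n) * (t powr (d - 1) * exp (- (k/2 * t)))))"
        using tp[of t] t assms by (intro mult_left_mono) auto
      finally show ?thesis by (simp add: mult_ac)
    qed
    have "(\<integral>\<^sup>+z. ennreal ((c / (1 + rho * (cmod z)\<^sup>2)) ^ s * (4 * (cmod z)\<^sup>2) ^ p * exp (- (k * (cmod z)\<^sup>2))) \<partial>lborel)
      \<le> (\<integral>\<^sup>+z. ennreal (c ^ s * 4 ^ p * (1 + fact n * (2 / k) ^ n) * rho powr (- q)) * ennreal ((cmod z)\<^sup>2 powr (d - 1) * exp (- (k/2 * (cmod z)\<^sup>2))) \<partial>lborel)"
    proof (rule nn_integral_mono_AE)
      have "AE z in lborel. z \<noteq> (0::complex)" by (rule AE_lborel_singleton)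
      then show "AE z in lborel. ennreal ((c / (1 + rho * (cmod z)\<^sup>2)) ^ s * (4 * (cmod z)\<^sup>2) ^ p * exp (- (k * (cmod z)\<^sup>2)))
        \<le> ennreal (c ^ s * 4 ^ p * (1 + fact n * (2 / k) ^ n) * rho powr (- q)) * ennreal ((cmod z)\<^sup>2 powr (d - 1) * exp (- (k/2 * (cmod z)\<^sup>2)))"
      proof eventually_elim
        case (elim z)
        then show ?case using pt[of "(cmod z)\<^sup>2"] assms
          by (subst ennreal_mult'[symmetric]) (auto intro!: ennreal_leI)
      qed
    qed
    also have "\<dots> = ennreal (c ^ s * 4 ^ p * (1 + fact n * (2 / k) ^ n) * rho powr (- q)) * ennreal K"
      using K by (simp add: nn_integral_cmult)
    also have "\<dots> = ennreal (C * rho powr (- q))"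
      unfolding C_def using K by (subst ennreal_mult''[symmetric]) (auto simp: mult_ac)
    finally show ?thesis .
  qed
  moreover have "C \<ge> 0" using assms K by (auto simp: C_def)
  ultimately show ?thesis by blast
qed

section \<open>Gaussian integrals and Gaussian elimination\<close>

abbreviation leb :: "'a set \<Rightarrow> ('a \<Rightarrow> complex) measure" where
  "leb S \<equiv> PiM S (\<lambda>_. lborel)"

abbreviation sqnorm :: "'a set \<Rightarrow> ('a \<Rightarrow> complex) \<Rightarrow> real" where
  "sqnorm S H \<equiv> (\<Sum>p\<in>S. (cmod (H p))\<^sup>2)"

abbreviation gweight :: "real \<Rightarrow> 'a set \<Rightarrow> ('a \<Rightarrow> complex) \<Rightarrow> ennreal" where
  "gweight k S H \<equiv> ennreal (exp (- (k * sqnorm S H)))"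

lemma product_sigma_finite_lborel: "product_sigma_finite (\<lambda>_. lborel :: complex measure)"
  by standard

text \<open>For \<open>a = 1\<close> and \<open>b > 0\<close> this is \<open>pi ^ card I\<close>
  divided by \<open>det (1 + b H H\<^sup>H)\<close>. Arbitrary index sets allow a row and a column
  to be deleted without renumbering, and separate \<open>a\<close> and \<open>b\<close> record the
  constants lost at each elimination.\<close>

definition gint :: "'a set \<Rightarrow> 'b set \<Rightarrow> real \<Rightarrow> real \<Rightarrow> ('a \<times> 'b \<Rightarrow> complex) \<Rightarrow> ennreal" where
  "gint I J a b H = (\<integral>\<^sup>+z. ennreal (exp (- (a * (\<Sum>i\<in>I. (cmod (z i))\<^sup>2)
     + b * (\<Sum>j\<in>J. (cmod (\<Sum>i\<in>I. z i * H (i, j)))\<^sup>2)))) \<partial>(leb I))"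

definition schur :: "'a \<Rightarrow> 'b \<Rightarrow> ('a \<times> 'b \<Rightarrow> complex) \<Rightarrow> 'a \<times> 'b \<Rightarrow> complex" where
  "schur i0 j0 H = (\<lambda>(i, j). H (i, j) - H (i, j0) * H (i0, j) / H (i0, j0))"

definition pivot :: "'a set \<Rightarrow> 'b set \<Rightarrow> 'a \<Rightarrow> 'b \<Rightarrow> ('a \<times> 'b \<Rightarrow> complex) \<Rightarrow> bool" where
  "pivot I J i0 j0 H \<longleftrightarrow> (\<forall>i\<in>I. cmod (H (i, j0)) \<le> cmod (H (i0, j0))) \<and> (\<forall>j\<in>J. cmod (H (i0, j)) \<le> cmod (H (i0, j0)))"

lemma gint_cong:
  assumes "\<And>i j. i \<in> I \<Longrightarrow> j \<in> J \<Longrightarrow> H (i, j) = H' (i, j)"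
  shows "gint I J a b H = gint I J a b H'"
  unfolding gint_def using assms by (intro nn_integral_cong arg_cong[where f=ennreal] arg_cong[where f=exp]) simp

text \<open>The coefficient \<open>b\<close> varies with the parameter because, in the outage
  condition, side information rescales it; joint measurability in channel and side information rests
  on this form.\<close>

lemma measurable_gint [measurable (raw)]:
  assumes fin: "finite I"
    and b: "b \<in> borel_measurable M"
    and m: "\<And>i j. i \<in> I \<Longrightarrow> j \<in> J \<Longrightarrow> (\<lambda>x. h x (i, j)) \<in> borel_measurable M"
  shows "(\<lambda>x. gint I J a (b x) (h x)) \<in> borel_measurable M"
proof -
  interpret product_sigma_finite "\<lambda>_. lborel :: complex measure" by (rule product_sigma_finite_lborel)
  interpret S: sigma_finite_measure "PiM I (\<lambda>_. lborel :: complex measure)" by (rule sigma_finite[OF fin])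
  have z: "(\<lambda>x. snd x i) \<in> borel_measurable (M \<Otimes>\<^sub>M leb I)" if "i \<in> I" for i
  proof -
    have "(\<lambda>z. z i) \<in> borel_measurable (leb I)"
      using measurable_component_singleton[OF that, of "\<lambda>_. lborel :: complex measure"] by simp
    then show ?thesis by measurable
  qed
  have h: "(\<lambda>x. h (fst x) (i, j)) \<in> borel_measurable (M \<Otimes>\<^sub>M leb I)" if "i \<in> I" "j \<in> J" for i j
    using m[OF that] by measurable
  have b': "(\<lambda>x. b (fst x)) \<in> borel_measurable (M \<Otimes>\<^sub>M leb I)"
    using b by measurable
  show ?thesis
    unfolding gint_def
    apply (rule S.borel_measurable_nn_integral)
    unfolding split_def
    apply (intro measurable_compose[OF _ measurable_ennreal] measurable_compose[OF _ borel_measurable_exp]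
       borel_measurable_uminus borel_measurable_add borel_measurable_times borel_measurable_const borel_measurable_sum
       borel_measurable_power measurable_compose[OF _ borel_measurable_norm] b' z h)
       apply assumption+
    done
qed

lemma cmod_add_sq_le: "(cmod (p + q))\<^sup>2 \<le> 2 * (cmod p)\<^sup>2 + 2 * (cmod q)\<^sup>2"
proof -
  have "(cmod (p + q))\<^sup>2 \<le> (cmod p + cmod q)\<^sup>2"
    by (intro power_mono norm_triangle_ineq) auto
  also have "\<dots> \<le> 2 * (cmod p)\<^sup>2 + 2 * (cmod q)\<^sup>2"
    using sum_squares_bound[of "cmod p" "cmod q"] by (simp add: power2_sum)
  finally show ?thesis .
qed

text \<open>The factor \<open>t\<close> makes the negative term as small as desired, so that a sum
  of such bounds can be absorbed by a positive term elsewhere. The price is a constant.\<close>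

lemma cmod_add_sq_ge:
  assumes "0 \<le> t" "t \<le> 1"
  shows "(cmod (p + q))\<^sup>2 \<ge> t * ((cmod p)\<^sup>2 / 2 - (cmod q)\<^sup>2)"
proof -
  have "(cmod p)\<^sup>2 \<le> 2 * (cmod (p + q))\<^sup>2 + 2 * (cmod (- q))\<^sup>2"
    using cmod_add_sq_le[of "p + q" "- q"] by simp
  then have "(cmod p)\<^sup>2 / 2 - (cmod q)\<^sup>2 \<le> (cmod (p + q))\<^sup>2" by simp
  then have "t * ((cmod p)\<^sup>2 / 2 - (cmod q)\<^sup>2) \<le> t * (cmod (p + q))\<^sup>2"
    using assms by (intro mult_left_mono) auto
  also have "\<dots> \<le> (cmod (p + q))\<^sup>2" using assms by (simp add: mult_left_le_one_le)
  finally show ?thesis .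
qed

lemma cmod_sum_mult_sq_le:
  assumes "\<And>i. i \<in> I \<Longrightarrow> cmod (m i) \<le> 1"
  shows "(cmod (\<Sum>i\<in>I. z i * m i))\<^sup>2 \<le> card I * (\<Sum>i\<in>I. (cmod (z i))\<^sup>2)"
proof -
  have "cmod (\<Sum>i\<in>I. z i * m i) \<le> (\<Sum>i\<in>I. cmod (z i * m i))" by (rule norm_sum)
  also have "\<dots> \<le> (\<Sum>i\<in>I. cmod (z i) * 1)"
    unfolding norm_mult using assms by (intro sum_mono mult_left_mono) auto
  finally have "(cmod (\<Sum>i\<in>I. z i * m i))\<^sup>2 \<le> (\<Sum>i\<in>I. cmod (z i))\<^sup>2"
    by (intro power_mono) auto
  also have "\<dots> \<le> card I * (\<Sum>i\<in>I. (cmod (z i))\<^sup>2)"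
    using sum_squared_le_sum_of_squares[of "\<lambda>i. cmod (z i)" I] by (simp add: mult.commute)
  finally show ?thesis .
qed

text \<open>The substitution \<open>y = z i0 + (\<Sum>i. z i * H (i, j0) / H (i0, j0))\<close> is one step of Gaussian
  elimination. The junk value \<open>x / 0 = 0\<close> makes it valid for a vanishing pivot as well.\<close>
lemma gint_peel:
  assumes fin: "finite I" "finite J" and ij: "i0 \<in> I" "j0 \<in> J" and piv: "pivot I J i0 j0 H"
  shows "gint I J a b H = (\<integral>\<^sup>+z. (\<integral>\<^sup>+y. ennreal (exp (- (
      a * ((cmod (y - (\<Sum>i\<in>I-{i0}. z i * (H (i, j0) / H (i0, j0)))))\<^sup>2 + (\<Sum>i\<in>I-{i0}. (cmod (z i))\<^sup>2))
      + b * ((cmod (H (i0, j0)) * cmod y)\<^sup>2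
        + (\<Sum>j\<in>J-{j0}. (cmod (y * H (i0, j) + (\<Sum>i\<in>I-{i0}. z i * schur i0 j0 H (i, j))))\<^sup>2)))))
      \<partial>lborel) \<partial>(leb (I - {i0})))"
proof -
  interpret product_sigma_finite "\<lambda>_. lborel :: complex measure" by (rule product_sigma_finite_lborel)
  let ?I = "I - {i0}" and ?J = "J - {j0}"
  let ?f = "\<lambda>z. ennreal (exp (- (a * (\<Sum>i\<in>I. (cmod (z i))\<^sup>2)
     + b * (\<Sum>j\<in>J. (cmod (\<Sum>i\<in>I. z i * H (i, j)))\<^sup>2))))"
  define w where "w z = (\<Sum>i\<in>?I. z i * (H (i, j0) / H (i0, j0)))" for z
  have I: "insert i0 ?I = I" using ij by auto
  have z: "(\<lambda>x. x i) \<in> borel_measurable (leb I)" if "i \<in> I" for i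
      using measurable_component_singleton[OF that, of "\<lambda>_. lborel :: complex measure"] by simp
  have fm: "?f \<in> borel_measurable (leb I)"
    by (intro measurable_compose[OF _ measurable_ennreal] measurable_compose[OF _ borel_measurable_exp]
       borel_measurable_uminus borel_measurable_add borel_measurable_times borel_measurable_const borel_measurable_sum
       borel_measurable_power measurable_compose[OF _ borel_measurable_norm] z)
  have fm': "?f \<in> borel_measurable (leb (insert i0 ?I))"
    by (subst I) (rule fm)
  have "gint I J a b H = (\<integral>\<^sup>+z. (\<integral>\<^sup>+y. ?f (z(i0 := y)) \<partial>lborel) \<partial>(leb ?I))"
  proof -
    have "integral\<^sup>N (leb (insert i0 ?I)) ?f = (\<integral>\<^sup>+z. (\<integral>\<^sup>+y. ?f (z(i0 := y)) \<partial>lborel) \<partial>(leb ?I))"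
      using fin by (intro product_nn_integral_insert fm') auto
    then show ?thesis unfolding gint_def by (subst (asm) I)
  qed
  also have "\<dots> = (\<integral>\<^sup>+z. (\<integral>\<^sup>+y. ?f (z(i0 := y + (- w z))) \<partial>lborel) \<partial>(leb ?I))"
  proof (rule nn_integral_cong)
    fix z assume z: "z \<in> space (leb ?I)"
    have "(\<lambda>y. ?f (z(i0 := y))) \<in> borel_measurable lborel"
      using measurable_comp[OF measurable_component_update[OF z, of i0] fm'] by (simp add: comp_def)
    then show "(\<integral>\<^sup>+y. ?f (z(i0 := y)) \<partial>lborel) = (\<integral>\<^sup>+y. ?f (z(i0 := y + (- w z))) \<partial>lborel)"
      using nn_integral_lborel_translate[of "\<lambda>y. ?f (z(i0 := y))" "- w z"] by simp
  qed
  also have "\<dots> = (\<integral>\<^sup>+z. (\<integral>\<^sup>+y. ennreal (exp (- (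
      a * ((cmod (y - w z))\<^sup>2 + (\<Sum>i\<in>?I. (cmod (z i))\<^sup>2))
      + b * ((cmod (H (i0, j0)) * cmod y)\<^sup>2
        + (\<Sum>j\<in>?J. (cmod (y * H (i0, j) + (\<Sum>i\<in>?I. z i * schur i0 j0 H (i, j))))\<^sup>2)))))
      \<partial>lborel) \<partial>(leb ?I))"
  proof (intro nn_integral_cong)
    fix z :: "'a \<Rightarrow> complex" and y :: complex
    let ?z = "z(i0 := y + (- w z))"
    have s1: "(\<Sum>i\<in>I. (cmod (?z i))\<^sup>2) = (cmod (y - w z))\<^sup>2 + (\<Sum>i\<in>?I. (cmod (z i))\<^sup>2)"
    proof -
      have "(\<Sum>i\<in>I. (cmod (?z i))\<^sup>2) = (cmod (?z i0))\<^sup>2 + (\<Sum>i\<in>?I. (cmod (?z i))\<^sup>2)"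
        using fin ij by (intro sum.remove) auto
      also have "(\<Sum>i\<in>?I. (cmod (?z i))\<^sup>2) = (\<Sum>i\<in>?I. (cmod (z i))\<^sup>2)"
        by (intro sum.cong) auto
      finally show ?thesis by simp
    qed
    have s2: "(\<Sum>i\<in>I. ?z i * H (i, j)) = y * H (i0, j) + (\<Sum>i\<in>?I. z i * schur i0 j0 H (i, j))" for j
    proof -
      have "(\<Sum>i\<in>I. ?z i * H (i, j)) = ?z i0 * H (i0, j) + (\<Sum>i\<in>?I. ?z i * H (i, j))"
        using fin ij by (intro sum.remove) auto
      also have "(\<Sum>i\<in>?I. ?z i * H (i, j)) = (\<Sum>i\<in>?I. z i * H (i, j))"
        by (intro sum.cong) auto
      also have "?z i0 * H (i0, j) + \<dots> = y * H (i0, j) + (\<Sum>i\<in>?I. z i * schur i0 j0 H (i, j))"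
        by (simp add: w_def schur_def algebra_simps sum_subtractf sum_distrib_left)
      finally show ?thesis .
    qed
    \<comment> \<open>Elimination clears column \<open>j0\<close>. If the pivot is zero, dominance
      forces the entire column to vanish, so the claim survives division by zero.\<close>
    have s3: "(\<Sum>i\<in>?I. z i * schur i0 j0 H (i, j0)) = 0"
    proof (intro sum.neutral ballI)
      fix i assume "i \<in> ?I"
      then show "z i * schur i0 j0 H (i, j0) = 0"
        using piv by (cases "H (i0, j0) = 0") (auto simp: schur_def pivot_def)
    qed
    have s4: "(\<Sum>j\<in>J. (cmod (\<Sum>i\<in>I. ?z i * H (i, j)))\<^sup>2) = (cmod (H (i0, j0)) * cmod y)\<^sup>2
        + (\<Sum>j\<in>?J. (cmod (y * H (i0, j) + (\<Sum>i\<in>?I. z i * schur i0 j0 H (i, j))))\<^sup>2)"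
      unfolding s2 using fin ij by (subst sum.remove[of _ j0]) (auto simp: s3 norm_mult mult.commute)
    show "?f ?z = ennreal (exp (- (
      a * ((cmod (y - w z))\<^sup>2 + (\<Sum>i\<in>?I. (cmod (z i))\<^sup>2))
      + b * ((cmod (H (i0, j0)) * cmod y)\<^sup>2
        + (\<Sum>j\<in>?J. (cmod (y * H (i0, j) + (\<Sum>i\<in>?I. z i * schur i0 j0 H (i, j))))\<^sup>2)))))"
      unfolding s1 s4 ..
  qed
  finally show ?thesis unfolding w_def .
qed

lemma gint_separated:
  assumes "finite I" "k > 0"
  shows "(\<integral>\<^sup>+z. (\<integral>\<^sup>+y. ennreal (exp (- (k * (cmod y)\<^sup>2 + (a * (\<Sum>i\<in>I. (cmod (z i))\<^sup>2)
     + b * (\<Sum>j\<in>J. (cmod (\<Sum>i\<in>I. z i * H (i, j)))\<^sup>2))))) \<partial>lborel) \<partial>(leb I))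
   = ennreal (pi / k) * gint I J a b H"
proof -
  have z: "(\<lambda>x. x i) \<in> borel_measurable (leb I)" if "i \<in> I" for i
      using measurable_component_singleton[OF that, of "\<lambda>_. lborel :: complex measure"] by simp
  define r where "r z = a * (\<Sum>i\<in>I. (cmod (z i))\<^sup>2) + b * (\<Sum>j\<in>J. (cmod (\<Sum>i\<in>I. z i * H (i, j)))\<^sup>2)" for z
  have fm: "(\<lambda>z. ennreal (exp (- r z))) \<in> borel_measurable (leb I)"
    unfolding r_def
    by (intro measurable_compose[OF _ measurable_ennreal] measurable_compose[OF _ borel_measurable_exp]
       borel_measurable_uminus borel_measurable_add borel_measurable_times borel_measurable_const borel_measurable_sum
       borel_measurable_power measurable_compose[OF _ borel_measurable_norm] z)
  have "ennreal (exp (- (k * (cmod y)\<^sup>2 + r z))) = ennreal (exp (- r z)) * ennreal (exp (- (k * (cmod y)\<^sup>2)))" for y z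
    by (simp add: exp_add[symmetric] flip: ennreal_mult')
  then have "(\<integral>\<^sup>+y. ennreal (exp (- (k * (cmod y)\<^sup>2 + r z))) \<partial>lborel) = ennreal (exp (- r z)) * ennreal (pi / k)" for z
    by (simp only: nn_integral_complex_gauss[OF assms(2), symmetric]) (simp add: nn_integral_cmult)
  then have "(\<integral>\<^sup>+z. (\<integral>\<^sup>+y. ennreal (exp (- (k * (cmod y)\<^sup>2 + r z))) \<partial>lborel) \<partial>(leb I))
     = (\<integral>\<^sup>+z. ennreal (exp (- r z)) \<partial>(leb I)) * ennreal (pi / k)"
    using fm by (simp only: nn_integral_multc)
  then show ?thesis unfolding gint_def r_def by (simp only: mult.commute)
qed

text \<open>Dominance bounds the multipliers \<open>H (i, j0) / H (i0, j0)\<close> by 1 and the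
  products \<open>y * H (i0, j)\<close> by the pivot's modulus times that of \<open>y\<close>. The
  cross terms between \<open>y\<close> and the remaining variables can then be absorbed, and the
  \<open>y\<close>-integral separates. The constants come before \<open>rho\<close> and
  \<open>H\<close> in the quantifiers, as the later integration over \<open>H\<close>
  requires.\<close>

lemma gint_pivot_le:
  assumes fin: "finite I" "finite J" and ij: "i0 \<in> I" "j0 \<in> J" and ab: "a > 0" "b > 0"
  shows "\<exists>C>0. \<exists>a'>0. \<exists>b'>0. \<forall>rho\<ge>0. \<forall>H. pivot I J i0 j0 H \<longrightarrow>
    gint I J a (b * rho) H \<le> ennreal (C / (1 + rho * (cmod (H (i0, j0)))\<^sup>2)) * gint (I - {i0}) (J - {j0}) a' (b' * rho) (schur i0 j0 H)"
proof -
  let ?I = "I - {i0}" and ?J = "J - {j0}"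
  define N where "N = real (card ?I + card ?J)"
  \<comment> \<open>Chosen so that \<open>t * N \<le> 1/2\<close>: all cross terms together then
    consume at most half of each of the positive terms \<open>S\<close> and
    \<open>(?h * cmod y)\<^sup>2\<close>.\<close>
  define t where "t = 1 / (2 * (N + 1))"
  have N: "N \<ge> 0" by (simp add: N_def)
  have t: "t > 0" "t \<le> 1" "t * N \<le> 1/2" using N by (auto simp: t_def field_simps)
  \<comment> \<open>The smaller of the coefficients left over for the square of \<open>y\<close> and
    for its multiple by \<open>rho\<close> and the squared pivot, so that both combine into
    \<open>k * (1 + rho * ?h\<^sup>2)\<close>.\<close>
  define k where "k = min (a * t / 2) (b / 2)"
  have k: "k > 0" using ab t by (simp add: k_def)
  have "gint I J a (b * rho) H \<le> ennreal ((pi / k) / (1 + rho * (cmod (H (i0, j0)))\<^sup>2)) * gint ?I ?J (a / 2) (b * t / 2 * rho) (schur i0 j0 H)"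
    if rho: "rho \<ge> 0" and piv: "pivot I J i0 j0 H" for rho H
  proof -
    let ?h = "cmod (H (i0, j0))"
    have kk: "k * (1 + rho * ?h\<^sup>2) > 0" using k rho by (intro mult_pos_pos add_pos_nonneg) auto
    have m: "cmod (H (i, j0) / H (i0, j0)) \<le> 1" if "i \<in> ?I" for i
      using piv that by (cases "H (i0, j0) = 0") (auto simp: pivot_def norm_divide)
    have "gint I J a (b * rho) H \<le> (\<integral>\<^sup>+z. (\<integral>\<^sup>+y. ennreal (exp (- (k * (1 + rho * ?h\<^sup>2) * (cmod y)\<^sup>2 + (a / 2 * (\<Sum>i\<in>?I. (cmod (z i))\<^sup>2)
     + b * t / 2 * rho * (\<Sum>j\<in>?J. (cmod (\<Sum>i\<in>?I. z i * schur i0 j0 H (i, j)))\<^sup>2))))) \<partial>lborel) \<partial>(leb ?I))"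
      unfolding gint_peel[OF fin ij piv]
    proof (intro nn_integral_mono ennreal_leI exp_le_cancel_iff[THEN iffD2] le_imp_neg_le)
      fix z :: "'a \<Rightarrow> complex" and y :: complex
      define S where "S = (\<Sum>i\<in>?I. (cmod (z i))\<^sup>2)"
      define w where "w = (\<Sum>i\<in>?I. z i * (H (i, j0) / H (i0, j0)))"
      define q where "q j = (\<Sum>i\<in>?I. z i * schur i0 j0 H (i, j))" for j
      have S: "S \<ge> 0" by (simp add: S_def sum_nonneg)
      have "(cmod w)\<^sup>2 \<le> card ?I * S" unfolding w_def S_def by (rule cmod_sum_mult_sq_le[OF m])
      also have "\<dots> \<le> N * S" using S by (intro mult_right_mono) (auto simp: N_def)
      finally have w: "t * (cmod w)\<^sup>2 \<le> t * (N * S)" using t by (intro mult_left_mono) auto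
      have "t * (N * S) \<le> 1/2 * S" using t(3) S mult_right_mono[of "t * N" "1/2" S] by (simp add: mult.assoc)
      with w have w': "t * (cmod w)\<^sup>2 \<le> 1/2 * S" by linarith
      have "(cmod (y - w))\<^sup>2 \<ge> t * ((cmod y)\<^sup>2 / 2 - (cmod w)\<^sup>2)"
        using cmod_add_sq_ge[of t y "- w"] t by simp
      then have 1: "(cmod (y - w))\<^sup>2 \<ge> t / 2 * (cmod y)\<^sup>2 - S / 2"
        using w' by (simp add: right_diff_distrib)
      have "(\<Sum>j\<in>?J. (cmod (y * H (i0, j) + q j))\<^sup>2) \<ge> (\<Sum>j\<in>?J. t * ((cmod (q j))\<^sup>2 / 2 - (?h * cmod y)\<^sup>2))"
      proof (intro sum_mono)
        fix j assume j: "j \<in> ?J"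
        have "cmod (y * H (i0, j)) \<le> ?h * cmod y"
          using piv j by (simp add: pivot_def norm_mult mult.commute mult_left_mono)
        then have "(cmod (y * H (i0, j)))\<^sup>2 \<le> (?h * cmod y)\<^sup>2" by (intro power_mono) auto
        then have "t * ((cmod (q j))\<^sup>2 / 2 - (?h * cmod y)\<^sup>2) \<le> t * ((cmod (q j))\<^sup>2 / 2 - (cmod (y * H (i0, j)))\<^sup>2)"
          using t by (intro mult_left_mono) auto
        also have "\<dots> \<le> (cmod (q j + y * H (i0, j)))\<^sup>2" using t by (intro cmod_add_sq_ge) auto
        finally show "t * ((cmod (q j))\<^sup>2 / 2 - (?h * cmod y)\<^sup>2) \<le> (cmod (y * H (i0, j) + q j))\<^sup>2"
          by (simp add: add.commute)
      qed
      also have "(\<Sum>j\<in>?J. t * ((cmod (q j))\<^sup>2 / 2 - (?h * cmod y)\<^sup>2)) = t / 2 * (\<Sum>j\<in>?J. (cmod (q j))\<^sup>2) - t * (card ?J * (?h * cmod y)\<^sup>2)"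
        by (simp add: sum_subtractf right_diff_distrib sum_distrib_left)
      finally have "(\<Sum>j\<in>?J. (cmod (y * H (i0, j) + q j))\<^sup>2) \<ge> t / 2 * (\<Sum>j\<in>?J. (cmod (q j))\<^sup>2) - t * (card ?J * (?h * cmod y)\<^sup>2)" .
      moreover have "t * (card ?J * (?h * cmod y)\<^sup>2) \<le> 1/2 * (?h * cmod y)\<^sup>2"
      proof -
        have "t * card ?J \<le> t * N" using t by (intro mult_left_mono) (auto simp: N_def)
        then have "t * card ?J \<le> 1/2" using t by linarith
        then show ?thesis using mult_right_mono[of "t * card ?J" "1/2" "(?h * cmod y)\<^sup>2"] by (simp add: mult.assoc)
      qed
      ultimately have 2: "(?h * cmod y)\<^sup>2 + (\<Sum>j\<in>?J. (cmod (y * H (i0, j) + q j))\<^sup>2) \<ge> (?h * cmod y)\<^sup>2 / 2 + t / 2 * (\<Sum>j\<in>?J. (cmod (q j))\<^sup>2)"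
        by linarith
      have "k * (1 + rho * ?h\<^sup>2) * (cmod y)\<^sup>2 = k * (cmod y)\<^sup>2 + k * (rho * (?h * cmod y)\<^sup>2)"
        by (simp add: algebra_simps)
      also have "\<dots> \<le> (a * t / 2) * (cmod y)\<^sup>2 + b / 2 * (rho * (?h * cmod y)\<^sup>2)"
        using rho by (intro add_mono mult_right_mono) (auto simp: k_def)
      finally have 3: "k * (1 + rho * ?h\<^sup>2) * (cmod y)\<^sup>2 \<le> (a * t / 2) * (cmod y)\<^sup>2 + b / 2 * (rho * (?h * cmod y)\<^sup>2)" .
      have "a * (t / 2 * (cmod y)\<^sup>2 - S / 2) \<le> a * (cmod (y - w))\<^sup>2" using 1 ab by (intro mult_left_mono) auto
      moreover have "b * rho * ((?h * cmod y)\<^sup>2 / 2 + t / 2 * (\<Sum>j\<in>?J. (cmod (q j))\<^sup>2)) \<le> b * rho * ((?h * cmod y)\<^sup>2 + (\<Sum>j\<in>?J. (cmod (y * H (i0, j) + q j))\<^sup>2))"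
        using 2 ab rho by (intro mult_left_mono) auto
      ultimately show "k * (1 + rho * ?h\<^sup>2) * (cmod y)\<^sup>2 + (a / 2 * S + b * t / 2 * rho * (\<Sum>j\<in>?J. (cmod (q j))\<^sup>2))
        \<le> a * ((cmod (y - w))\<^sup>2 + S) + b * rho * ((?h * cmod y)\<^sup>2 + (\<Sum>j\<in>?J. (cmod (y * H (i0, j) + q j))\<^sup>2))"
        using 3 by (simp add: algebra_simps)
    qed
    also have "\<dots> = ennreal (pi / (k * (1 + rho * ?h\<^sup>2))) * gint ?I ?J (a / 2) (b * t / 2 * rho) (schur i0 j0 H)"
      using fin kk by (intro gint_separated) auto
    finally show ?thesis by simp
  qed
  then show ?thesis
    using k ab t by (intro exI[of _ "pi / k"] exI[of _ "a / 2"] exI[of _ "b * t / 2"] conjI) auto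
qed

text \<open>The same decoupling with the quadratic form bounded from above:
  \<open>cmod_add_sq_le\<close> doubles each term, and dominance moves the cross terms to the side
  of \<open>y\<close> or of \<open>z\<close>.\<close>

lemma gint_pivot_ge:
  assumes fin: "finite I" "finite J" and ij: "i0 \<in> I" "j0 \<in> J" and ab: "a > 0" "b > 0"
  shows "\<exists>C>0. \<exists>a'>0. \<exists>b'>0. \<forall>rho\<ge>0. \<forall>H. pivot I J i0 j0 H \<longrightarrow>
    gint I J a (b * rho) H \<ge> ennreal (C / (1 + rho * (cmod (H (i0, j0)))\<^sup>2)) * gint (I - {i0}) (J - {j0}) a' (b' * rho) (schur i0 j0 H)"
proof -
  let ?I = "I - {i0}" and ?J = "J - {j0}"
  define N where "N = real (card ?I + card ?J)"
  have N: "N \<ge> 0" by (simp add: N_def)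
  define k where "k = max (2 * a) (b * (1 + 2 * N))"
  have k: "k > 0" using ab by (simp add: k_def)
  have "gint I J a (b * rho) H \<ge> ennreal ((pi / k) / (1 + rho * (cmod (H (i0, j0)))\<^sup>2)) * gint ?I ?J (a * (1 + 2 * N)) (2 * b * rho) (schur i0 j0 H)"
    if rho: "rho \<ge> 0" and piv: "pivot I J i0 j0 H" for rho H
  proof -
    let ?h = "cmod (H (i0, j0))"
    have kk: "k * (1 + rho * ?h\<^sup>2) > 0" using k rho by (intro mult_pos_pos add_pos_nonneg) auto
    have m: "cmod (H (i, j0) / H (i0, j0)) \<le> 1" if "i \<in> ?I" for i
      using piv that by (cases "H (i0, j0) = 0") (auto simp: pivot_def norm_divide)
    have "ennreal ((pi / k) / (1 + rho * ?h\<^sup>2)) * gint ?I ?J (a * (1 + 2 * N)) (2 * b * rho) (schur i0 j0 H) =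
       ennreal (pi / (k * (1 + rho * ?h\<^sup>2))) * gint ?I ?J (a * (1 + 2 * N)) (2 * b * rho) (schur i0 j0 H)"
      by simp
    also have "\<dots> = (\<integral>\<^sup>+z. (\<integral>\<^sup>+y. ennreal (exp (- (k * (1 + rho * ?h\<^sup>2) * (cmod y)\<^sup>2 + (a * (1 + 2 * N) * (\<Sum>i\<in>?I. (cmod (z i))\<^sup>2)
     + 2 * b * rho * (\<Sum>j\<in>?J. (cmod (\<Sum>i\<in>?I. z i * schur i0 j0 H (i, j)))\<^sup>2))))) \<partial>lborel) \<partial>(leb ?I))"
      using fin kk by (intro gint_separated[symmetric]) auto
    also have "\<dots> \<le> gint I J a (b * rho) H"
      unfolding gint_peel[OF fin ij piv]
    proof (intro nn_integral_mono ennreal_leI exp_le_cancel_iff[THEN iffD2] le_imp_neg_le)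
      fix z :: "'a \<Rightarrow> complex" and y :: complex
      define S where "S = (\<Sum>i\<in>?I. (cmod (z i))\<^sup>2)"
      define w where "w = (\<Sum>i\<in>?I. z i * (H (i, j0) / H (i0, j0)))"
      define q where "q j = (\<Sum>i\<in>?I. z i * schur i0 j0 H (i, j))" for j
      have S: "S \<ge> 0" by (simp add: S_def sum_nonneg)
      have "(cmod w)\<^sup>2 \<le> card ?I * S" unfolding w_def S_def by (rule cmod_sum_mult_sq_le[OF m])
      also have "\<dots> \<le> N * S" using S by (intro mult_right_mono) (auto simp: N_def)
      finally have w: "(cmod w)\<^sup>2 \<le> N * S" .
      have 1: "(cmod (y - w))\<^sup>2 \<le> 2 * (cmod y)\<^sup>2 + 2 * (N * S)"
        using cmod_add_sq_le[of y "- w"] w by simp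
      have "(\<Sum>j\<in>?J. (cmod (y * H (i0, j) + q j))\<^sup>2) \<le> (\<Sum>j\<in>?J. 2 * (?h * cmod y)\<^sup>2 + 2 * (cmod (q j))\<^sup>2)"
      proof (intro sum_mono)
        fix j assume j: "j \<in> ?J"
        have "cmod (y * H (i0, j)) \<le> ?h * cmod y"
          using piv j by (simp add: pivot_def norm_mult mult.commute mult_left_mono)
        then have "(cmod (y * H (i0, j)))\<^sup>2 \<le> (?h * cmod y)\<^sup>2" by (intro power_mono) auto
        then show "(cmod (y * H (i0, j) + q j))\<^sup>2 \<le> 2 * (?h * cmod y)\<^sup>2 + 2 * (cmod (q j))\<^sup>2"
          using cmod_add_sq_le[of "y * H (i0, j)" "q j"] by linarith
      qed
      also have "\<dots> = 2 * (card ?J * (?h * cmod y)\<^sup>2) + 2 * (\<Sum>j\<in>?J. (cmod (q j))\<^sup>2)"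
        by (simp add: sum.distrib sum_distrib_left)
      also have "\<dots> \<le> 2 * (N * (?h * cmod y)\<^sup>2) + 2 * (\<Sum>j\<in>?J. (cmod (q j))\<^sup>2)"
        by (intro add_right_mono mult_left_mono mult_right_mono) (auto simp: N_def)
      finally have 2: "(?h * cmod y)\<^sup>2 + (\<Sum>j\<in>?J. (cmod (y * H (i0, j) + q j))\<^sup>2) \<le> (1 + 2 * N) * (?h * cmod y)\<^sup>2 + 2 * (\<Sum>j\<in>?J. (cmod (q j))\<^sup>2)"
        by (simp add: algebra_simps)
      have "(2 * a) * (cmod y)\<^sup>2 + b * (1 + 2 * N) * (rho * (?h * cmod y)\<^sup>2) \<le> k * (cmod y)\<^sup>2 + k * (rho * (?h * cmod y)\<^sup>2)"
        using rho by (intro add_mono mult_right_mono) (auto simp: k_def)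
      also have "\<dots> = k * (1 + rho * ?h\<^sup>2) * (cmod y)\<^sup>2"
        by (simp add: algebra_simps)
      finally have 3: "(2 * a) * (cmod y)\<^sup>2 + b * (1 + 2 * N) * (rho * (?h * cmod y)\<^sup>2) \<le> k * (1 + rho * ?h\<^sup>2) * (cmod y)\<^sup>2" .
      have "a * (cmod (y - w))\<^sup>2 \<le> a * (2 * (cmod y)\<^sup>2 + 2 * (N * S))" using 1 ab by (intro mult_left_mono) auto
      moreover have "b * rho * ((?h * cmod y)\<^sup>2 + (\<Sum>j\<in>?J. (cmod (y * H (i0, j) + q j))\<^sup>2)) \<le> b * rho * ((1 + 2 * N) * (?h * cmod y)\<^sup>2 + 2 * (\<Sum>j\<in>?J. (cmod (q j))\<^sup>2))"
        using 2 ab rho by (intro mult_left_mono) auto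
      ultimately show "a * ((cmod (y - w))\<^sup>2 + S) + b * rho * ((?h * cmod y)\<^sup>2 + (\<Sum>j\<in>?J. (cmod (y * H (i0, j) + q j))\<^sup>2))
         \<le> k * (1 + rho * ?h\<^sup>2) * (cmod y)\<^sup>2 + (a * (1 + 2 * N) * S + 2 * b * rho * (\<Sum>j\<in>?J. (cmod (q j))\<^sup>2))"
        using 3 by (simp add: algebra_simps)
    qed
    finally show ?thesis .
  qed
  then show ?thesis
    using k ab N by (intro exI[of _ "pi / k"] exI[of _ "a * (1 + 2 * N)"] exI[of _ "2 * b"] conjI) auto
qed

section \<open>Peeling a pivot off a matrix integral\<close>

lemma measurable_PiM_lborel_component:
  "p \<in> S \<Longrightarrow> (\<lambda>x. x p) \<in> borel_measurable (leb S)"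
  using measurable_component_singleton[of p S "\<lambda>_. lborel :: complex measure"] by simp

lemma distr_PiM_lborel_translate:
  assumes "finite S"
  shows "distr (leb S) (leb S) (\<lambda>x. \<lambda>p\<in>S. x p + (w p :: complex)) = leb S"
proof -
  interpret product_sigma_finite "\<lambda>_. lborel :: complex measure" by (rule product_sigma_finite_lborel)
  have m: "(\<lambda>x. \<lambda>p\<in>S. x p + w p) \<in> leb S \<rightarrow>\<^sub>M leb S"
    using measurable_PiM_lborel_component by (intro measurable_restrict) simp
  show ?thesis
  proof (rule PiM_eqI[OF assms])
    fix A :: "'a \<Rightarrow> complex set" assume A: "\<And>i. i \<in> S \<Longrightarrow> A i \<in> sets lborel"
    have B: "(\<lambda>x. x + w i) -` A i \<in> sets borel" if "i \<in> S" for i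
      using A[OF that] by (auto intro!: measurable_sets_borel[where M=borel])
    have "(\<lambda>x. \<lambda>p\<in>S. x p + w p) -` (Pi\<^sub>E S A) \<inter> space (leb S) = Pi\<^sub>E S (\<lambda>p. (\<lambda>x. x + w p) -` A p)"
      by (auto simp: space_PiM PiE_iff)
    then have "emeasure (distr (leb S) (leb S) (\<lambda>x. \<lambda>p\<in>S. x p + w p)) (Pi\<^sub>E S A)
      = emeasure (leb S) (Pi\<^sub>E S (\<lambda>p. (\<lambda>x. x + w p) -` A p))"
      using m A assms by (subst emeasure_distr) (auto intro!: sets_PiM_I_finite)
    also have "\<dots> = (\<Prod>p\<in>S. emeasure lborel ((\<lambda>x. x + w p) -` A p))"
      using B assms by (intro emeasure_PiM) auto
    also have "\<dots> = (\<Prod>p\<in>S. emeasure lborel (A p))"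
    proof (intro prod.cong refl)
      fix p assume p: "p \<in> S"
      have "emeasure lborel (A p) = emeasure (distr lborel borel ((+) (w p))) (A p)"
        by (simp add: lborel_distr_plus)
      also have "\<dots> = emeasure lborel ((+) (w p) -` A p \<inter> space lborel)"
        using A[OF p] by (intro emeasure_distr) auto
      also have "(+) (w p) -` A p \<inter> space lborel = (\<lambda>x. x + w p) -` A p"
        by (auto simp: add.commute)
      finally show "emeasure lborel ((\<lambda>x. x + w p) -` A p) = emeasure lborel (A p)" ..
    qed
    finally show "emeasure (distr (leb S) (leb S) (\<lambda>x. \<lambda>p\<in>S. x p + w p)) (Pi\<^sub>E S A) = (\<Prod>p\<in>S. emeasure lborel (A p))" .
  qed simp
qed

lemma nn_integral_PiM_lborel_translate:
  assumes "finite S" and f: "f \<in> borel_measurable (leb S)"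
  shows "(\<integral>\<^sup>+x. f (\<lambda>p\<in>S. x p + (w p :: complex)) \<partial>leb S) = (\<integral>\<^sup>+x. f x \<partial>leb S)"
proof -
  have m: "(\<lambda>x. \<lambda>p\<in>S. x p + w p) \<in> leb S \<rightarrow>\<^sub>M leb S"
    using measurable_PiM_lborel_component by (intro measurable_restrict) simp
  show ?thesis
    by (subst (2) distr_PiM_lborel_translate[OF assms(1), of w, symmetric], subst nn_integral_distr[OF m]) (simp_all add: f)
qed

text \<open>The inverse of an elimination step: the matrix with pivot \<open>a\<close>, pivot row
  and column taken from \<open>x\<close>, and Schur complement \<open>D\<close>.\<close>

definition comb :: "'a \<Rightarrow> 'b \<Rightarrow> complex \<Rightarrow> ('a \<times> 'b \<Rightarrow> complex) \<Rightarrow> ('a \<times> 'b \<Rightarrow> complex) \<Rightarrow> 'a \<times> 'b \<Rightarrow> complex" where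
  "comb i0 j0 a x D = (\<lambda>(i, j). if i = i0 \<and> j = j0 then a else if i = i0 \<or> j = j0 then x (i, j)
     else D (i, j) + x (i, j0) * x (i0, j) / a)"

definition cross :: "'a set \<Rightarrow> 'b set \<Rightarrow> 'a \<Rightarrow> 'b \<Rightarrow> ('a \<times> 'b) set" where
  "cross I J i0 j0 = {i0} \<times> (J - {j0}) \<union> (I - {i0}) \<times> {j0}"

lemma card_cross:
  assumes "finite I" "finite J" "i0 \<in> I" "j0 \<in> J"
  shows "finite (cross I J i0 j0)" "card (cross I J i0 j0) = card (I - {i0}) + card (J - {j0})"
proof -
  show "finite (cross I J i0 j0)" using assms by (simp add: cross_def)
  show "card (cross I J i0 j0) = card (I - {i0}) + card (J - {j0})"
    unfolding cross_def using assms by (subst card_Un_disjoint) (auto simp: card_cartesian_product)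
qed

text \<open>With pivot, row and column fixed, passing from the remaining entries to the Schur
  complement is a translation, which Lebesgue measure does not notice. This is the reason for
  working with Lebesgue measure and a weight rather than with the Gaussian law.\<close>

lemma nn_integral_matrix_peel:
  assumes fin: "finite I" "finite J" and ij: "i0 \<in> I" "j0 \<in> J"
    and f: "f \<in> borel_measurable (leb (I \<times> J))"
  shows "(\<integral>\<^sup>+H. f H \<partial>leb (I \<times> J)) =
    (\<integral>\<^sup>+a. (\<integral>\<^sup>+x. (\<integral>\<^sup>+D. f (restrict (comb i0 j0 a x D) (I \<times> J))
      \<partial>leb ((I - {i0}) \<times> (J - {j0}))) \<partial>leb (cross I J i0 j0)) \<partial>lborel)"
proof -
  interpret product_sigma_finite "\<lambda>_. lborel :: complex measure" by (rule product_sigma_finite_lborel)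
  let ?X = "cross I J i0 j0" and ?B = "(I - {i0}) \<times> (J - {j0})"
  have un: "insert (i0, j0) (?X \<union> ?B) = I \<times> J" using ij by (auto simp: cross_def)
  have nin: "(i0, j0) \<notin> ?X \<union> ?B" by (auto simp: cross_def)
  have disj: "?X \<inter> ?B = {}" by (auto simp: cross_def)
  have finX: "finite ?X" "finite ?B" using fin by (auto simp: cross_def)
  have f': "f \<in> borel_measurable (leb (insert (i0, j0) (?X \<union> ?B)))"
    unfolding un by (rule f)
  have "(\<integral>\<^sup>+H. f H \<partial>leb (I \<times> J)) = (\<integral>\<^sup>+a. (\<integral>\<^sup>+y. f (y((i0, j0) := a)) \<partial>leb (?X \<union> ?B)) \<partial>lborel)"
    using product_nn_integral_insert_rev[OF _ nin f'] finX unfolding un by simp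
  also have "\<dots> = (\<integral>\<^sup>+a. (\<integral>\<^sup>+x. (\<integral>\<^sup>+D. f (restrict (comb i0 j0 a x D) (I \<times> J))
      \<partial>leb ?B) \<partial>leb ?X) \<partial>lborel)"
  proof (rule nn_integral_cong)
    fix a :: complex
    have fa: "(\<lambda>y. f (y((i0, j0) := a))) \<in> borel_measurable (leb (?X \<union> ?B))"
    proof (rule measurable_compose[OF _ f'])
      show "(\<lambda>y. y((i0, j0) := a)) \<in> leb (?X \<union> ?B) \<rightarrow>\<^sub>M leb (insert (i0, j0) (?X \<union> ?B))"
        by (intro measurable_fun_upd[where J="?X \<union> ?B"]) auto
    qed
    have "(\<integral>\<^sup>+y. f (y((i0, j0) := a)) \<partial>leb (?X \<union> ?B)) =
      (\<integral>\<^sup>+x. (\<integral>\<^sup>+D. f ((merge ?X ?B (x, D))((i0, j0) := a)) \<partial>leb ?B) \<partial>leb ?X)"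
      by (rule product_nn_integral_fold[OF disj finX fa])
    also have "\<dots> = (\<integral>\<^sup>+x. (\<integral>\<^sup>+D. f (restrict (comb i0 j0 a x D) (I \<times> J))
      \<partial>leb ?B) \<partial>leb ?X)"
    proof (rule nn_integral_cong)
      fix x assume x: "x \<in> space (leb ?X)"
      have fx: "(\<lambda>D. f ((merge ?X ?B (x, D))((i0, j0) := a))) \<in> borel_measurable (leb ?B)"
      proof (rule measurable_compose[OF _ fa])
        show "(\<lambda>D. merge ?X ?B (x, D)) \<in> leb ?B \<rightarrow>\<^sub>M leb (?X \<union> ?B)"
          using x by (intro measurable_compose[OF _ measurable_merge]) auto
      qed
      have eq: "(merge ?X ?B (x, \<lambda>p\<in>?B. D p + x (fst p, j0) * x (i0, snd p) / a))((i0, j0) := a) = restrict (comb i0 j0 a x D) (I \<times> J)"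
        for D using ij by (auto simp: fun_eq_iff comb_def merge_def cross_def restrict_def)
      show "(\<integral>\<^sup>+D. f ((merge ?X ?B (x, D))((i0, j0) := a)) \<partial>leb ?B) =
        (\<integral>\<^sup>+D. f (restrict (comb i0 j0 a x D) (I \<times> J)) \<partial>leb ?B)"
        unfolding nn_integral_PiM_lborel_translate[OF finX(2) fx, of "\<lambda>p. x (fst p, j0) * x (i0, snd p) / a", symmetric] eq ..
    qed
    finally show "(\<integral>\<^sup>+y. f (y((i0, j0) := a)) \<partial>leb (?X \<union> ?B)) =
      (\<integral>\<^sup>+x. (\<integral>\<^sup>+D. f (restrict (comb i0 j0 a x D) (I \<times> J)) \<partial>leb ?B) \<partial>leb ?X)" .
  qed
  finally show ?thesis .
qed

lemma schur_comb:
  assumes "i \<in> I - {i0}" "j \<in> J - {j0}" "i0 \<in> I" "j0 \<in> J"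
  shows "schur i0 j0 (restrict (comb i0 j0 a x D) (I \<times> J)) (i, j) = D (i, j)"
  using assms by (auto simp: schur_def comb_def)

lemma ennreal_power_mono: "(a::ennreal) \<le> b \<Longrightarrow> a ^ n \<le> b ^ n"
  by (induction n) (auto intro: mult_mono)

lemma nn_integral_PiM_disc_le:
  assumes "finite X" "r \<ge> 0"
  shows "(\<integral>\<^sup>+x. (\<Prod>p\<in>X. indicator {z. cmod z \<le> r} (x p)) \<partial>leb X) \<le> ennreal ((4 * r\<^sup>2) ^ card X)"
proof -
  interpret product_sigma_finite "\<lambda>_. lborel :: complex measure" by (rule product_sigma_finite_lborel)
  have [measurable]: "{z. cmod z \<le> r} \<in> sets borel" by measurable
  have "(\<integral>\<^sup>+x. (\<Prod>p\<in>X. indicator {z. cmod z \<le> r} (x p)) \<partial>leb X) = (\<Prod>p\<in>X. emeasure lborel {z. cmod z \<le> r})"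
    using assms by (subst product_nn_integral_prod) auto
  also have "\<dots> \<le> (\<Prod>p\<in>X. ennreal (4 * r\<^sup>2))"
    using emeasure_complex_disc_le[OF assms(2)] by (auto intro: ennreal_power_mono)
  also have "\<dots> = ennreal ((4 * r\<^sup>2) ^ card X)" by (simp add: ennreal_power)
  finally show ?thesis .
qed

lemma nn_integral_PiM_disc_ge:
  assumes "finite X" "r \<ge> 0"
  shows "(\<integral>\<^sup>+x. (\<Prod>p\<in>X. indicator {z. cmod z \<le> r} (x p)) \<partial>leb X) \<ge> ennreal ((r\<^sup>2 / 4) ^ card X)"
proof -
  interpret product_sigma_finite "\<lambda>_. lborel :: complex measure" by (rule product_sigma_finite_lborel)
  have [measurable]: "{z. cmod z \<le> r} \<in> sets borel" by measurable
  have "(\<integral>\<^sup>+x. (\<Prod>p\<in>X. indicator {z. cmod z \<le> r} (x p)) \<partial>leb X) = (\<Prod>p\<in>X. emeasure lborel {z. cmod z \<le> r})"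
    using assms by (subst product_nn_integral_prod) auto
  moreover have "\<dots> \<ge> (\<Prod>p\<in>X. ennreal (r\<^sup>2 / 4))"
    using emeasure_complex_disc_ge[OF assms(2)] by (auto intro: ennreal_power_mono)
  moreover have "(\<Prod>p\<in>X. ennreal (r\<^sup>2 / 4)) = ennreal ((r\<^sup>2 / 4) ^ card X)" by (simp add: ennreal_power)
  ultimately show ?thesis by simp
qed

lemma gint_degenerate:
  assumes "finite I" "a > 0" "I = {} \<or> J = {}"
  shows "gint I J a b H = ennreal ((pi / a) ^ card I)"
proof -
  interpret product_sigma_finite "\<lambda>_. lborel :: complex measure" by (rule product_sigma_finite_lborel)
  have "gint I J a b H = (\<integral>\<^sup>+z. (\<Prod>i\<in>I. ennreal (exp (- (a * (cmod (z i))\<^sup>2)))) \<partial>leb I)"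
    unfolding gint_def
  proof (intro nn_integral_cong)
    fix z :: "'a \<Rightarrow> complex"
    have "(\<Sum>j\<in>J. (cmod (\<Sum>i\<in>I. z i * H (i, j)))\<^sup>2) = 0" using assms by auto
    then show "ennreal (exp (- (a * (\<Sum>i\<in>I. (cmod (z i))\<^sup>2) + b * (\<Sum>j\<in>J. (cmod (\<Sum>i\<in>I. z i * H (i, j)))\<^sup>2)))) = (\<Prod>i\<in>I. ennreal (exp (- (a * (cmod (z i))\<^sup>2))))"
      using assms by (simp add: prod_ennreal exp_sum[symmetric] sum_distrib_left sum_negf)
  qed
  also have "\<dots> = (\<Prod>i\<in>I. ennreal (pi / a))"
    using assms by (subst product_nn_integral_prod) (auto simp: nn_integral_complex_gauss)
  finally show ?thesis using assms by (simp add: ennreal_power)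
qed

lemma measurable_matrix_weight:
  assumes "finite S"
  shows "(\<lambda>H. gweight k S H) \<in> borel_measurable (leb S)"
  by (intro measurable_compose[OF _ measurable_ennreal] measurable_compose[OF _ borel_measurable_exp]
       borel_measurable_uminus borel_measurable_times borel_measurable_const borel_measurable_sum
       borel_measurable_power measurable_compose[OF _ borel_measurable_norm] measurable_PiM_lborel_component)

lemma measurable_gint_PiM:
  assumes "finite I"
  shows "(\<lambda>H. gint I J a b H) \<in> borel_measurable (leb (I \<times> J))"
  using assms by (intro measurable_gint measurable_PiM_lborel_component) auto

lemma measurable_pivot:
  assumes "finite I" "finite J" "i0 \<in> I" "j0 \<in> J"
  shows "Measurable.pred (leb (I \<times> J)) (pivot I J i0 j0)"
proof -
  have le: "Measurable.pred (leb (I \<times> J)) (\<lambda>H. cmod (H p) \<le> cmod (H q))"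
    if "p \<in> I \<times> J" "q \<in> I \<times> J" for p q
    unfolding pred_def
    by (intro borel_measurable_le measurable_compose[OF _ borel_measurable_norm] measurable_PiM_lborel_component that)
  show ?thesis unfolding pivot_def using assms
    by (intro pred_intros_logic pred_intros_finite le) auto
qed

lemma sum_matrix_split:
  assumes "finite I" "finite J" "i0 \<in> I" "j0 \<in> J"
  shows "sum f (I \<times> J) = f (i0, j0) + sum f (cross I J i0 j0) + sum f ((I - {i0}) \<times> (J - {j0}))"
proof -
  have "I \<times> J = insert (i0, j0) (cross I J i0 j0 \<union> (I - {i0}) \<times> (J - {j0}))"
    using assms by (auto simp: cross_def)
  moreover have "(i0, j0) \<notin> cross I J i0 j0 \<union> (I - {i0}) \<times> (J - {j0})" by (auto simp: cross_def)
  moreover have "cross I J i0 j0 \<inter> ((I - {i0}) \<times> (J - {j0})) = {}" by (auto simp: cross_def)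
  moreover have "finite (cross I J i0 j0)" "finite ((I - {i0}) \<times> (J - {j0}))" using assms by (auto simp: cross_def)
  ultimately show ?thesis by (simp add: sum.union_disjoint add.assoc)
qed

section \<open>Moments under complete pivoting\<close>

text \<open>Dominance is a condition on row and column alone, so the Schur complement ranges freely
  and its integral can be split off.\<close>

lemma pivot_comb:
  assumes "i0 \<in> I" "j0 \<in> J"
  shows "pivot I J i0 j0 (restrict (comb i0 j0 a x D) (I \<times> J)) \<longleftrightarrow> (\<forall>p\<in>cross I J i0 j0. cmod (x p) \<le> cmod a)"
  using assms by (force simp: pivot_def comb_def cross_def)

text \<open>Under dominance every shift \<open>x (i, j0) * x (i0, j) / a\<close> has modulus at most
  \<open>cmod a\<close>. Hence the squared norm of the assembled matrix is comparable to a separate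
  expression in \<open>a\<close> and \<open>D\<close>, and the Gaussian weight factors up to
  constants.\<close>

lemma comb_weight_bounds:
  fixes D :: "'a \<times> 'b \<Rightarrow> complex"
  assumes fin: "finite I" "finite J" and ij: "i0 \<in> I" "j0 \<in> J"
    and x: "\<forall>p\<in>cross I J i0 j0. cmod (x p) \<le> cmod a"
  defines "B \<equiv> (I - {i0}) \<times> (J - {j0})"
  defines "W \<equiv> (\<Sum>p\<in>I\<times>J. (cmod (restrict (comb i0 j0 a x D) (I \<times> J) p))\<^sup>2)"
  shows "(cmod a)\<^sup>2 / 2 + 1 / (4 * (real (card B) + 1)) * sqnorm B D \<le> W"
    and "W \<le> (cmod a)\<^sup>2 * (1 + real (card (cross I J i0 j0)) + 2 * real (card B)) + 2 * sqnorm B D"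
proof -
  let ?H = "restrict (comb i0 j0 a x D) (I \<times> J)"
  define w where "w p = x (fst p, j0) * x (i0, snd p) / a" for p
  have W: "W = (cmod a)\<^sup>2 + sqnorm (cross I J i0 j0) x + (\<Sum>p\<in>B. (cmod (D p + w p))\<^sup>2)"
  proof -
    have "sqnorm (cross I J i0 j0) ?H = sqnorm (cross I J i0 j0) x"
      using ij by (intro sum.cong) (auto simp: cross_def comb_def)
    moreover have "sqnorm B ?H = (\<Sum>p\<in>B. (cmod (D p + w p))\<^sup>2)"
      using ij by (intro sum.cong) (auto simp: B_def comb_def w_def)
    moreover have "?H (i0, j0) = a" using ij by (simp add: comb_def)
    ultimately show ?thesis unfolding W_def using fin ij by (subst sum_matrix_split[of I J i0 j0]) (auto simp: B_def)
  qed
  have wle: "(cmod (w p))\<^sup>2 \<le> (cmod a)\<^sup>2" if "p \<in> B" for p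
  proof (cases "a = 0")
    case False
    have "cmod (x (fst p, j0)) * cmod (x (i0, snd p)) \<le> cmod a * cmod a"
      using x that by (intro mult_mono) (auto simp: cross_def B_def)
    then have "cmod (w p) \<le> cmod a" using False by (simp add: w_def norm_mult norm_divide field_simps)
    then show ?thesis by (intro power_mono) auto
  qed (simp add: w_def)
  have xle: "sqnorm (cross I J i0 j0) x \<le> real (card (cross I J i0 j0)) * (cmod a)\<^sup>2"
    using x sum_bounded_above[of "cross I J i0 j0" "\<lambda>p. (cmod (x p))\<^sup>2" "(cmod a)\<^sup>2"] by (simp add: power_mono)
  have x0: "sqnorm (cross I J i0 j0) x \<ge> 0" by (simp add: sum_nonneg)
  \<comment> \<open>With \<open>t * card B \<le> 1/2\<close> the shifts take away at most half of
    the squared pivot, which supplies the other half in the first bound.\<close>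
  define t where "t = 1 / (2 * (real (card B) + 1))"
  have t: "t \<ge> 0" "t \<le> 1" "t * card B \<le> 1/2" by (auto simp: t_def field_simps)
  have "(\<Sum>p\<in>B. (cmod (D p + w p))\<^sup>2) \<ge> (\<Sum>p\<in>B. t * ((cmod (D p))\<^sup>2 / 2 - (cmod a)\<^sup>2))"
  proof (intro sum_mono)
    fix p assume "p \<in> B"
    then have "t * ((cmod (D p))\<^sup>2 / 2 - (cmod a)\<^sup>2) \<le> t * ((cmod (D p))\<^sup>2 / 2 - (cmod (w p))\<^sup>2)"
      using wle t by (intro mult_left_mono) auto
    also have "\<dots> \<le> (cmod (D p + w p))\<^sup>2" using t by (intro cmod_add_sq_ge) auto
    finally show "t * ((cmod (D p))\<^sup>2 / 2 - (cmod a)\<^sup>2) \<le> (cmod (D p + w p))\<^sup>2" .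
  qed
  also have "(\<Sum>p\<in>B. t * ((cmod (D p))\<^sup>2 / 2 - (cmod a)\<^sup>2)) = t / 2 * sqnorm B D - t * card B * (cmod a)\<^sup>2"
    by (simp add: sum_subtractf right_diff_distrib sum_distrib_left)
  finally have "(\<Sum>p\<in>B. (cmod (D p + w p))\<^sup>2) \<ge> t / 2 * sqnorm B D - t * card B * (cmod a)\<^sup>2" .
  moreover have "t * card B * (cmod a)\<^sup>2 \<le> 1/2 * (cmod a)\<^sup>2" using t by (intro mult_right_mono) auto
  moreover have "t / 2 = 1 / (4 * (real (card B) + 1))" by (simp add: t_def field_simps)
  ultimately show "(cmod a)\<^sup>2 / 2 + 1 / (4 * (real (card B) + 1)) * sqnorm B D \<le> W"
    unfolding W using x0 by simp
  have "(\<Sum>p\<in>B. (cmod (D p + w p))\<^sup>2) \<le> (\<Sum>p\<in>B. 2 * (cmod (D p))\<^sup>2 + 2 * (cmod a)\<^sup>2)"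
    using wle by (intro sum_mono order_trans[OF cmod_add_sq_le]) auto
  also have "\<dots> = 2 * sqnorm B D + 2 * card B * (cmod a)\<^sup>2"
    by (simp add: sum.distrib sum_distrib_left)
  finally show "W \<le> (cmod a)\<^sup>2 * (1 + real (card (cross I J i0 j0)) + 2 * real (card B)) + 2 * sqnorm B D"
    unfolding W using xle by (simp add: algebra_simps)
qed

text \<open>The \<open>card I + card J - 2\<close> entries dominated by the pivot \<open>z\<close>
  have volume of order \<open>cmod z\<close> to twice that number; the area element of
  \<open>z\<close> adds one more square, whence the strict bound on \<open>q0\<close>. The induction
  hypothesis covers all constants because elimination changes them.\<close>

lemma gint_moment_step:
  fixes q0 Q k :: real and s :: nat
  assumes fin: "finite I" "finite J" and ij: "i0 \<in> I" "j0 \<in> J" and ab: "a > 0" "b > 0" "k > 0"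
    and q0: "0 \<le> q0" "q0 \<le> s" "q0 < real (card I) + real (card J) - 1"
    and IH: "\<And>a b k. a > 0 \<Longrightarrow> b > 0 \<Longrightarrow> k > 0 \<Longrightarrow> \<exists>C\<ge>0. \<forall>rho\<ge>1.
      (\<integral>\<^sup>+H. gint (I - {i0}) (J - {j0}) a (b * rho) H ^ s * gweight k ((I - {i0})\<times>(J - {j0})) H \<partial>leb ((I - {i0}) \<times> (J - {j0})))
      \<le> ennreal (C * rho powr (- Q))"
  shows "\<exists>C\<ge>0. \<forall>rho\<ge>1.
      (\<integral>\<^sup>+H. gint I J a (b * rho) H ^ s * gweight k (I\<times>J) H * indicator {H. pivot I J i0 j0 H} H \<partial>leb (I \<times> J))
      \<le> ennreal (C * rho powr (- (q0 + Q)))"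
proof -
  let ?B = "(I - {i0}) \<times> (J - {j0})" and ?X = "cross I J i0 j0"
  define k' where "k' = k * (1 / (4 * (real (card ?B) + 1)))"
  have k': "k' > 0" using ab by (simp add: k'_def)
  obtain C1 a' b' where C1: "C1 > 0" "a' > 0" "b' > 0" and g: "\<And>rho H. rho \<ge> 0 \<Longrightarrow> pivot I J i0 j0 H \<Longrightarrow>
    gint I J a (b * rho) H \<le> ennreal (C1 / (1 + rho * (cmod (H (i0, j0)))\<^sup>2)) * gint (I - {i0}) (J - {j0}) a' (b' * rho) (schur i0 j0 H)"
    using gint_pivot_le[OF fin ij ab(1,2)] by blast
  obtain C2 where C2: "C2 \<ge> 0" and ih: "\<And>rho. rho \<ge> 1 \<Longrightarrow>
     (\<integral>\<^sup>+H. gint (I - {i0}) (J - {j0}) a' (b' * rho) H ^ s * gweight k' ?B H \<partial>leb ?B)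
      \<le> ennreal (C2 * rho powr (- Q))"
    using IH[OF C1(2,3) k'] by blast
  have cardX: "finite ?X" "card ?X = card (I - {i0}) + card (J - {j0})" by (rule card_cross[OF fin ij])+
  have cI: "card I = Suc (card (I - {i0}))" "card J = Suc (card (J - {j0}))"
    by (rule card.remove[OF fin(1) ij(1)], rule card.remove[OF fin(2) ij(2)])
  have q0': "q0 < card ?X + 1" using q0 cI cardX by simp
  obtain C3 where C3: "C3 \<ge> 0" and rad: "\<And>rho. rho \<ge> 1 \<Longrightarrow> (\<integral>\<^sup>+z. ennreal ((C1 / (1 + rho * (cmod z)\<^sup>2)) ^ s * (4 * (cmod z)\<^sup>2) ^ card ?X * exp (- (k/2 * (cmod z)\<^sup>2))) \<partial>lborel)
     \<le> ennreal (C3 * rho powr (- q0))"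
    using radial_integral_bound[OF q0(1,2) q0', of "k/2" C1] ab(3) C1(1) by fastforce
  have "(\<integral>\<^sup>+H. gint I J a (b * rho) H ^ s * gweight k (I\<times>J) H * indicator {H. pivot I J i0 j0 H} H \<partial>leb (I \<times> J))
      \<le> ennreal (C3 * C2 * rho powr (- (q0 + Q)))" if rho: "rho \<ge> 1" for rho
  proof -
    define E where "E = (\<integral>\<^sup>+H. gint (I - {i0}) (J - {j0}) a' (b' * rho) H ^ s * gweight k' ?B H \<partial>leb ?B)"
    define A where "A z = (C1 / (1 + rho * (cmod z)\<^sup>2)) ^ s * exp (- (k/2 * (cmod z)\<^sup>2))" for z
    have A0: "A z \<ge> 0" for z using C1 rho by (simp add: A_def)
    let ?f = "\<lambda>H. gint I J a (b * rho) H ^ s * gweight k (I\<times>J) H * indicator {H. pivot I J i0 j0 H} H"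
    have f: "?f \<in> borel_measurable (leb (I \<times> J))"
      using fin ij measurable_pivot[OF fin ij]
      by (intro borel_measurable_times_ennreal borel_measurable_power_ennreal measurable_gint_PiM measurable_matrix_weight
          borel_measurable_indicator') (auto simp: pred_def)
    have "(\<integral>\<^sup>+H. ?f H \<partial>leb (I \<times> J)) =
      (\<integral>\<^sup>+z. (\<integral>\<^sup>+x. (\<integral>\<^sup>+D. ?f (restrict (comb i0 j0 z x D) (I \<times> J)) \<partial>leb ?B) \<partial>leb ?X) \<partial>lborel)"
      by (rule nn_integral_matrix_peel[OF fin ij f])
    also have "\<dots> \<le> (\<integral>\<^sup>+z. (\<integral>\<^sup>+x. (\<integral>\<^sup>+D. (ennreal (A z) * (\<Prod>p\<in>?X. indicator {y. cmod y \<le> cmod z} (x p))) *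
          (gint (I - {i0}) (J - {j0}) a' (b' * rho) D ^ s * gweight k' ?B D)
           \<partial>leb ?B) \<partial>leb ?X) \<partial>lborel)"
    proof (intro nn_integral_mono)
      fix z :: complex and x D :: "'a \<times> 'b \<Rightarrow> complex"
      let ?H = "restrict (comb i0 j0 z x D) (I \<times> J)"
      show "?f ?H \<le> (ennreal (A z) * (\<Prod>p\<in>?X. indicator {y. cmod y \<le> cmod z} (x p))) *
          (gint (I - {i0}) (J - {j0}) a' (b' * rho) D ^ s * gweight k' ?B D)"
      proof (cases "pivot I J i0 j0 ?H")
        case True
        then have x: "\<forall>p\<in>?X. cmod (x p) \<le> cmod z" using pivot_comb[OF ij] by blast
        have Hz: "?H (i0, j0) = z" using ij by (simp add: comb_def)
        have gs: "gint (I - {i0}) (J - {j0}) a' (b' * rho) (schur i0 j0 ?H) = gint (I - {i0}) (J - {j0}) a' (b' * rho) D"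
          using ij by (intro gint_cong schur_comb) auto
        have "gint I J a (b * rho) ?H ^ s \<le> (ennreal (C1 / (1 + rho * (cmod z)\<^sup>2)) * gint (I - {i0}) (J - {j0}) a' (b' * rho) D) ^ s"
          using g[OF _ True, of rho] rho unfolding Hz gs by (intro ennreal_power_mono) auto
        also have "\<dots> = ennreal ((C1 / (1 + rho * (cmod z)\<^sup>2)) ^ s) * gint (I - {i0}) (J - {j0}) a' (b' * rho) D ^ s"
          using C1 rho by (simp add: power_mult_distrib ennreal_power)
        finally have 1: "gint I J a (b * rho) ?H ^ s \<le> ennreal ((C1 / (1 + rho * (cmod z)\<^sup>2)) ^ s) * gint (I - {i0}) (J - {j0}) a' (b' * rho) D ^ s" .
        have "k * ((cmod z)\<^sup>2 / 2 + 1 / (4 * (real (card ?B) + 1)) * sqnorm ?B D) \<le> k * sqnorm (I\<times>J) ?H"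
          using comb_weight_bounds(1)[OF fin ij x, of D] ab by (intro mult_left_mono) auto
        then have "exp (- (k * sqnorm (I\<times>J) ?H)) \<le> exp (- (k/2 * (cmod z)\<^sup>2) + - (k' * sqnorm ?B D))"
          by (simp add: k'_def distrib_left)
        also have "\<dots> = exp (- (k/2 * (cmod z)\<^sup>2)) * exp (- (k' * sqnorm ?B D))"
          by (rule exp_add)
        finally have 2: "gweight k (I\<times>J) ?H \<le> ennreal (exp (- (k/2 * (cmod z)\<^sup>2))) * gweight k' ?B D"
          by (subst ennreal_mult'[symmetric]) (auto intro: ennreal_leI)
        have 3: "(\<Prod>p\<in>?X. indicator {y. cmod y \<le> cmod z} (x p)) = (1::ennreal)"
          using x by (intro prod.neutral) auto
        have "?f ?H = gint I J a (b * rho) ?H ^ s * gweight k (I\<times>J) ?H"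
          using True by simp
        also have "\<dots> \<le> (ennreal ((C1 / (1 + rho * (cmod z)\<^sup>2)) ^ s) * gint (I - {i0}) (J - {j0}) a' (b' * rho) D ^ s) *
           (ennreal (exp (- (k/2 * (cmod z)\<^sup>2))) * gweight k' ?B D)"
          using 1 2 by (intro mult_mono) auto
        also have "\<dots> = ennreal (A z) * (gint (I - {i0}) (J - {j0}) a' (b' * rho) D ^ s * gweight k' ?B D)"
          using C1 rho unfolding A_def by (subst ennreal_mult') (auto simp: mult_ac)
        finally show ?thesis unfolding 3 by (simp only: mult_1_right)
      next
        case False
        then have z: "indicator {H. pivot I J i0 j0 H} ?H = (0::ennreal)"
          by (intro indicator_simps(2)) blast
        show ?thesis unfolding z mult_zero_right by (rule zero_le)
      qed
    qed
    also have "\<dots> = (\<integral>\<^sup>+z. (\<integral>\<^sup>+x. (ennreal (A z) * (\<Prod>p\<in>?X. indicator {y. cmod y \<le> cmod z} (x p))) * E \<partial>leb ?X) \<partial>lborel)"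
      unfolding E_def using fin
      by (intro nn_integral_cong nn_integral_cmult borel_measurable_times_ennreal borel_measurable_power_ennreal
          measurable_gint_PiM measurable_matrix_weight) auto
    also have "\<dots> = (\<integral>\<^sup>+z. (ennreal (A z) * E) * (\<integral>\<^sup>+x. (\<Prod>p\<in>?X. indicator {y. cmod y \<le> cmod z} (x p)) \<partial>leb ?X) \<partial>lborel)"
    proof (intro nn_integral_cong)
      fix z :: complex
      have m: "(\<lambda>x. \<Prod>p\<in>?X. indicator {y. cmod y \<le> cmod z} (x p) :: ennreal) \<in> borel_measurable (leb ?X)"
        by (intro borel_measurable_prod_ennreal measurable_compose[OF measurable_PiM_lborel_component] borel_measurable_indicator) auto
      show "(\<integral>\<^sup>+x. (ennreal (A z) * (\<Prod>p\<in>?X. indicator {y. cmod y \<le> cmod z} (x p))) * E \<partial>leb ?X)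
        = (ennreal (A z) * E) * (\<integral>\<^sup>+x. (\<Prod>p\<in>?X. indicator {y. cmod y \<le> cmod z} (x p)) \<partial>leb ?X)"
        using nn_integral_cmult[OF m, of "ennreal (A z) * E"] by (simp add: mult_ac)
    qed
    also have "\<dots> \<le> (\<integral>\<^sup>+z. (ennreal (A z) * E) * ennreal ((4 * (cmod z)\<^sup>2) ^ card ?X) \<partial>lborel)"
      using cardX by (intro nn_integral_mono mult_left_mono nn_integral_PiM_disc_le) auto
    also have "\<dots> = (\<integral>\<^sup>+z. ennreal ((C1 / (1 + rho * (cmod z)\<^sup>2)) ^ s * (4 * (cmod z)\<^sup>2) ^ card ?X * exp (- (k/2 * (cmod z)\<^sup>2))) * E \<partial>lborel)"
    proof (intro nn_integral_cong)
      fix z :: complex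
      have "ennreal ((C1 / (1 + rho * (cmod z)\<^sup>2)) ^ s * (4 * (cmod z)\<^sup>2) ^ card ?X * exp (- (k/2 * (cmod z)\<^sup>2))) = ennreal (A z * (4 * (cmod z)\<^sup>2) ^ card ?X)"
        by (simp add: A_def mult_ac)
      also have "\<dots> = ennreal (A z) * ennreal ((4 * (cmod z)\<^sup>2) ^ card ?X)"
        using A0[of z] by (intro ennreal_mult) auto
      finally show "(ennreal (A z) * E) * ennreal ((4 * (cmod z)\<^sup>2) ^ card ?X) =
        ennreal ((C1 / (1 + rho * (cmod z)\<^sup>2)) ^ s * (4 * (cmod z)\<^sup>2) ^ card ?X * exp (- (k/2 * (cmod z)\<^sup>2))) * E"
        by (simp add: mult_ac)
    qed
    also have "\<dots> = (\<integral>\<^sup>+z. ennreal ((C1 / (1 + rho * (cmod z)\<^sup>2)) ^ s * (4 * (cmod z)\<^sup>2) ^ card ?X * exp (- (k/2 * (cmod z)\<^sup>2))) \<partial>lborel) * E"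
      by (rule nn_integral_multc) measurable
    also have "\<dots> \<le> ennreal (C3 * rho powr (- q0)) * ennreal (C2 * rho powr (- Q))"
      using rad[OF rho] ih[OF rho] by (intro mult_mono) (auto simp: E_def)
    also have "\<dots> = ennreal (C3 * C2 * rho powr (- q0 + - Q))"
      using C2 C3 rho unfolding powr_add by (subst ennreal_mult[symmetric]) (auto simp: mult_ac)
    finally show ?thesis by simp
  qed
  then show ?thesis using C2 C3 by (intro exI[of _ "C3 * C2"]) auto
qed

text \<open>Complete pivoting: some entry of maximal modulus is a pivot, so the moment is bounded by the
  sum over all pivot positions.\<close>
lemma gint_moment_le:
  fixes q :: "nat \<Rightarrow> real" and s :: nat
  assumes "finite I" "finite J" "a > 0" "b > 0" "k > 0"
    and "\<And>l. l < min (card I) (card J) \<Longrightarrow> 0 \<le> q l \<and> q l \<le> s \<and> q l < real (card I) + real (card J) - 1 - 2 * real l"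
  shows "\<exists>C\<ge>0. \<forall>rho\<ge>1.
      (\<integral>\<^sup>+H. gint I J a (b * rho) H ^ s * gweight k (I\<times>J) H \<partial>leb (I \<times> J))
      \<le> ennreal (C * rho powr (- (\<Sum>l<min (card I) (card J). q l)))"
  using assms
proof (induction "card I" arbitrary: I J a b k q)
  case 0
  then have I: "I = {}" by simp
  interpret product_sigma_finite "\<lambda>_. lborel :: complex measure" by (rule product_sigma_finite_lborel)
  show ?case
    using 0 unfolding I by (intro exI[of _ 1]) (simp add: nn_integral_empty gint_degenerate space_PiM)
next
  case (Suc n)
  interpret product_sigma_finite "\<lambda>_. lborel :: complex measure" by (rule product_sigma_finite_lborel)
  show ?case
  proof (cases "J = {}")
    case True
    have "gint I J a b' H ^ s = ennreal (((pi / a) ^ card I) ^ s)" for b' H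
      using Suc.prems True by (simp add: gint_degenerate ennreal_power)
    then show ?thesis
      using Suc.prems True by (intro exI[of _ "((pi / a) ^ card I) ^ s"]) (simp add: nn_integral_empty space_PiM)
  next
    case False
    have Ine: "I \<noteq> {}" using Suc by auto
    let ?f = "\<lambda>rho H. gint I J a (b * rho) H ^ s * gweight k (I\<times>J) H"
    let ?Q = "\<Sum>l<min (card I) (card J). q l"
    have ex: "\<exists>C\<ge>0. \<forall>rho\<ge>1. (\<integral>\<^sup>+H. ?f rho H * indicator {H. pivot I J i0 j0 H} H \<partial>leb (I \<times> J)) \<le> ennreal (C * rho powr (- ?Q))"
      if ij: "i0 \<in> I" "j0 \<in> J" for i0 j0
    proof -
      have cI: "card I = Suc (card (I - {i0}))" "card J = Suc (card (J - {j0}))"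
        by (rule card.remove[OF Suc.prems(1) ij(1)], rule card.remove[OF Suc.prems(2) ij(2)])
      have mn: "min (card I) (card J) = Suc (min (card (I - {i0})) (card (J - {j0})))" using cI by simp
      \<comment> \<open>The first exponent is spent on the first pivot. The remaining matrix has one
        row and one column less, which turns the bound for index \<open>Suc l\<close> into the bound
        for index \<open>l\<close>.\<close>
      have Q: "?Q = q 0 + (\<Sum>l<min (card (I - {i0})) (card (J - {j0})). q (Suc l))"
        unfolding mn by (rule sum.lessThan_Suc_shift)
      have q0: "0 \<le> q 0" "q 0 \<le> s" "q 0 < real (card I) + real (card J) - 1"
        using Suc.prems(6)[of 0] mn by auto
      show ?thesis unfolding Q
      proof (rule gint_moment_step[OF Suc.prems(1,2) ij Suc.prems(3-5) q0], goal_cases)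
        case (1 a' b' k')
        show ?case
        proof (rule Suc.hyps(1))
          show "n = card (I - {i0})" using Suc.hyps(2) cI by simp
          show "0 \<le> q (Suc l) \<and> q (Suc l) \<le> s \<and> q (Suc l) < real (card (I - {i0})) + real (card (J - {j0})) - 1 - 2 * real l"
            if "l < min (card (I - {i0})) (card (J - {j0}))" for l
            using Suc.prems(6)[of "Suc l"] that mn cI by simp
        qed (use 1 Suc.prems(1,2) in auto)
      qed
    qed
    have "\<forall>p\<in>I\<times>J. \<exists>C\<ge>0. \<forall>rho\<ge>1. (\<integral>\<^sup>+H. ?f rho H * indicator {H. pivot I J (fst p) (snd p) H} H \<partial>leb (I \<times> J)) \<le> ennreal (C * rho powr (- ?Q))"
      by (intro ballI, intro ex) auto
    from bchoice[OF this] obtain C where CC: "\<forall>p\<in>I\<times>J. C p \<ge> 0 \<and> (\<forall>rho\<ge>1.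
      (\<integral>\<^sup>+H. ?f rho H * indicator {H. pivot I J (fst p) (snd p) H} H \<partial>leb (I \<times> J)) \<le> ennreal (C p * rho powr (- ?Q)))"
      by (rule exE)
    have C: "C p \<ge> 0" if "p \<in> I \<times> J" for p
      by (rule conjunct1[OF bspec[OF CC that]])
    have Cb: "(\<integral>\<^sup>+H. ?f rho H * indicator {H. pivot I J (fst p) (snd p) H} H \<partial>leb (I \<times> J)) \<le> ennreal (C p * rho powr (- ?Q))"
      if "p \<in> I \<times> J" "rho \<ge> 1" for p rho
      by (rule conjunct2[OF bspec[OF CC that(1)], rule_format, OF that(2)])
    have finIJ: "finite (I \<times> J)" using Suc.prems by auto
    have "(\<integral>\<^sup>+H. ?f rho H \<partial>leb (I \<times> J)) \<le> ennreal ((\<Sum>p\<in>I\<times>J. C p) * rho powr (- ?Q))" if rho: "rho \<ge> 1" for rho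
    proof -
      have "(\<integral>\<^sup>+H. ?f rho H \<partial>leb (I \<times> J)) \<le> (\<integral>\<^sup>+H. (\<Sum>p\<in>I\<times>J. ?f rho H * indicator {H. pivot I J (fst p) (snd p) H} H) \<partial>leb (I \<times> J))"
      proof (intro nn_integral_mono)
        fix H :: "'a \<times> 'b \<Rightarrow> complex"
        let ?S = "(\<lambda>p. cmod (H p)) ` (I \<times> J)"
        have fi: "finite ?S" "?S \<noteq> {}"
          by (rule finite_imageI[OF finIJ]) (use False Ine in simp)
        obtain p where p: "p \<in> I \<times> J" and pM: "Max ?S = cmod (H p)"
          using Max_in[OF fi] by (rule imageE)
        have le: "cmod (H p') \<le> cmod (H p)" if "p' \<in> I \<times> J" for p'
          unfolding pM[symmetric] by (rule Max_ge[OF fi(1)], rule imageI, rule that)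
        have "cmod (H (i, snd p)) \<le> cmod (H p)" if "i \<in> I" for i
          by (rule le) (use that p in \<open>simp add: mem_Times_iff\<close>)
        moreover have "cmod (H (fst p, j)) \<le> cmod (H p)" if "j \<in> J" for j
          by (rule le) (use that p in \<open>simp add: mem_Times_iff\<close>)
        ultimately have "pivot I J (fst p) (snd p) H" unfolding pivot_def prod.collapse by blast
        then have "indicator {H. pivot I J (fst p) (snd p) H} H = (1::ennreal)"
          by (intro indicator_simps(1)) blast
        then have "?f rho H = ?f rho H * indicator {H. pivot I J (fst p) (snd p) H} H" by (simp only: mult_1_right)
        also have "\<dots> \<le> (\<Sum>p\<in>I\<times>J. ?f rho H * indicator {H. pivot I J (fst p) (snd p) H} H)"
          by (rule member_le_sum[OF p zero_le finIJ])
        finally show "?f rho H \<le> (\<Sum>p\<in>I\<times>J. ?f rho H * indicator {H. pivot I J (fst p) (snd p) H} H)" .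
      qed
      also have "\<dots> = (\<Sum>p\<in>I\<times>J. (\<integral>\<^sup>+H. ?f rho H * indicator {H. pivot I J (fst p) (snd p) H} H \<partial>leb (I \<times> J)))"
      proof (intro nn_integral_sum)
        fix p assume p: "p \<in> I \<times> J"
        have m: "Measurable.pred (leb (I \<times> J)) (pivot I J (fst p) (snd p))"
          using p Suc.prems by (intro measurable_pivot) auto
        show "(\<lambda>H. ?f rho H * indicator {H. pivot I J (fst p) (snd p) H} H) \<in> borel_measurable (leb (I \<times> J))"
          using Suc.prems finIJ m
          by (intro borel_measurable_times_ennreal borel_measurable_power_ennreal measurable_gint_PiM measurable_matrix_weight
            borel_measurable_indicator') (auto simp: pred_def)
      qed
      also have "\<dots> \<le> (\<Sum>p\<in>I\<times>J. ennreal (C p * rho powr (- ?Q)))"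
        using Cb rho by (intro sum_mono) auto
      also have "\<dots> = ennreal ((\<Sum>p\<in>I\<times>J. C p) * rho powr (- ?Q))"
        using C by (subst sum_ennreal) (auto simp: sum_distrib_right)
      finally show ?thesis .
    qed
    moreover have "(\<Sum>p\<in>I\<times>J. C p) \<ge> 0" using C by (intro sum_nonneg) auto
    ultimately show ?thesis by blast
  qed
qed

section \<open>Tail probabilities from below\<close>

text \<open>The pivot is confined to an annulus of radius about \<open>rho powr (- t0 / 2)\<close>
  and its row and column to the inner disc, so dominance is automatic. This event has probability of
  order \<open>rho powr (- (t0 * (card I + card J - 1)))\<close>, and on it the pivot's factor in
  \<open>gint_pivot_ge\<close> is at least of order \<open>rho powr (- (1 - t0))\<close>.\<close>

lemma gint_tail_step:
  fixes t0 T S :: real and k :: real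
  assumes fin: "finite I" "finite J" and ij: "i0 \<in> I" "j0 \<in> J" and ab: "a > 0" "b > 0" "k > 0"
    and t0: "0 \<le> t0" "t0 \<le> 1"
    and IH: "\<And>a b k. a > 0 \<Longrightarrow> b > 0 \<Longrightarrow> k > 0 \<Longrightarrow> \<exists>c>0. \<forall>rho\<ge>1.
      ennreal (c * rho powr (- T)) \<le>
      (\<integral>\<^sup>+H. indicator {H. ennreal (c * rho powr (- S)) \<le> gint (I - {i0}) (J - {j0}) a (b * rho) H} H
         * gweight k ((I - {i0})\<times>(J - {j0})) H \<partial>leb ((I - {i0}) \<times> (J - {j0})))"
  shows "\<exists>c>0. \<forall>rho\<ge>1.
      ennreal (c * rho powr (- (t0 * (real (card I) + real (card J) - 1) + T))) \<le>
      (\<integral>\<^sup>+H. indicator {H. ennreal (c * rho powr (- ((1 - t0) + S))) \<le> gint I J a (b * rho) H} H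
         * gweight k (I\<times>J) H \<partial>leb (I \<times> J))"
proof -
  let ?B = "(I - {i0}) \<times> (J - {j0})" and ?X = "cross I J i0 j0"
  obtain C1 a' b' where C1: "C1 > 0" "a' > 0" "b' > 0" and g: "\<And>rho H. rho \<ge> 0 \<Longrightarrow> pivot I J i0 j0 H \<Longrightarrow>
    ennreal (C1 / (1 + rho * (cmod (H (i0, j0)))\<^sup>2)) * gint (I - {i0}) (J - {j0}) a' (b' * rho) (schur i0 j0 H) \<le> gint I J a (b * rho) H"
    using gint_pivot_ge[OF fin ij ab(1,2)] by blast
  have k2: "2 * k > 0" using ab by simp
  obtain c1 where c1: "c1 > 0" and ih: "\<And>rho. rho \<ge> 1 \<Longrightarrow>
     ennreal (c1 * rho powr (- T)) \<le>
      (\<integral>\<^sup>+H. indicator {H. ennreal (c1 * rho powr (- S)) \<le> gint (I - {i0}) (J - {j0}) a' (b' * rho) H} H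
         * gweight (2 * k) ?B H \<partial>leb ?B)"
    using IH[OF C1(2,3) k2] by blast
  have cardX: "finite ?X" "card ?X = card (I - {i0}) + card (J - {j0})" by (rule card_cross[OF fin ij])+
  have cI: "card I = Suc (card (I - {i0}))" "card J = Suc (card (J - {j0}))"
    by (rule card.remove[OF fin(1) ij(1)], rule card.remove[OF fin(2) ij(2)])
  \<comment> \<open>A lower bound for the Gaussian weight of pivot, row and column:
    \<open>cmod z\<close> is at most 2 on the annulus, and the rest is the second bound of
    \<open>comb_weight_bounds\<close>.\<close>
  define K where "K = exp (- (k * (4 * (1 + real (card ?X) + 2 * real (card ?B)))))"
  have K: "K > 0" by (simp add: K_def)
  \<comment> \<open>The same constant multiplies the threshold and the probability, so it is the
    minimum of what the two allow. The 5 comes from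
    \<open>1 + rho * (cmod z)\<^sup>2 \<le> 5 * rho powr (1 - t0)\<close>; each 1/4 comes from the
    area bound of the annulus or of a disc.\<close>
  define c where "c = min (C1 / 5 * c1) (K * (1/4) ^ Suc (card ?X) * c1)"
  have c: "c > 0" "c \<le> C1 / 5 * c1" "c \<le> K * (1/4) ^ Suc (card ?X) * c1" using C1 c1 K by (auto simp: c_def)
  have "ennreal (c * rho powr (- (t0 * (real (card I) + real (card J) - 1) + T))) \<le>
      (\<integral>\<^sup>+H. indicator {H. ennreal (c * rho powr (- ((1 - t0) + S))) \<le> gint I J a (b * rho) H} H
         * gweight k (I\<times>J) H \<partial>leb (I \<times> J))"
    if rho: "rho \<ge> 1" for rho
  proof -
    define r where "r = sqrt (rho powr (- t0))"
    have r: "r > 0" "r\<^sup>2 = rho powr (- t0)" using rho by (auto simp: r_def)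
    have rt1: "rho powr (- t0) \<le> 1" using rho t0 powr_mono[of "- t0" 0 rho] by simp
    let ?f = "\<lambda>H. indicator {H. ennreal (c * rho powr (- ((1 - t0) + S))) \<le> gint I J a (b * rho) H} H
         * gweight k (I\<times>J) H"
    let ?h = "\<lambda>D. indicator {H. ennreal (c1 * rho powr (- S)) \<le> gint (I - {i0}) (J - {j0}) a' (b' * rho) H} D
         * gweight (2 * k) ?B D"
    have f: "?f \<in> borel_measurable (leb (I \<times> J))"
      using fin
      by (intro borel_measurable_times_ennreal measurable_matrix_weight borel_measurable_indicator')
        (auto intro!: borel_measurable_le measurable_gint_PiM)
    have h: "?h \<in> borel_measurable (leb ?B)"
      using fin
      by (intro borel_measurable_times_ennreal measurable_matrix_weight borel_measurable_indicator')
        (auto intro!: borel_measurable_le measurable_gint_PiM)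
    let ?Az = "\<lambda>z. ennreal K * indicator {z. r \<le> cmod z \<and> cmod z \<le> 2 * r} z"
    let ?Px = "\<lambda>x. \<Prod>p\<in>?X. indicator {y. cmod y \<le> r} (x p) :: ennreal"
    have mP: "?Px \<in> borel_measurable (leb ?X)"
      by (intro borel_measurable_prod_ennreal measurable_compose[OF measurable_PiM_lborel_component] borel_measurable_indicator) auto
    have e1: "t0 * (real (card I) + real (card J) - 1) = t0 * real (Suc (card ?X))"
      using cI cardX by simp
    have pw: "(rho powr (- t0)) ^ Suc (card ?X) = rho powr (- (t0 * real (Suc (card ?X))))"
      by (subst powr_power) (use rho in \<open>auto simp: mult.commute\<close>)
    have "ennreal (c * rho powr (- (t0 * (real (card I) + real (card J) - 1) + T)))
       \<le> ennreal (K * (1/4) ^ Suc (card ?X) * c1 * rho powr (- (t0 * (real (card I) + real (card J) - 1) + T)))"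
      using c by (intro ennreal_leI mult_right_mono) auto
    also have "K * (1/4) ^ Suc (card ?X) * c1 * rho powr (- (t0 * (real (card I) + real (card J) - 1) + T)) =
       K * (r\<^sup>2 / 4) * ((r\<^sup>2 / 4) ^ card ?X * (c1 * rho powr (- T)))"
    proof -
      have "rho powr (- (t0 * (real (card I) + real (card J) - 1) + T)) = (rho powr (- t0)) ^ Suc (card ?X) * rho powr (- T)"
        unfolding e1 pw by (simp flip: powr_add)
      then show ?thesis by (simp add: r(2) power_divide)
    qed
    also have "ennreal \<dots> = ennreal K * ennreal (r\<^sup>2 / 4) * (ennreal ((r\<^sup>2 / 4) ^ card ?X) * ennreal (c1 * rho powr (- T)))"
    proof -
      have em: "ennreal (x1 * x2 * (x3 * x4)) = ennreal x1 * ennreal x2 * (ennreal x3 * ennreal x4)"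
        if "x1 \<ge> 0" "x2 \<ge> 0" "x3 \<ge> 0" "x4 \<ge> 0" for x1 x2 x3 x4
        using that by (simp add: ennreal_mult)
      show ?thesis by (rule em) (use K c1 in auto)
    qed
    also have "\<dots> \<le> ennreal K * emeasure lborel {z. r \<le> cmod z \<and> cmod z \<le> 2 * r} * ((\<integral>\<^sup>+x. ?Px x \<partial>leb ?X) * (\<integral>\<^sup>+D. ?h D \<partial>leb ?B))"
      using ih[OF rho] r cardX by (intro mult_mono mult_left_mono emeasure_complex_annulus_ge nn_integral_PiM_disc_ge) auto
    also have "\<dots> = (\<integral>\<^sup>+z. ?Az z * ((\<integral>\<^sup>+x. ?Px x \<partial>leb ?X) * (\<integral>\<^sup>+D. ?h D \<partial>leb ?B)) \<partial>lborel)"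
      by (simp add: nn_integral_multc nn_integral_cmult)
    also have "\<dots> = (\<integral>\<^sup>+z. (\<integral>\<^sup>+x. (\<integral>\<^sup>+D. ?Az z * ?Px x * ?h D \<partial>leb ?B) \<partial>leb ?X) \<partial>lborel)"
    proof (intro nn_integral_cong)
      fix z :: complex
      have "(\<integral>\<^sup>+x. (\<integral>\<^sup>+D. ?Az z * ?Px x * ?h D \<partial>leb ?B) \<partial>leb ?X)
         = (\<integral>\<^sup>+x. ?Px x * (?Az z * (\<integral>\<^sup>+D. ?h D \<partial>leb ?B)) \<partial>leb ?X)"
      proof (intro nn_integral_cong)
        fix x
        show "(\<integral>\<^sup>+D. ?Az z * ?Px x * ?h D \<partial>leb ?B) = ?Px x * (?Az z * (\<integral>\<^sup>+D. ?h D \<partial>leb ?B))"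
          unfolding nn_integral_cmult[OF h] by (simp only: mult_ac)
      qed
      also have "\<dots> = (\<integral>\<^sup>+x. ?Px x \<partial>leb ?X) * (?Az z * (\<integral>\<^sup>+D. ?h D \<partial>leb ?B))"
        by (rule nn_integral_multc[OF mP])
      finally show "?Az z * ((\<integral>\<^sup>+x. ?Px x \<partial>leb ?X) * (\<integral>\<^sup>+D. ?h D \<partial>leb ?B))
         = (\<integral>\<^sup>+x. (\<integral>\<^sup>+D. ?Az z * ?Px x * ?h D \<partial>leb ?B) \<partial>leb ?X)"
        by (simp only: mult_ac)
    qed
    also have "\<dots> \<le> (\<integral>\<^sup>+z. (\<integral>\<^sup>+x. (\<integral>\<^sup>+D. ?f (restrict (comb i0 j0 z x D) (I \<times> J)) \<partial>leb ?B) \<partial>leb ?X) \<partial>lborel)"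
    proof (intro nn_integral_mono)
      fix z :: complex and x D :: "'a \<times> 'b \<Rightarrow> complex"
      let ?H = "restrict (comb i0 j0 z x D) (I \<times> J)"
      show "?Az z * ?Px x * ?h D \<le> ?f ?H"
      proof (cases "r \<le> cmod z \<and> cmod z \<le> 2 * r \<and> (\<forall>p\<in>?X. cmod (x p) \<le> r) \<and> ennreal (c1 * rho powr (- S)) \<le> gint (I - {i0}) (J - {j0}) a' (b' * rho) D")
        case True
        then have x: "\<forall>p\<in>?X. cmod (x p) \<le> cmod z" by force
        then have piv: "pivot I J i0 j0 ?H" using pivot_comb[OF ij] by blast
        have Hz: "?H (i0, j0) = z" using ij by (simp add: comb_def)
        have gs: "gint (I - {i0}) (J - {j0}) a' (b' * rho) (schur i0 j0 ?H) = gint (I - {i0}) (J - {j0}) a' (b' * rho) D"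
          using ij by (intro gint_cong schur_comb) auto
        have z2: "(cmod z)\<^sup>2 \<le> 4 * rho powr (- t0)"
        proof -
          have "(cmod z)\<^sup>2 \<le> (2 * r)\<^sup>2" using True by (intro power_mono) auto
          then show ?thesis using r by (simp add: power_mult_distrib)
        qed
        have "1 + rho * (cmod z)\<^sup>2 \<le> 5 * rho powr (1 - t0)"
        proof -
          have "rho * (cmod z)\<^sup>2 \<le> rho * (4 * rho powr (- t0))" using z2 rho by (intro mult_left_mono) auto
          also have "\<dots> = 4 * rho powr (1 - t0)" using rho by (simp add: powr_diff powr_minus field_simps)
          finally have "rho * (cmod z)\<^sup>2 \<le> 4 * rho powr (1 - t0)" .
          moreover have "1 \<le> rho powr (1 - t0)" using rho t0 by (intro ge_one_powr_ge_zero) auto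
          ultimately show ?thesis by simp
        qed
        moreover have pos: "1 + rho * (cmod z)\<^sup>2 > 0" using rho by (intro add_pos_nonneg) auto
        ultimately have "C1 / (1 + rho * (cmod z)\<^sup>2) \<ge> C1 / (5 * rho powr (1 - t0))"
          using C1 rho by (intro divide_left_mono mult_pos_pos) auto
        moreover have "C1 / (5 * rho powr (1 - t0)) = C1 / 5 * rho powr (- (1 - t0))"
          unfolding powr_minus by (simp add: field_simps)
        ultimately have 4: "C1 / 5 * rho powr (- (1 - t0)) \<le> C1 / (1 + rho * (cmod z)\<^sup>2)" by simp
        have "ennreal (c * rho powr (- ((1 - t0) + S))) \<le> ennreal (C1 / 5 * c1 * rho powr (- ((1 - t0) + S)))"
          using c by (intro ennreal_leI mult_right_mono) auto
        also have "C1 / 5 * c1 * rho powr (- ((1 - t0) + S)) = (C1 / 5 * rho powr (- (1 - t0))) * (c1 * rho powr (- S))"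
        proof -
          have "- ((1 - t0) + S) = - (1 - t0) + - S" by simp
          then show ?thesis by (simp only: powr_add mult_ac)
        qed
        also have "ennreal \<dots> = ennreal (C1 / 5 * rho powr (- (1 - t0))) * ennreal (c1 * rho powr (- S))"
          using C1 c1 by (intro ennreal_mult) auto
        also have "\<dots> \<le> ennreal (C1 / (1 + rho * (cmod z)\<^sup>2)) * gint (I - {i0}) (J - {j0}) a' (b' * rho) D"
          using 4 True by (intro mult_mono ennreal_leI) auto
        also have "\<dots> \<le> gint I J a (b * rho) ?H"
          using g[OF _ piv, of rho] rho unfolding Hz gs by simp
        finally have 1: "ennreal (c * rho powr (- ((1 - t0) + S))) \<le> gint I J a (b * rho) ?H" .
        have "(cmod z)\<^sup>2 \<le> 4" using z2 rt1 by simp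
        then have "(cmod z)\<^sup>2 * (1 + real (card ?X) + 2 * real (card ?B)) \<le> 4 * (1 + real (card ?X) + 2 * real (card ?B))"
          by (intro mult_right_mono) auto
        then have "sqnorm (I\<times>J) ?H \<le> 4 * (1 + real (card ?X) + 2 * real (card ?B)) + 2 * sqnorm ?B D"
          using comb_weight_bounds(2)[OF fin ij x, of D] by linarith
        then have "k * sqnorm (I\<times>J) ?H \<le> k * (4 * (1 + real (card ?X) + 2 * real (card ?B)) + 2 * sqnorm ?B D)"
          using ab by (intro mult_left_mono) auto
        then have "exp (- (k * (4 * (1 + real (card ?X) + 2 * real (card ?B)))) + - (2 * k * sqnorm ?B D)) \<le> exp (- (k * sqnorm (I\<times>J) ?H))"
          by (simp add: algebra_simps)
        then have "K * exp (- (2 * k * sqnorm ?B D)) \<le> exp (- (k * sqnorm (I\<times>J) ?H))"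
          unfolding K_def exp_add .
        then have 2: "ennreal K * gweight (2 * k) ?B D \<le> gweight k (I\<times>J) ?H"
          using K by (subst ennreal_mult[symmetric]) (auto intro: ennreal_leI)
        have 3: "?Px x = 1"
          using True by (intro prod.neutral) auto
        have 4: "indicator {z. r \<le> cmod z \<and> cmod z \<le> 2 * r} z = (1::ennreal)"
          by (intro indicator_simps(1)) (use True in blast)
        have 5: "indicator {H. ennreal (c1 * rho powr (- S)) \<le> gint (I - {i0}) (J - {j0}) a' (b' * rho) H} D = (1::ennreal)"
          by (intro indicator_simps(1)) (use True in blast)
        have 6: "indicator {H. ennreal (c * rho powr (- ((1 - t0) + S))) \<le> gint I J a (b * rho) H} ?H = (1::ennreal)"
          by (intro indicator_simps(1)) (use 1 in blast)
        show ?thesis unfolding 3 4 5 6 mult_1_right mult_1_left by (rule 2)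
      next
        case False
        then consider "\<not> (r \<le> cmod z \<and> cmod z \<le> 2 * r)" | p where "p \<in> ?X" "\<not> cmod (x p) \<le> r"
          | "\<not> ennreal (c1 * rho powr (- S)) \<le> gint (I - {i0}) (J - {j0}) a' (b' * rho) D" by blast
        then have "?Az z * ?Px x * ?h D = 0"
        proof cases
          case 1
          then have "indicator {z. r \<le> cmod z \<and> cmod z \<le> 2 * r} z = (0::ennreal)" by (intro indicator_simps(2)) blast
          then show ?thesis by (simp only: mult_zero_right mult_zero_left)
        next
          case 2
          have "?Px x = 0"
            by (rule prod_zero[OF cardX(1)]) (use 2 in \<open>auto simp: indicator_def\<close>)
          then show ?thesis by (simp only: mult_zero_right mult_zero_left)
        next
          case 3
          then have "indicator {H. ennreal (c1 * rho powr (- S)) \<le> gint (I - {i0}) (J - {j0}) a' (b' * rho) H} D = (0::ennreal)"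
            by (intro indicator_simps(2)) blast
          then show ?thesis by (simp only: mult_zero_right mult_zero_left)
        qed
        then show ?thesis by (simp only: zero_le)
      qed
    qed
    also have "\<dots> = (\<integral>\<^sup>+H. ?f H \<partial>leb (I \<times> J))"
      by (rule nn_integral_matrix_peel[OF fin ij f, symmetric])
    finally show ?thesis .
  qed
  then show ?thesis using c by blast
qed

text \<open>Here \<open>t l\<close> is the order of smallness of the \<open>l\<close>-th squared
  pivot. The total cost is linear in \<open>t\<close> with weights decreasing in \<open>l\<close>; a
  fixed pivot position at each step suffices because only one favourable event has to be
  exhibited.\<close>

lemma gint_tail_ge:
  fixes t :: "nat \<Rightarrow> real"
  assumes "finite I" "finite J" "a > 0" "b > 0" "k > 0"
    and "\<And>l. l < min (card I) (card J) \<Longrightarrow> 0 \<le> t l \<and> t l \<le> 1"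
  shows "\<exists>c>0. \<forall>rho\<ge>1.
      ennreal (c * rho powr (- (\<Sum>l<min (card I) (card J). t l * (real (card I) + real (card J) - 1 - 2 * real l)))) \<le>
      (\<integral>\<^sup>+H. indicator {H. ennreal (c * rho powr (- (\<Sum>l<min (card I) (card J). 1 - t l))) \<le> gint I J a (b * rho) H} H
         * gweight k (I\<times>J) H \<partial>leb (I \<times> J))"
  using assms
proof (induction "card I" arbitrary: I J a b k t)
  case 0
  then have I: "I = {}" by simp
  interpret product_sigma_finite "\<lambda>_. lborel :: complex measure" by (rule product_sigma_finite_lborel)
  show ?case
    using 0 unfolding I by (intro exI[of _ 1]) (simp add: nn_integral_empty gint_degenerate space_PiM)
next
  case (Suc n)
  interpret product_sigma_finite "\<lambda>_. lborel :: complex measure" by (rule product_sigma_finite_lborel)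
  show ?case
  proof (cases "J = {}")
    case True
    have g: "gint I J a b' H = ennreal ((pi / a) ^ card I)" for b' H
      using Suc.prems True by (simp add: gint_degenerate)
    define c where "c = min 1 ((pi / a) ^ card I)"
    have c: "c > 0" "c \<le> 1" "c \<le> (pi / a) ^ card I" using Suc.prems by (auto simp: c_def)
    have e1: "(\<Sum>l<min (card I) (card J). t l * (real (card I) + real (card J) - 1 - 2 * real l)) = 0"
      and e2: "(\<Sum>l<min (card I) (card J). 1 - t l) = 0"
      and e3: "I \<times> J = {}" using True by auto
    show ?thesis
      unfolding e1 e2 e3 using c
      by (intro exI[of _ c]) (auto simp: nn_integral_empty space_PiM g ennreal_leI)
  next
    case False
    have "I \<noteq> {}" using Suc by auto
    then obtain i0 j0 where ij: "i0 \<in> I" "j0 \<in> J" using False by auto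
    have cI: "card I = Suc (card (I - {i0}))" "card J = Suc (card (J - {j0}))"
      by (rule card.remove[OF Suc.prems(1) ij(1)], rule card.remove[OF Suc.prems(2) ij(2)])
    let ?m = "min (card (I - {i0})) (card (J - {j0}))"
    have mn: "min (card I) (card J) = Suc ?m" using cI by simp
    have T: "(\<Sum>l<min (card I) (card J). t l * (real (card I) + real (card J) - 1 - 2 * real l)) =
       t 0 * (real (card I) + real (card J) - 1) + (\<Sum>l<?m. t (Suc l) * (real (card (I - {i0})) + real (card (J - {j0})) - 1 - 2 * real l))"
      unfolding mn sum.lessThan_Suc_shift using cI by (simp add: algebra_simps)
    have S: "(\<Sum>l<min (card I) (card J). 1 - t l) = (1 - t 0) + (\<Sum>l<?m. 1 - t (Suc l))"
      unfolding mn by (rule sum.lessThan_Suc_shift)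
    have t0: "0 \<le> t 0" "t 0 \<le> 1" using Suc.prems(6)[of 0] mn by auto
    show ?thesis unfolding T S
    proof (rule gint_tail_step[OF Suc.prems(1,2) ij Suc.prems(3-5) t0], goal_cases)
      case (1 a' b' k')
      show ?case
      proof (rule Suc.hyps(1))
        show "n = card (I - {i0})" using Suc.hyps(2) cI by simp
        show "0 \<le> t (Suc l) \<and> t (Suc l) \<le> 1" if "l < ?m" for l
          using Suc.prems(6)[of "Suc l"] that mn by simp
      qed (use 1 Suc.prems in auto)
    qed
  qed
qed

section \<open>Eigenvalues of the Gram matrix\<close>

definition gram :: "nat \<Rightarrow> nat \<Rightarrow> (nat \<times> nat \<Rightarrow> complex) \<Rightarrow> complex mat" where
  "gram Mr Mt H = chan_mat Mr Mt H * mat_adjoint (chan_mat Mr Mt H)"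

lemma mat_adjoint_chan:
  "mat_adjoint (chan_mat Mr Mt H) = mat Mt Mr (\<lambda>(t, i). cnj (H (i, t)))"
  by (rule eq_matI) (auto simp: mat_adjoint_def chan_mat_def mat_of_rows_def)

lemma gram_carrier [simp]: "gram Mr Mt H \<in> carrier_mat Mr Mr"
  by (auto simp: gram_def mat_adjoint_chan) (auto simp: chan_mat_def)

lemma gram_index:
  "i < Mr \<Longrightarrow> j < Mr \<Longrightarrow> gram Mr Mt H $$ (i, j) = (\<Sum>t<Mt. H (i, t) * cnj (H (j, t)))"
  unfolding gram_def mat_adjoint_chan by (auto simp: chan_mat_def scalar_prod_def lessThan_atLeast0)

text \<open>Multiplying the block matrix \<open>?M\<close> by the unit triangular \<open>?E\<close>
  from the right and from the left gives two block triangular matrices whose determinants are the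
  two sides; \<open>det ?E = 1\<close>.\<close>

lemma det_one_plus_mult_commute:
  fixes B :: "'a::idom mat"
  assumes B: "B \<in> carrier_mat r t" and C: "C \<in> carrier_mat t r"
  shows "det (1\<^sub>m r + B * C) = det (1\<^sub>m t + C * B)"
proof -
  let ?M = "four_block_mat (1\<^sub>m r) (- B) C (1\<^sub>m t)"
  have B': "- B \<in> carrier_mat r t" using B by simp
  have M: "?M \<in> carrier_mat (r + t) (r + t)" using B C by simp
  let ?E = "four_block_mat (1\<^sub>m r) B (0\<^sub>m t r) (1\<^sub>m t)"
  have E: "?E \<in> carrier_mat (r + t) (r + t)" by simp
  have dE: "det ?E = 1"
    by (subst det_four_block_mat_lower_left_zero[OF one_carrier_mat B refl one_carrier_mat]) simp
  have "?M * ?E = four_block_mat (1\<^sub>m r) (0\<^sub>m r t) C (1\<^sub>m t + C * B)"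
    by (subst mult_four_block_mat[OF one_carrier_mat B' C one_carrier_mat one_carrier_mat B zero_carrier_mat one_carrier_mat])
       (insert B C, auto intro!: cong_four_block_mat comm_add_mat)
  then have "det ?M * det ?E = det (1\<^sub>m t + C * B)"
    using det_mult[OF M E] det_four_block_mat_upper_right_zero[OF one_carrier_mat refl C, of "1\<^sub>m t + C * B"] B C by simp
  moreover have "?E * ?M = four_block_mat (1\<^sub>m r + B * C) (0\<^sub>m r t) C (1\<^sub>m t)"
    by (subst mult_four_block_mat[OF one_carrier_mat B zero_carrier_mat one_carrier_mat one_carrier_mat B' C one_carrier_mat])
       (insert B C, auto intro!: cong_four_block_mat)
  then have "det ?E * det ?M = det (1\<^sub>m r + B * C)"
    using det_mult[OF E M] det_four_block_mat_upper_right_zero[of "1\<^sub>m r + B * C" r "0\<^sub>m r t" t C "1\<^sub>m t"] B C by simp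
  ultimately show ?thesis using dE by simp
qed

text \<open>Over the complex numbers the characteristic polynomial splits into \<open>n\<close>
  linear factors. Evaluation at \<open>- x / y\<close>, with one factor \<open>- y\<close> given to
  each root, yields the product.\<close>

lemma det_smult_one_plus_proots:
  fixes A :: "complex mat"
  assumes A: "A \<in> carrier_mat n n" and y: "y \<noteq> 0"
  shows "det (x \<cdot>\<^sub>m 1\<^sub>m n + y \<cdot>\<^sub>m A) = (\<Prod>l\<in>#proots (char_poly A). x + y * l)"
proof -
  have lc: "lead_coeff (char_poly A) = 1" "degree (char_poly A) = n" using degree_monic_char_poly[OF A] by auto
  have sz: "size (proots (char_poly A)) = n" using size_proots_complex[of "char_poly A"] lc by simp
  have "x \<cdot>\<^sub>m 1\<^sub>m n + y \<cdot>\<^sub>m A = (- y) \<cdot>\<^sub>m (- char_matrix A (- x / y))"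
    using A y by (intro eq_matI) (auto simp: char_matrix_def field_simps)
  then have "det (x \<cdot>\<^sub>m 1\<^sub>m n + y \<cdot>\<^sub>m A) = (- y) ^ n * det (- char_matrix A (- x / y))"
    using A by (simp add: det_smult char_matrix_def)
  also have "det (- char_matrix A (- x / y)) = poly (char_poly A) (- x / y)"
    by (rule char_poly_matrix[OF A, symmetric])
  also have "char_poly A = (\<Prod>l\<in>#proots (char_poly A). [:- l, 1:])"
    using complex_poly_decompose_multiset[of "char_poly A"] lc by simp
  also have "poly \<dots> (- x / y) = (\<Prod>l\<in>#proots (char_poly A). - x / y - l)"
  proof -
    have "poly (\<Prod>l\<in>#P. [:- l, 1:]) z = (\<Prod>l\<in>#P. z - l)" for P and z :: complex
      by (induction P) (auto simp: algebra_simps)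
    then show ?thesis .
  qed
  also have "(- y) ^ n * \<dots> = (\<Prod>l\<in>#proots (char_poly A). (- y) * (- x / y - l))"
  proof -
    have "c ^ size P * (\<Prod>l\<in>#P. f l) = (\<Prod>l\<in>#P. c * f l)" for P and c :: complex and f :: "complex \<Rightarrow> complex"
      by (induction P) auto
    from this[of "- y" "proots (char_poly A)"] show ?thesis unfolding sz .
  qed
  also have "\<dots> = (\<Prod>l\<in>#proots (char_poly A). x + y * l)"
    using y by (intro arg_cong[where f=prod_mset] image_mset_cong) (simp add: field_simps)
  finally show ?thesis .
qed

text \<open>Sylvester's identity \<open>det (1 - B * C) = det (1 - C * B)\<close> compares the characteristic
  polynomials of \<open>H * H\<^sup>H\<close> and \<open>H\<^sup>H * H\<close>.\<close>
lemma replicate_zero_subset_proots: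
  "replicate_mset (Mr - min Mr Mt) 0 \<subseteq># proots (char_poly (gram Mr Mt H))"
proof (cases "Mt < Mr")
  case True
  let ?H = "chan_mat Mr Mt H" and ?A = "mat_adjoint (chan_mat Mr Mt H)"
  have H: "?H \<in> carrier_mat Mr Mt" and A: "?A \<in> carrier_mat Mt Mr" unfolding mat_adjoint_chan by (auto simp: chan_mat_def)
  let ?p = "char_poly (gram Mr Mt H)" and ?q = "char_poly (?A * ?H)"
  have AH: "?A * ?H \<in> carrier_mat Mt Mt" using A H by simp
  have ev: "poly (monom 1 Mt * ?p) x = poly (monom 1 Mr * ?q) x" if x: "x \<noteq> 0" for x
  proof -
    have 1: "poly ?p x = x ^ Mr * det (1\<^sub>m Mr + ((-1/x) \<cdot>\<^sub>m ?H) * ?A)"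
    proof -
      have "- char_matrix (gram Mr Mt H) x = x \<cdot>\<^sub>m (1\<^sub>m Mr + ((-1/x) \<cdot>\<^sub>m ?H) * ?A)"
        using H A x by (intro eq_matI) (auto simp: char_matrix_def gram_def field_simps mult_smult_assoc_mat)
      then show ?thesis using char_poly_matrix[OF gram_carrier, of Mr Mt H x] H A by (simp add: det_smult)
    qed
    have 2: "poly ?q x = x ^ Mt * det (1\<^sub>m Mt + ?A * ((-1/x) \<cdot>\<^sub>m ?H))"
    proof -
      have "- char_matrix (?A * ?H) x = x \<cdot>\<^sub>m (1\<^sub>m Mt + ?A * ((-1/x) \<cdot>\<^sub>m ?H))"
        using H A x by (intro eq_matI) (auto simp: char_matrix_def field_simps mult_smult_distrib)
      then show ?thesis using char_poly_matrix[OF AH, of x] H A by (simp add: det_smult)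
    qed
    have 3: "det (1\<^sub>m Mr + ((-1/x) \<cdot>\<^sub>m ?H) * ?A) = det (1\<^sub>m Mt + ?A * ((-1/x) \<cdot>\<^sub>m ?H))"
      using H A by (intro det_one_plus_mult_commute) auto
    show ?thesis unfolding poly_mult poly_monom 1 2 3 by simp
  qed
  have eq: "monom 1 Mt * ?p = monom 1 Mr * ?q"
  proof -
    \<comment> \<open>The two sides are compared only away from 0. The additional factor
      \<open>monom 1 1\<close> settles the point 0 and cancels afterwards.\<close>
    have "monom 1 1 * (monom 1 Mt * ?p - monom 1 Mr * ?q) = 0"
      unfolding poly_all_0_iff_0[symmetric] using ev by (auto simp: poly_monom)
    then show ?thesis by simp
  qed
  have nz: "?p \<noteq> 0" "?q \<noteq> 0" using degree_monic_char_poly[OF gram_carrier, of Mr Mt H] degree_monic_char_poly[OF AH] by auto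
  \<comment> \<open>Comparing orders of vanishing at 0: that of \<open>?q\<close> is nonnegative, so
    that of \<open>?p\<close> is at least \<open>Mr - Mt\<close>.\<close>
  have "Mt + Polynomial.order 0 ?p = Mr + Polynomial.order 0 ?q"
    using arg_cong[OF eq, of "Polynomial.order 0"] nz by (simp add: order_mult)
  then have "Mr - min Mr Mt \<le> count (proots ?p) 0" using nz True by simp
  then show ?thesis by (simp add: count_le_replicate_mset_subset_eq)
next
  case False
  then show ?thesis by simp
qed


text \<open>An eigenvalue is the Rayleigh quotient \<open>W / V\<close> of an eigenvector
  \<open>v\<close>, with \<open>W\<close> the squared norm of \<open>H\<^sup>H v\<close> and
  \<open>V\<close> that of \<open>v\<close>. It is therefore real and nonnegative, and
  Cauchy-Schwarz bounds it by the squared Frobenius norm.\<close>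

lemma gram_eigenvalue_bounds:
  assumes "poly (char_poly (gram Mr Mt H)) l = 0"
  shows "Im l = 0" "0 \<le> Re l" "Re l \<le> sqnorm ({..<Mr}\<times>{..<Mt}) H"
proof -
  have "eigenvalue (gram Mr Mt H) l" using eigenvalue_root_char_poly[OF gram_carrier] assms by blast
  then obtain v where v: "v \<in> carrier_vec Mr" "v \<noteq> 0\<^sub>v Mr" "gram Mr Mt H *\<^sub>v v = l \<cdot>\<^sub>v v"
    unfolding eigenvalue_def eigenvector_def using gram_carrier[of Mr Mt H] by auto
  have ev: "(\<Sum>j<Mr. (\<Sum>t<Mt. H (i, t) * cnj (H (j, t))) * vec_index v j) = l * vec_index v i" if i: "i < Mr" for i
  proof -
    have "vec_index (gram Mr Mt H *\<^sub>v v) i = (\<Sum>j<Mr. gram Mr Mt H $$ (i, j) * vec_index v j)"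
      using i v(1) carrier_matD[OF gram_carrier[of Mr Mt H]] by (auto simp: scalar_prod_def lessThan_atLeast0)
    also have "\<dots> = (\<Sum>j<Mr. (\<Sum>t<Mt. H (i, t) * cnj (H (j, t))) * vec_index v j)"
      using i by (intro sum.cong) (auto simp: gram_index)
    finally show ?thesis unfolding v(3) using i v(1) by simp
  qed
  define V where "V = (\<Sum>i<Mr. (cmod (vec_index v i))\<^sup>2)"
  define W where "W = (\<Sum>t<Mt. (cmod (\<Sum>j<Mr. cnj (H (j, t)) * vec_index v j))\<^sup>2)"
  have "V > 0"
  proof -
    obtain i where i: "i < Mr" "vec_index v i \<noteq> 0"
      using v(1,2) by (metis carrier_vecD eq_vecI index_zero_vec(1) index_zero_vec(2))
    then have "0 < (cmod (vec_index v i))\<^sup>2" by simp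
    also have "\<dots> \<le> V" unfolding V_def using i by (intro member_le_sum) auto
    finally show ?thesis .
  qed
  have "of_real W = (\<Sum>t<Mt. cnj (\<Sum>i<Mr. cnj (H (i, t)) * vec_index v i) * (\<Sum>j<Mr. cnj (H (j, t)) * vec_index v j))"
    unfolding W_def of_real_sum by (intro sum.cong refl) (simp only: complex_norm_square mult.commute)
  also have "\<dots> = (\<Sum>t<Mt. \<Sum>i<Mr. \<Sum>j<Mr. cnj (vec_index v i) * (H (i, t) * cnj (H (j, t)) * vec_index v j))"
    unfolding cnj_sum sum_product by (simp add: mult_ac)
  also have "\<dots> = (\<Sum>i<Mr. \<Sum>t<Mt. \<Sum>j<Mr. cnj (vec_index v i) * (H (i, t) * cnj (H (j, t)) * vec_index v j))"
    by (rule sum.swap)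
  also have "\<dots> = (\<Sum>i<Mr. cnj (vec_index v i) * (\<Sum>j<Mr. (\<Sum>t<Mt. H (i, t) * cnj (H (j, t))) * vec_index v j))"
    by (intro sum.cong refl, subst sum.swap) (simp add: sum_distrib_left sum_distrib_right)
  also have "\<dots> = (\<Sum>i<Mr. cnj (vec_index v i) * (l * vec_index v i))"
    using ev by (intro sum.cong) auto
  also have "\<dots> = l * of_real V"
    unfolding V_def of_real_sum sum_distrib_left by (intro sum.cong refl) (simp only: complex_norm_square mult_ac)
  finally have WV: "of_real W = l * of_real V" .
  then have l: "l = of_real (W / V)" using \<open>V > 0\<close> by (simp add: field_simps)
  have W0: "W \<ge> 0" by (simp add: W_def sum_nonneg)
  show "Im l = 0" unfolding l by simp
  show "0 \<le> Re l" unfolding l using W0 \<open>V > 0\<close> by simp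
  have "W \<le> (\<Sum>t<Mt. (\<Sum>j<Mr. (cmod (H (j, t)))\<^sup>2) * V)"
    unfolding W_def
  proof (intro sum_mono)
    fix t
    have "cmod (\<Sum>j<Mr. cnj (H (j, t)) * vec_index v j) \<le> (\<Sum>j<Mr. \<bar>cmod (H (j, t))\<bar> * \<bar>cmod (vec_index v j)\<bar>)"
      by (rule order_trans[OF norm_sum]) (simp add: norm_mult)
    also have "\<dots> \<le> L2_set (\<lambda>j. cmod (H (j, t))) {..<Mr} * L2_set (\<lambda>j. cmod (vec_index v j)) {..<Mr}"
      by (rule L2_set_mult_ineq)
    finally have "(cmod (\<Sum>j<Mr. cnj (H (j, t)) * vec_index v j))\<^sup>2 \<le> (L2_set (\<lambda>j. cmod (H (j, t))) {..<Mr} * L2_set (\<lambda>j. cmod (vec_index v j)) {..<Mr})\<^sup>2"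
      by (intro power_mono) auto
    also have "\<dots> = (\<Sum>j<Mr. (cmod (H (j, t)))\<^sup>2) * V"
      by (simp add: L2_set_def V_def power_mult_distrib sum_nonneg)
    finally show "(cmod (\<Sum>j<Mr. cnj (H (j, t)) * vec_index v j))\<^sup>2 \<le> (\<Sum>j<Mr. (cmod (H (j, t)))\<^sup>2) * V" .
  qed
  also have "\<dots> = sqnorm ({..<Mr}\<times>{..<Mt}) H * V"
    unfolding sum_distrib_right[symmetric] by (subst sum.swap) (simp add: sum.cartesian_product)
  finally show "Re l \<le> sqnorm ({..<Mr}\<times>{..<Mt}) H"
    unfolding l using \<open>V > 0\<close> by (simp add: field_simps)
qed

text \<open>Multiset difference truncates, so counting and products are correct only because
  \<open>replicate_zero_subset_proots\<close> guarantees enough zero roots. The removed zeros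
  reappear in the determinant as a power of \<open>x\<close>.\<close>

lemma
  shows nz_eigs_nonneg: "l \<in># nz_eigs Mr Mt H \<Longrightarrow> 0 \<le> l"
    and nz_eigs_le: "l \<in># nz_eigs Mr Mt H \<Longrightarrow> l \<le> sqnorm ({..<Mr}\<times>{..<Mt}) H"
    and size_nz_eigs: "size (nz_eigs Mr Mt H) = min Mr Mt"
    and prod_nz_eigs: "y \<noteq> 0 \<Longrightarrow>
      of_real ((\<Prod>l\<in>#nz_eigs Mr Mt H. x + y * l) * x ^ (Mr - min Mr Mt)) = det (of_real x \<cdot>\<^sub>m 1\<^sub>m Mr + of_real y \<cdot>\<^sub>m gram Mr Mt H)"
proof -
  let ?P = "proots (char_poly (gram Mr Mt H))" and ?R = "replicate_mset (Mr - min Mr Mt) (0::complex)"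
  have R: "?R \<subseteq># ?P" by (rule replicate_zero_subset_proots)
  have nz: "nz_eigs Mr Mt H = image_mset Re (?P - ?R)" by (simp add: nz_eigs_def gram_def)
  have cp: "char_poly (gram Mr Mt H) \<noteq> 0" "degree (char_poly (gram Mr Mt H)) = Mr"
    using degree_monic_char_poly[OF gram_carrier, of Mr Mt H] by auto
  have root: "poly (char_poly (gram Mr Mt H)) l = 0" if "l \<in># ?P - ?R" for l
    using in_diffD[OF that] cp by simp
  show "0 \<le> l" if "l \<in># nz_eigs Mr Mt H"
    using that root gram_eigenvalue_bounds(2)[of Mr Mt H] unfolding nz by auto
  show "l \<le> sqnorm ({..<Mr}\<times>{..<Mt}) H" if "l \<in># nz_eigs Mr Mt H"
    using that root gram_eigenvalue_bounds(3)[of Mr Mt H] unfolding nz by auto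
  show "size (nz_eigs Mr Mt H) = min Mr Mt"
    unfolding nz using R cp size_proots_complex[of "char_poly (gram Mr Mt H)"] by (simp add: size_Diff_submset)
  assume y: "y \<noteq> 0"
  have "complex_of_real (\<Prod>l\<in>#nz_eigs Mr Mt H. x + y * l) = (\<Prod>l\<in>#?P - ?R. of_real x + of_real y * l)"
  proof -
    have "complex_of_real (\<Prod>l\<in>#image_mset Re Q. x + y * l) = (\<Prod>l\<in>#Q. of_real x + of_real y * l)"
      if "\<And>l. l \<in># Q \<Longrightarrow> Im l = 0" for Q
      using that
    proof (induction Q)
      case (add l Q)
      have "complex_of_real (Re l) = l" using add.prems[of l] by (simp add: complex_eq_iff)
      then show ?case using add by simp
    qed simp
    then show ?thesis unfolding nz using root gram_eigenvalue_bounds(1)[of Mr Mt H] by blast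
  qed
  then have "complex_of_real ((\<Prod>l\<in>#nz_eigs Mr Mt H. x + y * l) * x ^ (Mr - min Mr Mt)) =
      (\<Prod>l\<in>#?P - ?R. of_real x + of_real y * l) * (\<Prod>l\<in>#?R. of_real x + of_real y * l)"
    by simp
  also have "\<dots> = (\<Prod>l\<in>#(?P - ?R) + ?R. of_real x + of_real y * l)" by simp
  also have "(?P - ?R) + ?R = ?P" using R by (rule subset_mset.diff_add)
  also have "(\<Prod>l\<in>#?P. of_real x + of_real y * l) = det (of_real x \<cdot>\<^sub>m 1\<^sub>m Mr + of_real y \<cdot>\<^sub>m gram Mr Mt H)"
    using y by (intro det_smult_one_plus_proots[symmetric]) auto
  finally show "of_real ((\<Prod>l\<in>#nz_eigs Mr Mt H. x + y * l) * x ^ (Mr - min Mr Mt)) = det (of_real x \<cdot>\<^sub>m 1\<^sub>m Mr + of_real y \<cdot>\<^sub>m gram Mr Mt H)" .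
qed

text \<open>The last index is eliminated, so that the smaller matrix is again indexed by an initial
  segment. The factor \<open>?F\<close> clears the last row to the left of the corner entry.\<close>

lemma det_mat_Suc_schur:
  fixes Q :: "nat \<times> nat \<Rightarrow> complex"
  assumes q: "Q (n, n) \<noteq> 0"
  shows "det (mat (Suc n) (Suc n) Q) = Q (n, n) * det (mat n n (schur n n Q))"
proof -
  let ?A = "mat n n Q" and ?B = "mat n 1 (\<lambda>(i, _). Q (i, n))" and ?C = "mat 1 n (\<lambda>(_, j). Q (n, j))" and ?D = "mat 1 1 (\<lambda>_. Q (n, n))"
  let ?E = "mat 1 n (\<lambda>(_, j). - Q (n, j) / Q (n, n))"
  have M: "mat (Suc n) (Suc n) Q = four_block_mat ?A ?B ?C ?D"
    by (rule eq_matI) (auto simp: four_block_mat_def Let_def less_Suc_eq)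
  let ?F = "four_block_mat (1\<^sub>m n) (0\<^sub>m n 1) ?E (1\<^sub>m 1)"
  have "?A * 1\<^sub>m n + ?B * ?E = mat n n (schur n n Q)"
    by (rule eq_matI) (auto simp: schur_def scalar_prod_def)
  moreover have "?A * 0\<^sub>m n 1 + ?B * 1\<^sub>m 1 = ?B"
    by (rule eq_matI) (auto simp: scalar_prod_def)
  moreover have "?C * 1\<^sub>m n + ?D * ?E = 0\<^sub>m 1 n"
    using q by (intro eq_matI) (auto simp: scalar_prod_def)
  moreover have "?C * 0\<^sub>m n 1 + ?D * 1\<^sub>m 1 = ?D"
    by (rule eq_matI) (auto simp: scalar_prod_def)
  ultimately have eq: "four_block_mat ?A ?B ?C ?D * ?F = four_block_mat (mat n n (schur n n Q)) ?B (0\<^sub>m 1 n) ?D"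
    by (subst mult_four_block_mat[of _ n n _ 1 _ 1 _ _ n _ 1]) auto
  have "det (four_block_mat ?A ?B ?C ?D) * det ?F = det (four_block_mat ?A ?B ?C ?D * ?F)"
    by (rule det_mult[symmetric, of _ "n + 1"]) auto
  also have "\<dots> = det (mat n n (schur n n Q)) * det ?D"
    unfolding eq by (rule det_four_block_mat_lower_left_zero[of _ n _ 1]) auto
  finally have "det (four_block_mat ?A ?B ?C ?D) * det ?F = det (mat n n (schur n n Q)) * det ?D" .
  moreover have "det ?F = 1"
    by (subst det_four_block_mat_upper_right_zero[of _ n _ 1]) auto
  moreover have "det ?D = Q (n, n)" by (subst det_single) auto
  ultimately show ?thesis unfolding M by simp
qed

section \<open>The Gaussian integral as an inverse determinant\<close>

definition qform :: "nat \<Rightarrow> (nat \<times> nat \<Rightarrow> complex) \<Rightarrow> (nat \<Rightarrow> complex) \<Rightarrow> complex" where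
  "qform n Q z = (\<Sum>i<n. \<Sum>j<n. z i * Q (i, j) * cnj (z j))"

lemma qform_cong: "(\<And>i. i < n \<Longrightarrow> z i = z' i) \<Longrightarrow> qform n Q z = qform n Q z'"
  unfolding qform_def by (intro sum.cong) auto

text \<open>Completion of the square in the last variable; what remains is the form of the Schur
  complement.\<close>

lemma qform_Suc_schur:
  assumes herm: "\<And>i j. i < Suc n \<Longrightarrow> j < Suc n \<Longrightarrow> Q (j, i) = cnj (Q (i, j))" and q: "Q (n, n) = of_real q" "q \<noteq> 0"
  shows "qform (Suc n) Q z = of_real (q * (cmod (z n + (\<Sum>i<n. z i * Q (i, n)) / q))\<^sup>2) + qform n (schur n n Q) z"
proof -
  define s where "s = (\<Sum>i<n. z i * Q (i, n))"
  have cs: "cnj s = (\<Sum>j<n. Q (n, j) * cnj (z j))"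
    unfolding s_def cnj_sum
  proof (intro sum.cong refl)
    fix j assume "j \<in> {..<n}"
    then have "Q (n, j) = cnj (Q (j, n))" by (intro herm) auto
    then show "cnj (z j * Q (j, n)) = Q (n, j) * cnj (z j)" by (simp add: mult.commute)
  qed
  have "qform n (schur n n Q) z = (\<Sum>i<n. \<Sum>j<n. z i * Q (i, j) * cnj (z j) - z i * Q (i, n) * (Q (n, j) * cnj (z j)) / q)"
    unfolding qform_def schur_def using q by (intro sum.cong refl) (simp add: field_simps)
  also have "\<dots> = (\<Sum>i<n. \<Sum>j<n. z i * Q (i, j) * cnj (z j)) - s * cnj s / q"
    unfolding cs unfolding s_def sum_product by (simp add: sum_subtractf sum_divide_distrib)
  finally have 1: "qform n (schur n n Q) z = (\<Sum>i<n. \<Sum>j<n. z i * Q (i, j) * cnj (z j)) - s * cnj s / q" .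
  have 4: "qform (Suc n) Q z = (\<Sum>i<n. \<Sum>j<n. z i * Q (i, j) * cnj (z j)) + s * cnj (z n) + z n * cnj s + q * (z n * cnj (z n))"
    unfolding qform_def cs using q by (simp add: sum.distrib s_def sum_distrib_left sum_distrib_right mult_ac)
  have 2: "complex_of_real (q * (cmod (z n + s / q))\<^sup>2) = q * ((z n + s / q) * cnj (z n + s / q))"
    by (simp only: of_real_mult complex_norm_square)
  have 3: "q * ((z n + s / q) * cnj (z n + s / q)) = s * cnj s / q + s * cnj (z n) + z n * cnj s + q * (z n * cnj (z n))"
    using q(2) by (simp add: field_simps)
  show ?thesis unfolding s_def[symmetric] 1 2 3 4 by simp
qed

lemma measurable_qform:
  assumes "{..<n} \<subseteq> S"
  shows "(\<lambda>z. ennreal (exp (- Re (qform n Q z)))) \<in> borel_measurable (leb S)"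
proof -
  have cn: "(\<lambda>z. cnj (z i)) \<in> borel_measurable (leb S)" if "i < n" for i
    using that assms by (intro measurable_compose[OF measurable_PiM_lborel_component borel_measurable_continuous_onI] continuous_intros) auto
  have "(\<lambda>z. qform n Q z) \<in> borel_measurable (leb S)"
    unfolding qform_def using assms
    by (intro borel_measurable_sum borel_measurable_times borel_measurable_const measurable_PiM_lborel_component cn) auto
  then have "(\<lambda>z. Re (qform n Q z)) \<in> borel_measurable (leb S)"
    by (rule measurable_compose) (intro borel_measurable_continuous_onI continuous_intros)
  then show ?thesis
    by (intro measurable_compose[OF _ measurable_ennreal] measurable_compose[OF _ borel_measurable_exp] borel_measurable_uminus)
qed

text \<open>Integral and determinant obey the same recursion: completing the square in the last
  variable produces \<open>pi / q\<close>, while the determinant splits off \<open>q\<close>, and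
  both continue with the Schur complement. The real number \<open>d\<close> is part of the claim
  because the determinant is complex.\<close>

lemma nn_integral_gauss_qform:
  assumes "\<And>i j. i < n \<Longrightarrow> j < n \<Longrightarrow> Q (j, i) = cnj (Q (i, j))"
    and "\<And>z. \<exists>i<n. z i \<noteq> 0 \<Longrightarrow> 0 < Re (qform n Q z)"
  shows "\<exists>d>0. det (mat n n Q) = of_real d \<and>
    (\<integral>\<^sup>+z. ennreal (exp (- Re (qform n Q z))) \<partial>leb {..<n}) = ennreal (pi ^ n / d)"
  using assms
proof (induction n arbitrary: Q)
  case 0
  interpret product_sigma_finite "\<lambda>_. lborel :: complex measure" by (rule product_sigma_finite_lborel)
  show ?case by (intro exI[of _ 1]) (simp add: nn_integral_empty qform_def space_PiM)
next
  case (Suc n)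
  interpret product_sigma_finite "\<lambda>_. lborel :: complex measure" by (rule product_sigma_finite_lborel)
  define q where "q = Re (Q (n, n))"
  have "Q (n, n) = cnj (Q (n, n))" using Suc.prems(1)[of n n] by simp
  then have qq: "Q (n, n) = of_real q" by (simp add: complex_eq_iff q_def)
  have q: "q > 0"
  proof -
    have "0 < Re (qform (Suc n) Q (\<lambda>i. if i = n then 1 else 0))" by (rule Suc.prems(2)) auto
    also have "qform (Suc n) Q (\<lambda>i. if i = n then 1 else 0) = Q (n, n)"
      unfolding qform_def by (simp add: if_distrib[of "\<lambda>x. x * _"] if_distrib[of cnj] cong: if_cong)
    finally show ?thesis by (simp add: q_def)
  qed
  let ?S = "schur n n Q"
  define w where "w z = (\<Sum>i<n. z i * Q (i, n)) / q" for z
  have split: "qform (Suc n) Q z = of_real (q * (cmod (z n + w z))\<^sup>2) + qform n ?S z" for z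
    unfolding w_def
    by (rule qform_Suc_schur, erule (1) Suc.prems(1), rule qq) (use q in simp)
  have wup: "w (z(n := y)) = w z" for z y unfolding w_def by simp
  have qup: "qform n ?S (z(n := y)) = qform n ?S z" for z y by (rule qform_cong) simp
  have "\<exists>d>0. det (mat n n ?S) = of_real d \<and>
    (\<integral>\<^sup>+z. ennreal (exp (- Re (qform n ?S z))) \<partial>leb {..<n}) = ennreal (pi ^ n / d)"
  proof (rule Suc.IH)
    show "?S (j, i) = cnj (?S (i, j))" if "i < n" "j < n" for i j
    proof -
      have "Q (j, i) = cnj (Q (i, j))" "Q (j, n) = cnj (Q (n, j))" "Q (n, i) = cnj (Q (i, n))"
        using that by (intro Suc.prems(1); simp)+
      then show ?thesis by (simp add: schur_def qq mult.commute)
    qed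
    show "0 < Re (qform n ?S z)" if z: "\<exists>i<n. z i \<noteq> 0" for z
    proof -
      \<comment> \<open>This last coordinate makes the completed square vanish, so positivity of the
        full form passes to the Schur complement.\<close>
      let ?z = "z(n := - w z)"
      obtain i where "i < n" "z i \<noteq> 0" using z by blast
      then have "0 < Re (qform (Suc n) Q ?z)" by (intro Suc.prems(2) exI[of _ i]) auto
      then show ?thesis unfolding split wup qup by simp
    qed
  qed
  then obtain d where d: "d > 0" "det (mat n n ?S) = of_real d"
    "(\<integral>\<^sup>+z. ennreal (exp (- Re (qform n ?S z))) \<partial>leb {..<n}) = ennreal (pi ^ n / d)" by blast
  have det: "det (mat (Suc n) (Suc n) Q) = of_real (q * d)"
    using det_mat_Suc_schur[of Q n] qq q d(2) by simp
  have ins: "{..<Suc n} = insert n {..<n}" by auto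
  have m: "(\<lambda>z. ennreal (exp (- Re (qform (Suc n) Q z)))) \<in> borel_measurable (leb (insert n {..<n}))"
    by (rule measurable_qform) auto
  have "(\<integral>\<^sup>+z. ennreal (exp (- Re (qform (Suc n) Q z))) \<partial>PiM {..<Suc n} (\<lambda>_. lborel))
    = (\<integral>\<^sup>+z. (\<integral>\<^sup>+y. ennreal (exp (- Re (qform (Suc n) Q (z(n := y))))) \<partial>lborel) \<partial>leb {..<n})"
    unfolding ins by (rule product_nn_integral_insert[OF _ _ m]) auto
  also have "\<dots> = (\<integral>\<^sup>+z. ennreal (exp (- Re (qform n ?S z))) * ennreal (pi / q) \<partial>leb {..<n})"
  proof (intro nn_integral_cong)
    fix z :: "nat \<Rightarrow> complex"
    have "(\<integral>\<^sup>+y. ennreal (exp (- Re (qform (Suc n) Q (z(n := y))))) \<partial>lborel)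
       = (\<integral>\<^sup>+y. ennreal (exp (- Re (qform n ?S z))) * ennreal (exp (- (q * (cmod (y + w z))\<^sup>2))) \<partial>lborel)"
      unfolding split wup qup by (intro nn_integral_cong) (simp add: exp_diff exp_minus divide_simps flip: ennreal_mult')
    also have "\<dots> = ennreal (exp (- Re (qform n ?S z))) * (\<integral>\<^sup>+y. ennreal (exp (- (q * (cmod (y + w z))\<^sup>2))) \<partial>lborel)"
      by (rule nn_integral_cmult) measurable
    also have "(\<integral>\<^sup>+y. ennreal (exp (- (q * (cmod (y + w z))\<^sup>2))) \<partial>lborel) = ennreal (pi / q)"
      using nn_integral_lborel_translate[of "\<lambda>y. ennreal (exp (- (q * (cmod y)\<^sup>2)))" "w z"] nn_integral_complex_gauss[OF q] by simp
    finally show "(\<integral>\<^sup>+y. ennreal (exp (- Re (qform (Suc n) Q (z(n := y))))) \<partial>lborel) = ennreal (exp (- Re (qform n ?S z))) * ennreal (pi / q)" .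
  qed
  also have "\<dots> = ennreal (pi ^ n / d) * ennreal (pi / q)"
    unfolding d(3)[symmetric] by (rule nn_integral_multc) (rule measurable_qform, simp)
  also have "\<dots> = ennreal (pi ^ Suc n / (q * d))"
    using q d(1) by (subst ennreal_mult[symmetric]) (auto simp: mult_ac)
  finally show ?case using det q d(1) by (intro exI[of _ "q * d"]) auto
qed

text \<open>The real form of \<open>det (1 + b H H\<^sup>H)\<close>.\<close>

definition eigprod :: "nat \<Rightarrow> nat \<Rightarrow> real \<Rightarrow> (nat \<times> nat \<Rightarrow> complex) \<Rightarrow> real" where
  "eigprod Mr Mt b H = (\<Prod>l\<in>#nz_eigs Mr Mt H. 1 + b * l)"

text \<open>The link between the eigenvalues, in which the scheme is described, and the elimination
  estimates: both are expressed by the determinant of the positive definite matrix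
  \<open>Q\<close>.\<close>

lemma gint_eigprod:
  assumes "b > 0"
  shows "gint {..<Mr} {..<Mt} 1 b H = ennreal (pi ^ Mr / eigprod Mr Mt b H)"
proof -
  define Q where "Q = (\<lambda>(i, j). (if i = j then 1 else 0) + of_real b * (\<Sum>t<Mt. H (i, t) * cnj (H (j, t))))"
  have Q: "mat Mr Mr Q = of_real 1 \<cdot>\<^sub>m 1\<^sub>m Mr + of_real b \<cdot>\<^sub>m gram Mr Mt H"
    using carrier_matD[OF gram_carrier[of Mr Mt H]] by (intro eq_matI) (auto simp: Q_def gram_index)
  have qf: "qform Mr Q z = of_real ((\<Sum>i<Mr. (cmod (z i))\<^sup>2) + b * (\<Sum>t<Mt. (cmod (\<Sum>i<Mr. z i * H (i, t)))\<^sup>2))" for z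
  proof -
    have "qform Mr Q z = (\<Sum>i<Mr. \<Sum>j<Mr. (if i = j then z i * cnj (z j) else 0) + of_real b * (\<Sum>t<Mt. (z i * H (i, t)) * cnj (z j * H (j, t))))"
      unfolding qform_def Q_def by (intro sum.cong refl) (auto simp: sum_distrib_left sum_distrib_right algebra_simps)
    also have "\<dots> = (\<Sum>i<Mr. z i * cnj (z i)) + of_real b * (\<Sum>i<Mr. \<Sum>j<Mr. \<Sum>t<Mt. (z i * H (i, t)) * cnj (z j * H (j, t)))"
      by (simp add: sum.distrib sum_distrib_left)
    also have "(\<Sum>i<Mr. \<Sum>j<Mr. \<Sum>t<Mt. (z i * H (i, t)) * cnj (z j * H (j, t))) = (\<Sum>i<Mr. \<Sum>t<Mt. \<Sum>j<Mr. (z i * H (i, t)) * cnj (z j * H (j, t)))"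
      by (intro sum.cong refl sum.swap)
    also have "\<dots> = (\<Sum>t<Mt. \<Sum>i<Mr. \<Sum>j<Mr. (z i * H (i, t)) * cnj (z j * H (j, t)))"
      by (rule sum.swap)
    also have "\<dots> = (\<Sum>t<Mt. (\<Sum>i<Mr. z i * H (i, t)) * cnj (\<Sum>i<Mr. z i * H (i, t)))"
      unfolding cnj_sum sum_product ..
    also have "\<dots> = (\<Sum>t<Mt. of_real ((cmod (\<Sum>i<Mr. z i * H (i, t)))\<^sup>2))"
      by (simp only: complex_norm_square)
    also have "(\<Sum>i<Mr. z i * cnj (z i)) = (\<Sum>i<Mr. of_real ((cmod (z i))\<^sup>2))"
      by (simp only: complex_norm_square)
    finally show ?thesis by simp
  qed
  have "\<exists>d>0. det (mat Mr Mr Q) = of_real d \<and>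
    (\<integral>\<^sup>+z. ennreal (exp (- Re (qform Mr Q z))) \<partial>leb {..<Mr}) = ennreal (pi ^ Mr / d)"
  proof (rule nn_integral_gauss_qform)
    show "Q (j, i) = cnj (Q (i, j))" for i j by (auto simp: Q_def mult.commute)
    show "0 < Re (qform Mr Q z)" if "\<exists>i<Mr. z i \<noteq> 0" for z
    proof -
      obtain i where i: "i < Mr" "z i \<noteq> 0" using \<open>\<exists>i<Mr. z i \<noteq> 0\<close> by blast
      have "0 < (cmod (z i))\<^sup>2" using i by simp
      also have "\<dots> \<le> (\<Sum>i<Mr. (cmod (z i))\<^sup>2)" using i by (intro member_le_sum) auto
      finally show ?thesis unfolding qf using assms by (simp add: add_pos_nonneg sum_nonneg)
    qed
  qed
  then obtain d where d: "d > 0" "det (mat Mr Mr Q) = of_real d"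
    "(\<integral>\<^sup>+z. ennreal (exp (- Re (qform Mr Q z))) \<partial>leb {..<Mr}) = ennreal (pi ^ Mr / d)" by blast
  have "complex_of_real (eigprod Mr Mt b H) = of_real d"
    using prod_nz_eigs[of b 1 Mr Mt H] assms d(2) unfolding Q eigprod_def by simp
  then have "eigprod Mr Mt b H = d" by (simp only: of_real_eq_iff)
  then show ?thesis using d(3) unfolding gint_def qf by simp
qed

lemma eigprod_ge_1: "b \<ge> 0 \<Longrightarrow> eigprod Mr Mt b H \<ge> 1"
proof -
  assume b: "b \<ge> 0"
  have "(\<Prod>l\<in>#A. 1 + b * l) \<ge> 1" if "\<And>l. l \<in># A \<Longrightarrow> l \<ge> 0" for A
    using that
  proof (induction A)
    case (add l A)
    have "1 * 1 \<le> (1 + b * l) * (\<Prod>l\<in>#A. 1 + b * l)"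
      using add b by (intro mult_mono) auto
    then show ?case by simp
  qed simp
  then show ?thesis unfolding eigprod_def using nz_eigs_nonneg by blast
qed

section \<open>The law of the channel matrix as a density\<close>

lemma prob_space_cgauss: "prob_space cgauss"
proof
  have "emeasure cgauss (space cgauss) = (\<integral>\<^sup>+z. ennreal (exp (- (1 * (cmod z)\<^sup>2))) * ennreal (1 / pi) \<partial>lborel)"
    unfolding cgauss_def by (subst emeasure_density) (auto simp: power2_eq_square divide_inverse simp flip: ennreal_mult')
  also have "\<dots> = ennreal (pi / 1) * ennreal (1 / pi)"
    using nn_integral_complex_gauss[of 1] by (subst nn_integral_multc) auto
  also have "\<dots> = 1" by (simp flip: ennreal_mult')
  finally show "emeasure cgauss (space cgauss) = 1" .
qed

lemma sets_cgauss [measurable_cong, simp]: "sets cgauss = sets borel"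
  by (simp add: cgauss_def)

lemma product_sigma_finite_cgauss: "product_sigma_finite (\<lambda>_. cgauss)"
  using prob_space_cgauss by (intro product_sigma_finite.intro prob_space_imp_sigma_finite)

lemma sets_chan_measure: "sets (chan_measure Mr Mt) = sets (leb ({..<Mr} \<times> {..<Mt}))"
  unfolding chan_measure_def by (intro sets_PiM_cong) auto

lemma chan_measure_density:
  "chan_measure Mr Mt = density (leb ({..<Mr} \<times> {..<Mt}))
     (\<lambda>H. ennreal (1 / pi ^ (Mr * Mt)) * gweight 1 ({..<Mr}\<times>{..<Mt}) H)"
proof -
  let ?S = "{..<Mr} \<times> {..<Mt}"
  let ?d = "\<lambda>z. ennreal (exp (- (cmod z * cmod z)) / pi)"
  interpret L: product_sigma_finite "\<lambda>_. lborel :: complex measure" by (rule product_sigma_finite_lborel)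
  interpret C: product_sigma_finite "\<lambda>_. cgauss" by (rule product_sigma_finite_cgauss)
  have prod: "ennreal (1 / pi ^ (Mr * Mt)) * gweight 1 ?S H = (\<Prod>p\<in>?S. ?d (H p))" for H
  proof -
    have "(\<Prod>p\<in>?S. ?d (H p)) = ennreal (\<Prod>p\<in>?S. exp (- (cmod (H p))\<^sup>2) * (1 / pi))"
      by (subst prod_ennreal) (auto simp: power2_eq_square divide_inverse)
    also have "(\<Prod>p\<in>?S. exp (- (cmod (H p))\<^sup>2) * (1 / pi)) = exp (- sqnorm ?S H) * (1 / pi ^ (Mr * Mt))"
      unfolding prod.distrib by (simp add: exp_sum[symmetric] sum_negf power_one_over card_cartesian_product)
    finally show ?thesis by (simp add: mult.commute flip: ennreal_mult')
  qed
  show ?thesis unfolding chan_measure_def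
  proof (rule C.PiM_eqI[symmetric])
    show "sets (density (leb ?S) (\<lambda>H. ennreal (1 / pi ^ (Mr * Mt)) * gweight 1 ?S H)) = sets (PiM ?S (\<lambda>_. cgauss))"
      using sets_chan_measure[of Mr Mt] by (simp add: chan_measure_def)
    fix A :: "nat \<times> nat \<Rightarrow> complex set" assume A: "\<And>i. i \<in> ?S \<Longrightarrow> A i \<in> sets cgauss"
    have "emeasure (density (leb ?S) (\<lambda>H. ennreal (1 / pi ^ (Mr * Mt)) * gweight 1 ?S H)) (Pi\<^sub>E ?S A)
      = (\<integral>\<^sup>+H. (ennreal (1 / pi ^ (Mr * Mt)) * gweight 1 ?S H) * indicator (Pi\<^sub>E ?S A) H \<partial>leb ?S)"
      using A by (intro emeasure_density borel_measurable_times_ennreal borel_measurable_const measurable_matrix_weight sets_PiM_I_finite) auto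
    also have "\<dots> = (\<integral>\<^sup>+H. (\<Prod>p\<in>?S. ?d (H p) * indicator (A p) (H p)) \<partial>leb ?S)"
    proof (rule nn_integral_cong)
      fix H assume H: "H \<in> space (leb ?S)"
      have "indicator (Pi\<^sub>E ?S A) H = (\<Prod>p\<in>?S. indicator (A p) (H p) :: ennreal)"
      proof (cases "H \<in> Pi\<^sub>E ?S A")
        case True
        then have "(\<Prod>p\<in>?S. indicator (A p) (H p) :: ennreal) = 1"
          by (intro prod.neutral ballI indicator_simps(1)) (rule PiE_mem[OF True])
        then show ?thesis using True by simp
      next
        case False
        then obtain p where "p \<in> ?S" "H p \<notin> A p" using H by (auto simp: space_PiM PiE_iff)
        then have "\<exists>p\<in>?S. indicator (A p) (H p) = (0::ennreal)" by (intro bexI[of _ p] indicator_simps(2))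
        then have "(\<Prod>p\<in>?S. indicator (A p) (H p) :: ennreal) = 0" by (intro prod_zero) simp_all
        then show ?thesis using False by simp
      qed
      then show "(ennreal (1 / pi ^ (Mr * Mt)) * gweight 1 ?S H) * indicator (Pi\<^sub>E ?S A) H = (\<Prod>p\<in>?S. ?d (H p) * indicator (A p) (H p))"
        unfolding prod by (simp only: prod.distrib)
    qed
    also have "\<dots> = (\<Prod>p\<in>?S. \<integral>\<^sup>+z. ?d z * indicator (A p) z \<partial>lborel)"
      using A by (intro L.product_nn_integral_prod) auto
    also have "\<dots> = (\<Prod>p\<in>?S. emeasure cgauss (A p))"
      unfolding cgauss_def using A by (intro prod.cong refl emeasure_density[symmetric]) auto
    finally show "emeasure (density (leb ?S) (\<lambda>H. ennreal (1 / pi ^ (Mr * Mt)) * gweight 1 ?S H)) (Pi\<^sub>E ?S A) = (\<Prod>p\<in>?S. emeasure cgauss (A p))" .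
  qed auto
qed

lemma prob_space_chan_measure: "prob_space (chan_measure Mr Mt)"
  unfolding chan_measure_def using prob_space_cgauss by (intro prob_space_PiM)

lemma measurable_chan_iff: "f \<in> borel_measurable (chan_measure Mr Mt) \<longleftrightarrow> f \<in> borel_measurable (leb ({..<Mr} \<times> {..<Mt}))"
  using sets_chan_measure[of Mr Mt] by (intro iffI) (simp_all cong: measurable_cong_sets)

lemma nn_integral_chan_measure:
  assumes "f \<in> borel_measurable (leb ({..<Mr} \<times> {..<Mt}))"
  shows "(\<integral>\<^sup>+H. f H \<partial>chan_measure Mr Mt) = ennreal (1 / pi ^ (Mr * Mt)) *
    (\<integral>\<^sup>+H. f H * gweight 1 ({..<Mr}\<times>{..<Mt}) H \<partial>leb ({..<Mr} \<times> {..<Mt}))"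
proof -
  have m: "(\<lambda>H. gweight 1 ({..<Mr}\<times>{..<Mt}) H) \<in> borel_measurable (leb ({..<Mr} \<times> {..<Mt}))"
    by (rule measurable_matrix_weight) simp
  have "(\<integral>\<^sup>+H. f H \<partial>chan_measure Mr Mt) = (\<integral>\<^sup>+H. (ennreal (1 / pi ^ (Mr * Mt)) * gweight 1 ({..<Mr}\<times>{..<Mt}) H) * f H \<partial>leb ({..<Mr} \<times> {..<Mt}))"
    unfolding chan_measure_density using m assms by (intro nn_integral_density borel_measurable_times_ennreal) auto
  also have "\<dots> = (\<integral>\<^sup>+H. ennreal (1 / pi ^ (Mr * Mt)) * (f H * gweight 1 ({..<Mr}\<times>{..<Mt}) H) \<partial>leb ({..<Mr} \<times> {..<Mt}))"
    by (simp only: mult_ac)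
  also have "\<dots> = ennreal (1 / pi ^ (Mr * Mt)) *
    (\<integral>\<^sup>+H. f H * gweight 1 ({..<Mr}\<times>{..<Mt}) H \<partial>leb ({..<Mr} \<times> {..<Mt}))"
    using m assms by (intro nn_integral_cmult borel_measurable_times_ennreal)
  finally show ?thesis .
qed

section \<open>Diversity-multiplexing tradeoff\<close>

definition clamp01 :: "real \<Rightarrow> real" where "clamp01 t = max 0 (min 1 t)"

text \<open>The diversity-multiplexing tradeoff curve: the piecewise linear interpolation of the points
  \<open>(k, \<Phi>\<^sub>k)\<close>.\<close>
definition dmt :: "nat \<Rightarrow> nat \<Rightarrow> real \<Rightarrow> real" where
  "dmt n m x = (\<Sum>l<min n m. (1 - clamp01 (x - real l)) * (real n + real m - 1 - 2 * real l))"

lemma sum_clamp01: "x \<ge> 0 \<Longrightarrow> (\<Sum>l<m. clamp01 (x - real l)) = min (real m) x"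
  by (induction m) (auto simp: clamp01_def min_def max_def)

lemma dmt_weight_ge_1:
  assumes "l < min n m"
  shows "real n + real m - 1 - 2 * real l \<ge> 1"
  using assms by linarith

lemma continuous_on_dmt: "continuous_on UNIV (dmt n m)"
  unfolding dmt_def[abs_def] clamp01_def by (intro continuous_intros)

lemma dmt_antimono: "x \<le> y \<Longrightarrow> dmt n m y \<le> dmt n m x"
  unfolding dmt_def using dmt_weight_ge_1[of _ n m]
  by (intro sum_mono mult_right_mono) (force simp: clamp01_def)+

lemma dmt_eq_0: "real (min n m) \<le> x \<Longrightarrow> dmt n m x = 0"
  unfolding dmt_def by (intro sum.neutral) (auto simp: clamp01_def)

lemma dmt_nonneg: "dmt n m x \<ge> 0"
  unfolding dmt_def using dmt_weight_ge_1[of _ n m]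
  by (intro sum_nonneg mult_nonneg_nonneg) (force simp: clamp01_def)+

lemma eigprod_pos: "b \<ge> 0 \<Longrightarrow> eigprod Mr Mt b H > 0"
  using eigprod_ge_1[of b Mr Mt H] by simp

lemma eigprod_gint:
  assumes "b > 0"
  shows "eigprod Mr Mt b H = pi ^ Mr / enn2real (gint {..<Mr} {..<Mt} 1 b H)"
  using eigprod_pos[of b Mr Mt H] assms by (subst gint_eigprod) simp_all

lemma measurable_eigprod_chan:
  assumes "b > 0"
  shows "eigprod Mr Mt b \<in> borel_measurable (leb ({..<Mr} \<times> {..<Mt}))"
proof -
  have "(\<lambda>H. gint {..<Mr} {..<Mt} 1 b H) \<in> borel_measurable (leb ({..<Mr} \<times> {..<Mt}))"
    by (rule measurable_gint_PiM) simp
  then have "(\<lambda>H. pi ^ Mr / enn2real (gint {..<Mr} {..<Mt} 1 b H)) \<in> borel_measurable (leb ({..<Mr} \<times> {..<Mt}))"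
    by (intro borel_measurable_divide borel_measurable_const borel_measurable_enn2real)
  moreover have "eigprod Mr Mt b = (\<lambda>H. pi ^ Mr / enn2real (gint {..<Mr} {..<Mt} 1 b H))"
    using eigprod_gint[OF assms] by (intro ext)
  ultimately show ?thesis by simp
qed

text \<open>The weight \<open>k = 1\<close> belongs to the channel law. The weight
  \<open>k = 1/2\<close> serves \<open>expected_inverse_eigs\<close>, where the other half of the
  Gaussian has to pay for powers of the Frobenius norm.\<close>

lemma eigprod_weighted_moment:
  fixes q :: "nat \<Rightarrow> real" and s :: nat
  assumes "k > 0" "c > 0"
    and q: "\<And>l. l < min Mr Mt \<Longrightarrow> 0 \<le> q l \<and> q l \<le> s \<and> q l < real Mr + real Mt - 1 - 2 * real l"
  shows "\<exists>C\<ge>0. \<forall>rho\<ge>1.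
      (\<integral>\<^sup>+H. ennreal ((1 / eigprod Mr Mt (c * rho) H) ^ s) * gweight k ({..<Mr}\<times>{..<Mt}) H \<partial>leb ({..<Mr}\<times>{..<Mt}))
      \<le> ennreal (C * rho powr (- (\<Sum>l<min Mr Mt. q l)))"
proof -
  have "\<exists>C\<ge>0. \<forall>rho\<ge>1.
      (\<integral>\<^sup>+H. gint {..<Mr} {..<Mt} 1 (c * rho) H ^ s * gweight k ({..<Mr}\<times>{..<Mt}) H \<partial>leb ({..<Mr} \<times> {..<Mt}))
      \<le> ennreal (C * rho powr (- (\<Sum>l<min (card {..<Mr}) (card {..<Mt}). q l)))"
    by (rule gint_moment_le) (use assms in auto)
  then obtain C where C: "C \<ge> 0" and b: "\<And>rho. rho \<ge> 1 \<Longrightarrow> (\<integral>\<^sup>+H. gint {..<Mr} {..<Mt} 1 (c * rho) H ^ s * gweight k ({..<Mr}\<times>{..<Mt}) H \<partial>leb ({..<Mr} \<times> {..<Mt}))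
      \<le> ennreal (C * rho powr (- (\<Sum>l<min Mr Mt. q l)))" by auto
  have "(\<integral>\<^sup>+H. ennreal ((1 / eigprod Mr Mt (c * rho) H) ^ s) * gweight k ({..<Mr}\<times>{..<Mt}) H \<partial>leb ({..<Mr}\<times>{..<Mt}))
      \<le> ennreal ((1 / pi ^ Mr) ^ s * C * rho powr (- (\<Sum>l<min Mr Mt. q l)))" if rho: "rho \<ge> 1" for rho
  proof -
    have cr: "c * rho > 0" using rho assms by simp
    have eq: "ennreal ((1 / eigprod Mr Mt (c * rho) H) ^ s) = ennreal ((1 / pi ^ Mr) ^ s) * gint {..<Mr} {..<Mt} 1 (c * rho) H ^ s" for H
    proof -
      have "gint {..<Mr} {..<Mt} 1 (c * rho) H ^ s = ennreal ((pi ^ Mr / eigprod Mr Mt (c * rho) H) ^ s)"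
        using eigprod_pos[of "c * rho" Mr Mt H] cr by (simp add: gint_eigprod ennreal_power)
      then show ?thesis
        using eigprod_pos[of "c * rho" Mr Mt H] cr by (simp add: power_divide flip: ennreal_mult')
    qed
    have "(\<integral>\<^sup>+H. ennreal ((1 / eigprod Mr Mt (c * rho) H) ^ s) * gweight k ({..<Mr}\<times>{..<Mt}) H \<partial>leb ({..<Mr}\<times>{..<Mt}))
      = ennreal ((1 / pi ^ Mr) ^ s) * (\<integral>\<^sup>+H. gint {..<Mr} {..<Mt} 1 (c * rho) H ^ s * gweight k ({..<Mr}\<times>{..<Mt}) H \<partial>leb ({..<Mr} \<times> {..<Mt}))"
      unfolding eq mult.assoc
      by (intro nn_integral_cmult borel_measurable_times_ennreal borel_measurable_power_ennreal measurable_gint_PiM measurable_matrix_weight) auto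
    also have "\<dots> \<le> ennreal ((1 / pi ^ Mr) ^ s) * ennreal (C * rho powr (- (\<Sum>l<min Mr Mt. q l)))"
      using b[OF rho] by (intro mult_left_mono) auto
    also have "\<dots> = ennreal ((1 / pi ^ Mr) ^ s * C * rho powr (- (\<Sum>l<min Mr Mt. q l)))"
      using C by (subst ennreal_mult[symmetric]) (auto simp: mult_ac)
    finally show ?thesis .
  qed
  then show ?thesis using C by (intro exI[of _ "(1 / pi ^ Mr) ^ s * C"]) auto
qed

lemma eigprod_moment:
  fixes q :: "nat \<Rightarrow> real" and s :: nat
  assumes "c > 0"
    and q: "\<And>l. l < min Mr Mt \<Longrightarrow> 0 \<le> q l \<and> q l \<le> s \<and> q l < real Mr + real Mt - 1 - 2 * real l"
  shows "\<exists>C\<ge>0. \<forall>rho\<ge>1. (\<integral>\<^sup>+H. ennreal ((1 / eigprod Mr Mt (c * rho) H) ^ s) \<partial>chan_measure Mr Mt)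
      \<le> ennreal (C * rho powr (- (\<Sum>l<min Mr Mt. q l)))"
proof -
  obtain C where C: "C \<ge> 0" and b: "\<And>rho. rho \<ge> 1 \<Longrightarrow>
      (\<integral>\<^sup>+H. ennreal ((1 / eigprod Mr Mt (c * rho) H) ^ s) * gweight 1 ({..<Mr}\<times>{..<Mt}) H \<partial>leb ({..<Mr}\<times>{..<Mt}))
      \<le> ennreal (C * rho powr (- (\<Sum>l<min Mr Mt. q l)))"
    using eigprod_weighted_moment[of 1 c Mr Mt q s] assms by auto
  have "(\<integral>\<^sup>+H. ennreal ((1 / eigprod Mr Mt (c * rho) H) ^ s) \<partial>chan_measure Mr Mt)
      \<le> ennreal (1 / pi ^ (Mr * Mt) * C * rho powr (- (\<Sum>l<min Mr Mt. q l)))" if rho: "rho \<ge> 1" for rho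
  proof -
    have m: "(\<lambda>H. ennreal ((1 / eigprod Mr Mt (c * rho) H) ^ s)) \<in> borel_measurable (leb ({..<Mr}\<times>{..<Mt}))"
      using rho assms by (intro measurable_compose[OF _ measurable_ennreal] borel_measurable_power borel_measurable_divide borel_measurable_const measurable_eigprod_chan) auto
    have "(\<integral>\<^sup>+H. ennreal ((1 / eigprod Mr Mt (c * rho) H) ^ s) \<partial>chan_measure Mr Mt)
      \<le> ennreal (1 / pi ^ (Mr * Mt)) * ennreal (C * rho powr (- (\<Sum>l<min Mr Mt. q l)))"
      unfolding nn_integral_chan_measure[OF m] using b[OF rho] by (intro mult_left_mono) auto
    also have "\<dots> = ennreal (1 / pi ^ (Mr * Mt) * C * rho powr (- (\<Sum>l<min Mr Mt. q l)))"
      using C by (subst ennreal_mult[symmetric]) (auto simp: mult_ac)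
    finally show ?thesis .
  qed
  then show ?thesis using C by (intro exI[of _ "1 / pi ^ (Mr * Mt) * C"]) auto
qed

text \<open>Chernoff's bound with the exponent \<open>s\<close> equal to minus the slope of the tradeoff curve at
  \<open>x\<close>.\<close>
lemma eigprod_tail_le:
  assumes "c > 0" "K > 0" "x \<ge> 0" "d > 0"
  shows "\<exists>C\<ge>0. \<forall>rho\<ge>1. emeasure (chan_measure Mr Mt) {H \<in> space (chan_measure Mr Mt). eigprod Mr Mt (c * rho) H \<le> K * rho powr x}
    \<le> ennreal (C * rho powr (- (dmt Mr Mt x - d)))"
proof (cases "x < real (min Mr Mt)")
  case False
  then have d0: "dmt Mr Mt x = 0" by (intro dmt_eq_0) simp
  interpret prob_space "chan_measure Mr Mt" by (rule prob_space_chan_measure)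
  have "emeasure (chan_measure Mr Mt) A \<le> ennreal (1 * rho powr (- (dmt Mr Mt x - d)))" if rho: "rho \<ge> 1" for rho A
  proof -
    have "emeasure (chan_measure Mr Mt) A \<le> 1" by (rule emeasure_le_1)
    also have "1 \<le> ennreal (1 * rho powr (- (dmt Mr Mt x - d)))"
      using rho assms unfolding d0 by (simp add: ge_one_powr_ge_zero)
    finally show ?thesis .
  qed
  then show ?thesis by (intro exI[of _ 1]) auto
next
  case True
  define m where "m = min Mr Mt"
  define k where "k = nat \<lfloor>x\<rfloor>"
  have k: "real k \<le> x" "x < real k + 1" using assms(3) by (auto simp: k_def)
  have "real k < real m" unfolding m_def using k(1) True by linarith
  then have km: "k < m" by (simp only: of_nat_less_iff)
  have m1: "m \<ge> 1" using km by simp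
  define s where "s = Mr + Mt - 1 - 2 * k"
  have s: "real s = real Mr + real Mt - 1 - 2 * real k"
    using km by (auto simp: s_def m_def of_nat_diff)
  \<comment> \<open>Moments are available only for exponents strictly below \<open>U l\<close>. The
    loss \<open>e\<close> at each of the \<open>m\<close> steps adds up to at most \<open>d\<close>,
    and \<open>e \<le> 1 \<le> U l\<close> keeps the exponents nonnegative.\<close>
  define e where "e = min d 1 / real m"
  have e: "e > 0" "e \<le> 1" "real m * e \<le> d" using assms(4) m1 by (auto simp: e_def field_simps)
  define U where "U l = real Mr + real Mt - 1 - 2 * real l" for l
  have U1: "U l \<ge> 1" if "l < m" for l using dmt_weight_ge_1[of l Mr Mt] that by (simp add: U_def m_def)
  define q where "q l = min (real s) (U l - e)" for l
  have q: "0 \<le> q l \<and> q l \<le> s \<and> q l < real Mr + real Mt - 1 - 2 * real l" if "l < min Mr Mt" for l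
    using U1[of l] e that by (auto simp: q_def m_def U_def)
  obtain C where C: "C \<ge> 0" and Cb: "\<And>rho. rho \<ge> 1 \<Longrightarrow> (\<integral>\<^sup>+H. ennreal ((1 / eigprod Mr Mt (c * rho) H) ^ s) \<partial>chan_measure Mr Mt)
      \<le> ennreal (C * rho powr (- (\<Sum>l<min Mr Mt. q l)))"
    using eigprod_moment[of c Mr Mt q s] assms q by auto
  have sumq: "(\<Sum>l<min Mr Mt. q l) \<ge> dmt Mr Mt x + s * x - d"
  proof -
    have "(\<Sum>l<min Mr Mt. (1 - clamp01 (x - real l)) * U l + s * clamp01 (x - real l) - e) \<le> (\<Sum>l<min Mr Mt. q l)"
    proof (intro sum_mono)
      fix l assume l: "l \<in> {..<min Mr Mt}"
      \<comment> \<open>Duality at the optimal \<open>s = U k\<close>: before \<open>k\<close> the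
        clamp is 1 and \<open>s\<close> is the smaller value, after \<open>k\<close> the clamp is 0
        and \<open>U l\<close> is the smaller value, and at \<open>k\<close> the two agree.\<close>
      have "(1 - clamp01 (x - real l)) * U l + s * clamp01 (x - real l) = min (real s) (U l)"
      proof (cases l k rule: linorder_cases)
        case less
        then have "real l + 1 \<le> real k" by linarith
        then show ?thesis using k s by (simp add: clamp01_def U_def)
      next
        case equal
        moreover have "U k = real s" using s by (simp add: U_def)
        ultimately show ?thesis by (simp add: algebra_simps)
      next
        case greater
        then have "real k + 1 \<le> real l" by linarith
        then show ?thesis using k s by (simp add: clamp01_def U_def)
      qed
      then show "(1 - clamp01 (x - real l)) * U l + s * clamp01 (x - real l) - e \<le> q l"
        using e by (simp add: q_def)
    qed
    moreover have "(\<Sum>l<min Mr Mt. (1 - clamp01 (x - real l)) * U l + s * clamp01 (x - real l) - e) = dmt Mr Mt x + s * x - real m * e"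
      using assms(3) True by (simp add: sum.distrib sum_subtractf dmt_def U_def sum_distrib_left[symmetric] sum_clamp01 m_def)
    ultimately show ?thesis using e by linarith
  qed
  have "emeasure (chan_measure Mr Mt) {H \<in> space (chan_measure Mr Mt). eigprod Mr Mt (c * rho) H \<le> K * rho powr x}
    \<le> ennreal (K ^ s * C * rho powr (- (dmt Mr Mt x - d)))" if rho: "rho \<ge> 1" for rho
  proof -
    let ?f = "eigprod Mr Mt (c * rho)"
    have fm: "?f \<in> borel_measurable (chan_measure Mr Mt)"
      unfolding measurable_chan_iff using rho assms by (intro measurable_eigprod_chan) auto
    have fp: "?f H > 0" for H using rho assms by (intro eigprod_pos) auto
    have "emeasure (chan_measure Mr Mt) {H \<in> space (chan_measure Mr Mt). ?f H \<le> K * rho powr x}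
      = (\<integral>\<^sup>+H. indicator {H \<in> space (chan_measure Mr Mt). ?f H \<le> K * rho powr x} H \<partial>chan_measure Mr Mt)"
      using fm by (intro nn_integral_indicator[symmetric]) measurable
    also have "\<dots> \<le> (\<integral>\<^sup>+H. ennreal ((K * rho powr x) ^ s) * ennreal ((1 / ?f H) ^ s) \<partial>chan_measure Mr Mt)"
    proof (intro nn_integral_mono)
      fix H
      show "indicator {H \<in> space (chan_measure Mr Mt). ?f H \<le> K * rho powr x} H \<le> ennreal ((K * rho powr x) ^ s) * ennreal ((1 / ?f H) ^ s)"
      proof (cases "?f H \<le> K * rho powr x")
        case True
        have "1 \<le> (K * rho powr x) * (1 / ?f H)" using True fp[of H] by simp
        then have "1 \<le> ((K * rho powr x) * (1 / ?f H)) ^ s" by (rule one_le_power)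
        then have "1 \<le> ennreal ((K * rho powr x) ^ s * (1 / ?f H) ^ s)" unfolding power_mult_distrib by simp
        then show ?thesis using assms fp[of H] by (subst ennreal_mult[symmetric]) (auto simp: indicator_def)
      qed simp
    qed
    also have "\<dots> = ennreal ((K * rho powr x) ^ s) * (\<integral>\<^sup>+H. ennreal ((1 / ?f H) ^ s) \<partial>chan_measure Mr Mt)"
      using fm by (intro nn_integral_cmult) measurable
    also have "\<dots> \<le> ennreal ((K * rho powr x) ^ s) * ennreal (C * rho powr (- (\<Sum>l<min Mr Mt. q l)))"
      using Cb[OF rho] by (intro mult_left_mono) auto
    also have "\<dots> \<le> ennreal ((K * rho powr x) ^ s) * ennreal (C * rho powr (- (dmt Mr Mt x + s * x - d)))"
      using sumq rho C by (intro mult_left_mono ennreal_leI powr_mono) auto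
    also have "\<dots> = ennreal (K ^ s * C * rho powr (- (dmt Mr Mt x - d)))"
    proof -
      have "(rho powr x) ^ s * rho powr (- (dmt Mr Mt x + s * x - d)) = rho powr (- (dmt Mr Mt x - d))"
        using rho by (simp add: powr_power flip: powr_add)
      then have "(K * rho powr x) ^ s * (C * rho powr (- (dmt Mr Mt x + s * x - d))) = K ^ s * C * rho powr (- (dmt Mr Mt x - d))"
        by (simp add: power_mult_distrib mult_ac)
      then show ?thesis using C assms by (subst ennreal_mult[symmetric]) auto
    qed
    finally show ?thesis .
  qed
  then show ?thesis using C assms by (intro exI[of _ "K ^ s * C"]) auto
qed

text \<open>The choice of \<open>t\<close> is greedy. The weights decrease with \<open>l\<close>, so
  the budget \<open>x\<close> is used to keep the earliest pivots large, whose smallness would cost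
  most; the others are small, one of them possibly in part.\<close>

lemma eigprod_tail_ge:
  assumes "c > 0" "x \<ge> 0"
  shows "\<exists>K>0. \<exists>C>0. \<forall>rho\<ge>1. ennreal (C * rho powr (- dmt Mr Mt x)) \<le>
     emeasure (chan_measure Mr Mt) {H \<in> space (chan_measure Mr Mt). eigprod Mr Mt (c * rho) H \<le> K * rho powr x}"
proof -
  define t where "t l = 1 - clamp01 (x - real l)" for l :: nat
  have "\<exists>C>0. \<forall>rho\<ge>1.
      ennreal (C * rho powr (- (\<Sum>l<min (card {..<Mr}) (card {..<Mt}). t l * (real (card {..<Mr}) + real (card {..<Mt}) - 1 - 2 * real l)))) \<le>
      (\<integral>\<^sup>+H. indicator {H. ennreal (C * rho powr (- (\<Sum>l<min (card {..<Mr}) (card {..<Mt}). 1 - t l))) \<le> gint {..<Mr} {..<Mt} 1 (c * rho) H} H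
         * gweight 1 ({..<Mr}\<times>{..<Mt}) H \<partial>leb ({..<Mr} \<times> {..<Mt}))"
    by (rule gint_tail_ge) (use assms in \<open>auto simp: t_def clamp01_def\<close>)
  then obtain C where C: "C > 0" and Cb: "\<And>rho. rho \<ge> 1 \<Longrightarrow> ennreal (C * rho powr (- dmt Mr Mt x)) \<le>
      (\<integral>\<^sup>+H. indicator {H. ennreal (C * rho powr (- min (real (min Mr Mt)) x)) \<le> gint {..<Mr} {..<Mt} 1 (c * rho) H} H
         * gweight 1 ({..<Mr}\<times>{..<Mt}) H \<partial>leb ({..<Mr} \<times> {..<Mt}))"
    using sum_clamp01[OF assms(2), of "min Mr Mt"] by (auto simp: t_def dmt_def)
  have "ennreal (1 / pi ^ (Mr * Mt) * C * rho powr (- dmt Mr Mt x)) \<le>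
     emeasure (chan_measure Mr Mt) {H \<in> space (chan_measure Mr Mt). eigprod Mr Mt (c * rho) H \<le> (pi ^ Mr / C) * rho powr x}" if rho: "rho \<ge> 1" for rho
  proof -
    let ?f = "eigprod Mr Mt (c * rho)"
    let ?E = "{H. ennreal (C * rho powr (- min (real (min Mr Mt)) x)) \<le> gint {..<Mr} {..<Mt} 1 (c * rho) H}"
    have cr: "c * rho > 0" using rho assms by simp
    have fm: "?f \<in> borel_measurable (chan_measure Mr Mt)"
      unfolding measurable_chan_iff using cr by (rule measurable_eigprod_chan)
    have fp: "?f H > 0" for H using cr by (intro eigprod_pos) auto
    have Em: "(\<lambda>H. indicator ?E H :: ennreal) \<in> borel_measurable (leb ({..<Mr} \<times> {..<Mt}))"
      by (intro borel_measurable_indicator') (auto intro!: borel_measurable_le measurable_gint_PiM)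
    have "ennreal (1 / pi ^ (Mr * Mt) * C * rho powr (- dmt Mr Mt x)) = ennreal (1 / pi ^ (Mr * Mt)) * ennreal (C * rho powr (- dmt Mr Mt x))"
      using C by (subst ennreal_mult[symmetric]) (auto simp: mult_ac)
    also have "\<dots> \<le> (\<integral>\<^sup>+H. indicator ?E H \<partial>chan_measure Mr Mt)"
      unfolding nn_integral_chan_measure[OF Em] using Cb[OF rho] by (intro mult_left_mono) auto
    also have "\<dots> \<le> (\<integral>\<^sup>+H. indicator {H \<in> space (chan_measure Mr Mt). ?f H \<le> (pi ^ Mr / C) * rho powr x} H \<partial>chan_measure Mr Mt)"
    proof (intro nn_integral_mono)
      fix H assume H: "H \<in> space (chan_measure Mr Mt)"
      show "indicator ?E H \<le> (indicator {H \<in> space (chan_measure Mr Mt). ?f H \<le> (pi ^ Mr / C) * rho powr x} H :: ennreal)"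
      proof (cases "H \<in> ?E")
        case True
        then have "C * rho powr (- min (real (min Mr Mt)) x) \<le> pi ^ Mr / ?f H"
          using fp[of H] by (simp add: gint_eigprod[OF cr] divide_nonneg_pos)
        moreover have "C * rho powr (- x) \<le> C * rho powr (- min (real (min Mr Mt)) x)"
          using C rho by (intro mult_left_mono powr_mono) auto
        ultimately have "C * rho powr (- x) \<le> pi ^ Mr / ?f H" by linarith
        then have "C * rho powr (- x) * ?f H \<le> pi ^ Mr" using fp[of H] by (simp add: field_simps)
        then have "?f H \<le> (pi ^ Mr / C) * rho powr x" using C rho by (simp add: powr_minus field_simps)
        then show ?thesis using H by (simp add: indicator_def)
      qed simp
    qed
    also have "\<dots> = emeasure (chan_measure Mr Mt) {H \<in> space (chan_measure Mr Mt). ?f H \<le> (pi ^ Mr / C) * rho powr x}"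
      using fm by (intro nn_integral_indicator) measurable
    finally show ?thesis .
  qed
  then show ?thesis using C by (intro exI[of _ "pi ^ Mr / C"] conjI exI[of _ "1 / pi ^ (Mr * Mt) * C"]) auto
qed

text \<open>Each \<open>1 / (1 + b * l)\<close> is the product of the other factors divided by the determinant, and
  the other factors are controlled by the Frobenius norm.\<close>
lemma inverse_eig_sum_le:
  assumes b: "b \<ge> 0"
  shows "(\<Sum>l\<in>#nz_eigs Mr Mt H. 1 / (1 + b * l)) \<le>
    real (min Mr Mt) * ((1 + b * sqnorm ({..<Mr}\<times>{..<Mt}) H) ^ (min Mr Mt - 1) / eigprod Mr Mt b H)"
proof -
  define S where "S = sqnorm ({..<Mr}\<times>{..<Mt}) H"
  have S0: "S \<ge> 0" by (simp add: S_def sum_nonneg)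
  let ?A = "nz_eigs Mr Mt H"
  have prod_le: "(\<Prod>l\<in>#B. 1 + b * l) \<le> (1 + b * S) ^ size B" "(\<Prod>l\<in>#B. 1 + b * l) \<ge> 0" if "\<And>l. l \<in># B \<Longrightarrow> 0 \<le> l \<and> l \<le> S" for B
    using that
  proof (induction B)
    case (add l B)
    {
      case 1
      then show ?case using add b S0 by (auto intro!: mult_mono mult_left_mono)
    next
      case 2
      then show ?case using add b by auto
    }
  qed auto
  have each: "1 / (1 + b * l) \<le> (1 + b * S) ^ (min Mr Mt - 1) / eigprod Mr Mt b H" if l: "l \<in># ?A" for l
  proof -
    obtain B where B: "?A = add_mset l B" using l by (metis mset_add)
    have l0: "0 \<le> l" using nz_eigs_nonneg[OF l] .
    have Bb: "0 \<le> l \<and> l \<le> S" if "l \<in># B" for l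
      using that B nz_eigs_nonneg[of l Mr Mt H] nz_eigs_le[of l Mr Mt H] by (simp add: S_def)
    have sB: "size B = min Mr Mt - 1" using size_nz_eigs[of Mr Mt H] B by simp
    have pos: "1 + b * l > 0" using l0 b by (simp add: add_pos_nonneg)
    have ep: "eigprod Mr Mt b H = (1 + b * l) * (\<Prod>l\<in>#B. 1 + b * l)" unfolding eigprod_def B by simp
    have epp: "eigprod Mr Mt b H > 0" using eigprod_pos[OF b] .
    have "1 / (1 + b * l) = (\<Prod>l\<in>#B. 1 + b * l) / eigprod Mr Mt b H"
      using epp pos unfolding ep by (simp add: field_simps)
    also have "\<dots> \<le> (1 + b * S) ^ (min Mr Mt - 1) / eigprod Mr Mt b H"
    proof -
      have "(\<Prod>l\<in>#B. 1 + b * l) \<le> (1 + b * S) ^ size B" by (rule prod_le(1), rule Bb)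
      then show ?thesis using epp unfolding sB by (intro divide_right_mono) auto
    qed
    finally show ?thesis .
  qed
  have sum_le: "(\<Sum>l\<in>#B. 1 / (1 + b * l)) \<le> real (size B) * c" if "\<And>l. l \<in># B \<Longrightarrow> 1 / (1 + b * l) \<le> c" for B c
    using that
  proof (induction B)
    case (add l B)
    have "1 / (1 + b * l) + (\<Sum>l\<in>#B. 1 / (1 + b * l)) \<le> c + real (size B) * c"
      using add by (intro add_mono) auto
    then show ?case by (simp add: algebra_simps)
  qed simp
  have "(\<Sum>l\<in>#?A. 1 / (1 + b * l)) \<le> real (size ?A) * ((1 + b * S) ^ (min Mr Mt - 1) / eigprod Mr Mt b H)"
    by (rule sum_le, rule each)
  then show ?thesis unfolding size_nz_eigs S_def .
qed

section \<open>Expected inverse eigenvalues and side information\<close>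

text \<open>By \<open>inverse_eig_sum_le\<close> the sum is at most a polynomial of degree
  \<open>m - 1\<close> in \<open>rho\<close> times the squared Frobenius norm, divided by the
  determinant. The first inverse moment of the determinant contributes almost
  \<open>rho powr (- m)\<close>, so \<open>rho powr (- 1)\<close> remains up to the loss
  \<open>d\<close>.\<close>

lemma expected_inverse_eigs:
  assumes "c > 0" "d > 0" and m1: "min Mr Mt \<ge> 1"
  shows "\<exists>C\<ge>0. \<forall>rho\<ge>1. (\<integral>\<^sup>+H. ennreal (\<Sum>l\<in>#nz_eigs Mr Mt H. 1 / (1 + (c * rho) * l)) \<partial>chan_measure Mr Mt)
    \<le> ennreal (C * rho powr (- (1 - d)))"
proof -
  define m where "m = min Mr Mt"
  define n where "n = m - 1"
  define e where "e = min d 1 / real m"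
  have e: "e > 0" "e \<le> 1" "real m * e \<le> d" using assms m1 by (auto simp: e_def m_def field_simps)
  \<comment> \<open>For the first moment each step can contribute any exponent below 1, since all
    the weights are at least 1.\<close>
  define q where "q = (\<lambda>l::nat. 1 - e)"
  have q: "0 \<le> q l \<and> q l \<le> (1::nat) \<and> q l < real Mr + real Mt - 1 - 2 * real l" if "l < min Mr Mt" for l
    using e dmt_weight_ge_1[OF that] by (auto simp: q_def)
  have half: "(1/2::real) > 0" by simp
  obtain C where C: "C \<ge> 0" and Cb: "\<And>rho. rho \<ge> 1 \<Longrightarrow>
      (\<integral>\<^sup>+H. ennreal ((1 / eigprod Mr Mt (c * rho) H) ^ 1) * gweight (1/2) ({..<Mr}\<times>{..<Mt}) H \<partial>leb ({..<Mr}\<times>{..<Mt}))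
      \<le> ennreal (C * rho powr (- (\<Sum>l<min Mr Mt. q l)))"
    using eigprod_weighted_moment[OF half assms(1), of Mr Mt q 1] q by blast
  \<comment> \<open>Here \<open>power_le_exp\<close> is applied to \<open>(1 + S) / 2\<close>, with
    \<open>S\<close> the squared Frobenius norm. This gives \<open>2 ^ n\<close>,
    \<open>fact n\<close> and \<open>exp (1/2)\<close>, and the growth \<open>exp (S / 2)\<close>
    leaves weight 1/2 out of weight 1.\<close>
  define K where "K = real m * ((1 + c) ^ n * (2 ^ n * fact n * exp (1/2)))"
  have K: "K \<ge> 0" using assms by (simp add: K_def)
  have "(\<integral>\<^sup>+H. ennreal (\<Sum>l\<in>#nz_eigs Mr Mt H. 1 / (1 + (c * rho) * l)) \<partial>chan_measure Mr Mt)
    \<le> ennreal (1 / pi ^ (Mr * Mt) * (K * C) * rho powr (- (1 - d)))" if rho: "rho \<ge> 1" for rho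
  proof -
    let ?S = "\<lambda>H. \<Sum>p\<in>{..<Mr}\<times>{..<Mt}. (cmod (H p))\<^sup>2"
    let ?f = "eigprod Mr Mt (c * rho)"
    let ?B = "\<lambda>H. ennreal (real m * ((1 + (c * rho) * ?S H) ^ n / ?f H))"
    have cr: "c * rho > 0" using assms rho by simp
    have fm: "?f \<in> borel_measurable (leb ({..<Mr} \<times> {..<Mt}))"
      using cr by (rule measurable_eigprod_chan)
    have Sm: "?S \<in> borel_measurable (leb ({..<Mr} \<times> {..<Mt}))"
      by (intro borel_measurable_sum borel_measurable_power measurable_compose[OF _ borel_measurable_norm] measurable_PiM_lborel_component)
    have Bm: "?B \<in> borel_measurable (leb ({..<Mr} \<times> {..<Mt}))"
      using fm Sm by measurable
    have "(\<integral>\<^sup>+H. ennreal (\<Sum>l\<in>#nz_eigs Mr Mt H. 1 / (1 + (c * rho) * l)) \<partial>chan_measure Mr Mt) \<le> (\<integral>\<^sup>+H. ?B H \<partial>chan_measure Mr Mt)"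
      unfolding m_def n_def using cr by (intro nn_integral_mono ennreal_leI inverse_eig_sum_le) auto
    also have "\<dots> = ennreal (1 / pi ^ (Mr * Mt)) * (\<integral>\<^sup>+H. ?B H * ennreal (exp (- (1 * ?S H))) \<partial>leb ({..<Mr}\<times>{..<Mt}))"
      by (rule nn_integral_chan_measure[OF Bm])
    also have "\<dots> \<le> ennreal (1 / pi ^ (Mr * Mt)) * (\<integral>\<^sup>+H. ennreal (K * rho ^ n) * (ennreal ((1 / ?f H) ^ 1) * ennreal (exp (- (1/2 * ?S H)))) \<partial>leb ({..<Mr}\<times>{..<Mt}))"
    proof (intro mult_left_mono nn_integral_mono)
      fix H
      have fp: "?f H > 0" using cr by (intro eigprod_pos) auto
      have S: "?S H \<ge> 0" by (simp add: sum_nonneg)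
      have "1 + (c * rho) * ?S H \<le> ((1 + c) * rho) * (1 + ?S H)"
      proof -
        have "1 \<le> rho" "0 \<le> c * rho" "0 \<le> rho * ?S H" using rho cr S by auto
        then show ?thesis by (simp add: algebra_simps)
      qed
      then have "(1 + (c * rho) * ?S H) ^ n \<le> (((1 + c) * rho) * (1 + ?S H)) ^ n"
        using cr S by (intro power_mono) auto
      also have "\<dots> = (1 + c) ^ n * rho ^ n * (2 ^ n * ((1 + ?S H) / 2) ^ n)"
        by (simp add: power_mult_distrib power_divide)
      also have "\<dots> \<le> (1 + c) ^ n * rho ^ n * (2 ^ n * (fact n * exp ((1 + ?S H) / 2)))"
        using S assms rho by (intro mult_left_mono power_le_exp) auto
      finally have 1: "(1 + (c * rho) * ?S H) ^ n \<le> (1 + c) ^ n * rho ^ n * (2 ^ n * (fact n * exp ((1 + ?S H) / 2)))" .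
      have "real m * ((1 + (c * rho) * ?S H) ^ n / ?f H) * exp (- (1 * ?S H)) \<le>
         real m * ((1 + c) ^ n * rho ^ n * (2 ^ n * (fact n * exp ((1 + ?S H) / 2))) / ?f H) * exp (- (1 * ?S H))"
        using 1 fp by (intro mult_right_mono mult_left_mono divide_right_mono) auto
      also have "\<dots> = real m * ((1 + c) ^ n * rho ^ n * (2 ^ n * fact n) / ?f H) * (exp ((1 + ?S H) / 2) * exp (- (1 * ?S H)))"
        by simp
      also have "exp ((1 + ?S H) / 2) * exp (- (1 * ?S H)) = exp (1/2) * exp (- (1/2 * ?S H))"
        by (simp add: exp_add[symmetric] field_simps)
      also have "real m * ((1 + c) ^ n * rho ^ n * (2 ^ n * fact n) / ?f H) * (exp (1/2) * exp (- (1/2 * ?S H)))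
         = (K * rho ^ n) * ((1 / ?f H) ^ 1 * exp (- (1/2 * ?S H)))"
        by (simp add: K_def)
      finally have "ennreal (real m * ((1 + (c * rho) * ?S H) ^ n / ?f H) * exp (- (1 * ?S H))) \<le> ennreal ((K * rho ^ n) * ((1 / ?f H) ^ 1 * exp (- (1/2 * ?S H))))"
        by (rule ennreal_leI)
      moreover have "ennreal (real m * ((1 + (c * rho) * ?S H) ^ n / ?f H) * exp (- (1 * ?S H))) = ?B H * ennreal (exp (- (1 * ?S H)))"
        by (rule ennreal_mult'') simp
      moreover have "ennreal ((K * rho ^ n) * ((1 / ?f H) ^ 1 * exp (- (1/2 * ?S H)))) = ennreal (K * rho ^ n) * ennreal ((1 / ?f H) ^ 1 * exp (- (1/2 * ?S H)))"
        by (rule ennreal_mult') (use K rho in simp)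
      moreover have "ennreal ((1 / ?f H) ^ 1 * exp (- (1/2 * ?S H))) = ennreal ((1 / ?f H) ^ 1) * ennreal (exp (- (1/2 * ?S H)))"
        by (rule ennreal_mult'') simp
      ultimately show "?B H * ennreal (exp (- (1 * ?S H))) \<le> ennreal (K * rho ^ n) * (ennreal ((1 / ?f H) ^ 1) * ennreal (exp (- (1/2 * ?S H))))"
        by (simp only:)
    qed simp
    also have "\<dots> = ennreal (1 / pi ^ (Mr * Mt)) * (ennreal (K * rho ^ n) * (\<integral>\<^sup>+H. (ennreal ((1 / ?f H) ^ 1) * ennreal (exp (- (1/2 * ?S H)))) \<partial>leb ({..<Mr}\<times>{..<Mt})))"
    proof -
      have "(\<lambda>H. ennreal ((1 / ?f H) ^ 1) * ennreal (exp (- (1/2 * ?S H)))) \<in> borel_measurable (leb ({..<Mr} \<times> {..<Mt}))"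
        by (intro borel_measurable_times_ennreal measurable_compose[OF _ measurable_ennreal] borel_measurable_power
            borel_measurable_divide borel_measurable_const fm measurable_matrix_weight) simp
      from nn_integral_cmult[OF this] show ?thesis by simp
    qed
    also have "\<dots> \<le> ennreal (1 / pi ^ (Mr * Mt)) * (ennreal (K * rho ^ n) * ennreal (C * rho powr (- (\<Sum>l<min Mr Mt. q l))))"
      using Cb[OF rho] by (intro mult_left_mono) auto
    also have "\<dots> \<le> ennreal (1 / pi ^ (Mr * Mt)) * (ennreal (K * rho ^ n) * ennreal (C * rho powr (- (real m - d))))"
    proof -
      have "(\<Sum>l<min Mr Mt. q l) = real m - real m * e" by (simp add: q_def m_def algebra_simps)
      then have "- (\<Sum>l<min Mr Mt. q l) \<le> - (real m - d)" using e by simp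
      then show ?thesis using rho C by (intro mult_left_mono ennreal_leI powr_mono) auto
    qed
    also have "\<dots> = ennreal (1 / pi ^ (Mr * Mt) * (K * C) * rho powr (- (1 - d)))"
    proof -
      have "rho ^ n * rho powr (- (real m - d)) = rho powr (real n + - (real m - d))"
        unfolding powr_add using rho by (simp add: powr_realpow)
      also have "real n + - (real m - d) = - (1 - d)" using m1 by (simp add: n_def m_def of_nat_diff)
      finally have "(K * rho ^ n) * (C * rho powr (- (real m - d))) = K * C * rho powr (- (1 - d))" by simp
      then have "ennreal (K * rho ^ n) * ennreal (C * rho powr (- (real m - d))) = ennreal (K * C * rho powr (- (1 - d)))"
        using K C rho by (subst ennreal_mult[symmetric]) auto
      then show ?thesis using K C by (simp add: mult.assoc flip: ennreal_mult')
    qed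
    finally show ?thesis .
  qed
  then show ?thesis using K C by (intro exI[of _ "1 / pi ^ (Mr * Mt) * (K * C)"]) auto
qed

section \<open>The exponential law of the side-information gain\<close>

lemma sets_gamma [measurable_cong, simp]: "sets gamma_measure = sets borel"
  by (simp add: gamma_measure_def)

lemma prob_space_gamma: "prob_space gamma_measure"
  unfolding gamma_measure_def by (rule prob_space_exponential_density) simp

lemma AE_gamma_nonneg: "AE g in gamma_measure. g \<ge> 0"
  unfolding gamma_measure_def by (subst AE_density) (auto simp: exponential_density_def)

text \<open>Since \<open>1 + y \<ge> y powr a\<close> for \<open>0 \<le> a\<close> and
  \<open>a \<le> 1\<close>, the integral is at most \<open>t powr (- a)\<close> times the moment of
  order \<open>- a\<close> of the exponential law, which is \<open>Gamma (1 - a)\<close>. That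
  moment is infinite at \<open>a = 1\<close>, so the exponent 1 is approached with an arbitrarily
  small loss.\<close>

lemma gamma_tail_side_information:
  assumes a: "0 \<le> a" "a < 1"
  shows "\<exists>C\<ge>0. \<forall>t>0. (\<integral>\<^sup>+g. ennreal (1 / (1 + t * g)) * indicator {0..} g \<partial>gamma_measure) \<le> ennreal (C * t powr (- a))"
proof -
  have int: "((\<lambda>g. g powr ((1 - a) - 1) / exp g) has_integral Gamma (1 - a)) {0..}"
    using a by (intro Gamma_integral_real) auto
  have "(\<integral>\<^sup>+g. ennreal (1 / (1 + t * g)) * indicator {0..} g \<partial>gamma_measure) \<le> ennreal (Gamma (1 - a) * t powr (- a))" if t: "t > 0" for t
  proof -
    have "(\<integral>\<^sup>+g. ennreal (1 / (1 + t * g)) * indicator {0..} g \<partial>gamma_measure)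
      = (\<integral>\<^sup>+g. ennreal (exponential_density 1 g) * (ennreal (1 / (1 + t * g)) * indicator {0..} g) \<partial>lborel)"
      unfolding gamma_measure_def by (subst nn_integral_density) auto
    also have "\<dots> \<le> (\<integral>\<^sup>+g. ennreal (t powr (- a)) * ennreal (indicator {0..} g * (g powr ((1 - a) - 1) / exp g)) \<partial>lborel)"
    proof (rule nn_integral_mono_AE)
      have "AE g in lborel. g \<noteq> (0::real)" by (rule AE_lborel_singleton)
      then show "AE g in lborel. ennreal (exponential_density 1 g) * (ennreal (1 / (1 + t * g)) * indicator {0..} g) \<le> ennreal (t powr (- a)) * ennreal (indicator {0..} g * (g powr ((1 - a) - 1) / exp g))"
      proof eventually_elim
        case (elim g)
        show ?case
        proof (cases "g > 0")
          case True
          have "(t * g) powr a \<le> (1 + t * g) powr a" using True t a by (intro powr_mono2) auto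
          also have "\<dots> \<le> (1 + t * g) powr 1" using True t a by (intro powr_mono) auto
          finally have "(t * g) powr a \<le> 1 + t * g" using True t by simp
          then have "1 / (1 + t * g) \<le> 1 / (t * g) powr a" using True t by (intro divide_left_mono mult_pos_pos) (auto simp: add_pos_pos)
          also have "\<dots> = t powr (- a) * g powr ((1 - a) - 1)"
            using True t by (simp add: powr_mult powr_minus field_simps)
          finally have "exp (- g) * (1 / (1 + t * g)) \<le> exp (- g) * (t powr (- a) * g powr ((1 - a) - 1))" by (intro mult_left_mono) auto
          also have "\<dots> = t powr (- a) * (g powr ((1 - a) - 1) / exp g)" by (simp add: exp_minus field_simps)
          finally have "ennreal (exp (- g) * (1 / (1 + t * g))) \<le> ennreal (t powr (- a) * (g powr ((1 - a) - 1) / exp g))" by (rule ennreal_leI)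
          moreover have "ennreal (exp (- g) * (1 / (1 + t * g))) = ennreal (exp (- g)) * ennreal (1 / (1 + t * g))"
            by (rule ennreal_mult') simp
          moreover have "ennreal (t powr (- a) * (g powr ((1 - a) - 1) / exp g)) = ennreal (t powr (- a)) * ennreal (g powr ((1 - a) - 1) / exp g)"
            by (rule ennreal_mult') simp
          moreover have "exponential_density 1 g = exp (- g)" "indicator {0..} g = (1::ennreal)" "indicator {0..} g = (1::real)"
            using True by (simp_all add: exponential_density_def)
          ultimately show ?thesis by (simp only: mult_1_right mult_1_left)
        next
          case False
          then show ?thesis using elim by (simp add: exponential_density_def)
        qed
      qed
    qed
    also have "\<dots> = ennreal (t powr (- a)) * (\<integral>\<^sup>+g. ennreal (indicator {0..} g * (g powr ((1 - a) - 1) / exp g)) \<partial>lborel)"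
      by (rule nn_integral_cmult) measurable
    also have "(\<integral>\<^sup>+g. ennreal (indicator {0..} g * (g powr ((1 - a) - 1) / exp g)) \<partial>lborel) = ennreal (Gamma (1 - a))"
      by (rule nn_integral_has_integral_lebesgue[OF _ int]) auto
    also have "ennreal (t powr (- a)) * \<dots> = ennreal (Gamma (1 - a) * t powr (- a))"
      using a by (subst ennreal_mult[symmetric]) (auto simp: mult.commute intro!: less_imp_le[OF Gamma_real_pos])
    finally show ?thesis .
  qed
  moreover have "Gamma (1 - a) \<ge> 0" using a by (intro less_imp_le[OF Gamma_real_pos]) auto
  ultimately show ?thesis by blast
qed

lemma gamma_small_ge:
  assumes "0 \<le> t" "t \<le> 1"
  shows "ennreal (t * exp (- 1)) \<le> emeasure gamma_measure {0..t}"
proof -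
  have "ennreal (t * exp (- 1)) = (\<integral>\<^sup>+g. ennreal (exp (- 1)) * indicator {0..t} g \<partial>lborel)"
    using assms by (simp add: nn_integral_cmult_indicator ennreal_mult mult.commute)
  also have "\<dots> \<le> (\<integral>\<^sup>+g. ennreal (exponential_density 1 g) * indicator {0..t} g \<partial>lborel)"
    using assms by (intro nn_integral_mono) (auto simp: indicator_def exponential_density_def)
  also have "\<dots> = emeasure gamma_measure {0..t}"
    unfolding gamma_measure_def by (rule emeasure_density[symmetric]) auto
  finally show ?thesis .
qed

section \<open>Joint measurability of eigenvalue functions\<close>

lemma measurable_eigprod_joint:
  assumes b: "b \<in> borel_measurable N" "\<And>x. x \<in> space N \<Longrightarrow> b x > 0"
    and h: "h \<in> N \<rightarrow>\<^sub>M leb ({..<Mr} \<times> {..<Mt})"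
  shows "(\<lambda>x. eigprod Mr Mt (b x) (h x)) \<in> borel_measurable N"
proof -
  have c: "(\<lambda>x. h x (i, j)) \<in> borel_measurable N" if "i < Mr" "j < Mt" for i j
    by (rule measurable_compose[OF h measurable_PiM_lborel_component]) (use that in auto)
  \<comment> \<open>No enumeration of the unordered eigenvalues is chosen: their product is a
    function of a Gaussian integral in the matrix entries, and that integral is measurable.\<close>
  have "(\<lambda>x. gint {..<Mr} {..<Mt} 1 (b x) (h x)) \<in> borel_measurable N"
    using b c by (intro measurable_gint) auto
  then have "(\<lambda>x. pi ^ Mr / enn2real (gint {..<Mr} {..<Mt} 1 (b x) (h x))) \<in> borel_measurable N"
    by (intro borel_measurable_divide borel_measurable_const borel_measurable_enn2real)
  then show ?thesis
    by (rule measurable_cong[THEN iffD1, rotated]) (simp add: eigprod_gint b(2))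
qed

lemma prod_nz_eigs_scale:
  assumes "x > 0"
  shows "(\<Prod>l\<in>#nz_eigs Mr Mt H. x + y * l) = x ^ min Mr Mt * eigprod Mr Mt (y / x) H"
proof -
  have "(\<Prod>l\<in>#A. x + y * l) = x ^ size A * (\<Prod>l\<in>#A. 1 + y / x * l)" for A
    using assms by (induction A) (auto simp: field_simps)
  then show ?thesis unfolding eigprod_def size_nz_eigs[of Mr Mt H, symmetric] .
qed

text \<open>The derivative of \<open>ln\<close> of the product of \<open>x + y * l\<close> with
  respect to \<open>x\<close> is the sum of reciprocals. Taken along \<open>1 / Suc n\<close>, its
  difference quotients present the sum as a pointwise limit of functions of products, which
  transfers measurability.\<close>

lemma sum_inverse_eq_log_derivative:
  fixes A :: "real multiset"
  assumes "x > 0" "y > 0" "\<And>l. l \<in># A \<Longrightarrow> l \<ge> 0"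
  shows "(\<lambda>n. real (Suc n) * (ln (\<Prod>l\<in>#A. (x + 1 / real (Suc n)) + y * l) - ln (\<Prod>l\<in>#A. x + y * l)))
    \<longlonglongrightarrow> (\<Sum>l\<in>#A. 1 / (x + y * l))"
  using assms(3)
proof (induction A)
  case empty
  then show ?case by simp
next
  case (add a A)
  have pos: "(\<Prod>l\<in>#A. z + y * l) > 0" if "z > 0" for z
  proof -
    have "(\<Prod>l\<in>#B. z + y * l) > 0" if "\<And>l. l \<in># B \<Longrightarrow> l \<ge> 0" for B
      using that by (induction B) (auto intro!: mult_pos_pos add_pos_nonneg simp: \<open>z > 0\<close> assms less_imp_le[OF assms(2)])
    then show ?thesis using add.prems by auto
  qed
  define w where "w = x + y * a"
  have w: "w > 0" using add.prems[of a] assms by (simp add: w_def add_pos_nonneg)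
  have "((\<lambda>t. ln (w + t)) has_real_derivative 1 / w) (at 0)"
    using w by (auto intro!: derivative_eq_intros)
  then have "((\<lambda>h. (ln (w + (0 + h)) - ln (w + 0)) / h) \<longlongrightarrow> 1 / w) (at 0)"
    by (simp add: DERIV_def)
  then have "((\<lambda>h. (ln (w + h) - ln w) / h) \<longlongrightarrow> 1 / w) (at 0)" by simp
  moreover have "filterlim (\<lambda>n. 1 / real (Suc n)) (at 0) sequentially"
    unfolding filterlim_at using LIMSEQ_inverse_real_of_nat by (auto simp: inverse_eq_divide)
  ultimately have "(\<lambda>n. (ln (w + 1 / real (Suc n)) - ln w) / (1 / real (Suc n))) \<longlonglongrightarrow> 1 / w"
    by (rule filterlim_compose)
  then have 1: "(\<lambda>n. real (Suc n) * (ln (w + 1 / real (Suc n)) - ln w)) \<longlonglongrightarrow> 1 / w"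
    by (simp add: mult.commute)
  have eq: "real (Suc n) * (ln (\<Prod>l\<in>#add_mset a A. (x + 1 / real (Suc n)) + y * l) - ln (\<Prod>l\<in>#add_mset a A. x + y * l))
    = real (Suc n) * (ln (w + 1 / real (Suc n)) - ln w) + real (Suc n) * (ln (\<Prod>l\<in>#A. (x + 1 / real (Suc n)) + y * l) - ln (\<Prod>l\<in>#A. x + y * l))" for n
  proof -
    have x': "x + 1 / real (Suc n) > 0" using assms by (simp add: add_pos_pos)
    have ln_split: "ln (\<Prod>l\<in>#add_mset a A. z + y * l) = ln (z + y * a) + ln (\<Prod>l\<in>#A. z + y * l)" if z: "z > 0" for z
    proof -
      have "z + y * a > 0" using z assms(2) add.prems[of a] by (simp add: add_pos_nonneg)
      then show ?thesis unfolding image_mset_add_mset prod_mset.add_mset by (rule ln_mult_pos) (rule pos[OF z])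
    qed
    have "x + 1 / real (Suc n) + y * a = w + 1 / real (Suc n)" by (simp add: w_def)
    then have "ln (\<Prod>l\<in>#add_mset a A. (x + 1 / real (Suc n)) + y * l) = ln (w + 1 / real (Suc n)) + ln (\<Prod>l\<in>#A. (x + 1 / real (Suc n)) + y * l)"
      using ln_split[OF x'] by (simp only:)
    moreover have "ln (\<Prod>l\<in>#add_mset a A. x + y * l) = ln w + ln (\<Prod>l\<in>#A. x + y * l)"
      unfolding w_def by (rule ln_split[OF assms(1)])
    ultimately show ?thesis by (simp only: right_diff_distrib distrib_left)
  qed
  have "(\<lambda>n. real (Suc n) * (ln (w + 1 / real (Suc n)) - ln w) + real (Suc n) * (ln (\<Prod>l\<in>#A. (x + 1 / real (Suc n)) + y * l) - ln (\<Prod>l\<in>#A. x + y * l)))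
    \<longlonglongrightarrow> 1 / w + (\<Sum>l\<in>#A. 1 / (x + y * l))"
    using add by (intro tendsto_add 1 add.IH) auto
  then show ?case unfolding eq by (simp add: w_def)
qed

lemma measurable_sum_inverse_eigs:
  assumes x: "x \<in> borel_measurable N" "\<And>w. w \<in> space N \<Longrightarrow> x w > 0" and y: "y > 0"
    and h: "h \<in> N \<rightarrow>\<^sub>M leb ({..<Mr} \<times> {..<Mt})"
  shows "(\<lambda>w. \<Sum>l\<in>#nz_eigs Mr Mt (h w). 1 / (x w + y * l)) \<in> borel_measurable N"
proof (rule borel_measurable_LIMSEQ_real)
  fix w assume w: "w \<in> space N"
  show "(\<lambda>n. real (Suc n) * (ln (\<Prod>l\<in>#nz_eigs Mr Mt (h w). (x w + 1 / real (Suc n)) + y * l) - ln (\<Prod>l\<in>#nz_eigs Mr Mt (h w). x w + y * l)))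
    \<longlonglongrightarrow> (\<Sum>l\<in>#nz_eigs Mr Mt (h w). 1 / (x w + y * l))"
    using x(2)[OF w] y by (intro sum_inverse_eq_log_derivative nz_eigs_nonneg)
next
  have p: "(\<lambda>w. \<Prod>l\<in>#nz_eigs Mr Mt (h w). z w + y * l) \<in> borel_measurable N"
    if z: "z \<in> borel_measurable N" "\<And>w. w \<in> space N \<Longrightarrow> z w > 0" for z
  proof -
    have "(\<lambda>w. z w ^ min Mr Mt * eigprod Mr Mt (y / z w) (h w)) \<in> borel_measurable N"
      using z y by (intro borel_measurable_times borel_measurable_power measurable_eigprod_joint h) auto
    then show ?thesis
      by (rule measurable_cong[THEN iffD1, rotated]) (simp add: prod_nz_eigs_scale z(2))
  qed
  fix n
  show "(\<lambda>w. real (Suc n) * (ln (\<Prod>l\<in>#nz_eigs Mr Mt (h w). (x w + 1 / real (Suc n)) + y * l) - ln (\<Prod>l\<in>#nz_eigs Mr Mt (h w). x w + y * l))) \<in> borel_measurable N"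
    using x by (intro borel_measurable_times borel_measurable_diff borel_measurable_ln p borel_measurable_add borel_measurable_const)
      (auto intro!: add_pos_pos)
qed

section \<open>Distortion of the hybrid scheme\<close>

lemma prod_powr_mset:
  fixes A :: "real multiset" and f :: "real \<Rightarrow> real"
  assumes "\<And>l. l \<in># A \<Longrightarrow> f l \<ge> 0"
  shows "(\<Prod>l\<in>#A. f l powr e) = (\<Prod>l\<in>#A. f l) powr e"
proof -
  have "(\<Prod>l\<in>#A. f l powr e) = (\<Prod>l\<in>#A. f l) powr e \<and> (\<Prod>l\<in>#A. f l) \<ge> 0"
    using assms
  proof (induction A)
    case (add x A)
    have "f x \<ge> 0" "(\<Prod>l\<in>#A. f l) \<ge> 0" "(\<Prod>l\<in>#A. f l powr e) = (\<Prod>l\<in>#A. f l) powr e" using add by simp_all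
    moreover from this have "(f x * (\<Prod>l\<in>#A. f l)) powr e = f x powr e * (\<Prod>l\<in>#A. f l) powr e"
      by (simp only: powr_mult)
    ultimately show ?case by simp
  qed simp
  then show ?thesis ..
qed

lemma prod_shift_bounds:
  fixes A :: "real multiset"
  assumes l: "\<forall>l\<in>#A. l \<ge> 0" and "beta \<ge> 0" "u \<ge> 1" "s \<ge> 0"
  shows "(\<Prod>l\<in>#A. 1 + beta * l + u * s) \<le> (u * (1 + s)) ^ size A * (\<Prod>l\<in>#A. 1 + beta * l)"
    and "(\<Prod>l\<in>#A. 1 + beta * l) \<le> (\<Prod>l\<in>#A. 1 + beta * l + u * s)"
    and "(\<Prod>l\<in>#A. 1 + beta * l) \<ge> 1"
proof -
  have "(\<Prod>l\<in>#A. 1 + beta * l + u * s) \<le> (u * (1 + s)) ^ size A * (\<Prod>l\<in>#A. 1 + beta * l) \<and>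
     (\<Prod>l\<in>#A. 1 + beta * l) \<le> (\<Prod>l\<in>#A. 1 + beta * l + u * s) \<and> (\<Prod>l\<in>#A. 1 + beta * l) \<ge> 1"
    using l
  proof (induction A)
    case (add a A)
    have a: "a \<ge> 0" "beta * a \<ge> 0" using add.prems assms by auto
    have us: "u * s \<ge> 0" "u * (1 + s) \<ge> 0" using assms by auto
    have IH: "(\<Prod>l\<in>#A. 1 + beta * l + u * s) \<le> (u * (1 + s)) ^ size A * (\<Prod>l\<in>#A. 1 + beta * l)"
      "(\<Prod>l\<in>#A. 1 + beta * l) \<le> (\<Prod>l\<in>#A. 1 + beta * l + u * s)" "(\<Prod>l\<in>#A. 1 + beta * l) \<ge> 1"
      using add by auto
    have "1 + beta * a \<le> u * (1 + beta * a)" "u * s \<le> u * s * (1 + beta * a)"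
      using a us assms mult_right_mono[of 1 u "1 + beta * a"] mult_left_mono[of 1 "1 + beta * a" "u * s"] by auto
    then have 1: "1 + beta * a + u * s \<le> (u * (1 + s)) * (1 + beta * a)" by (simp add: algebra_simps)
    have "(1 + beta * a + u * s) * (\<Prod>l\<in>#A. 1 + beta * l + u * s) \<le>
       ((u * (1 + s)) * (1 + beta * a)) * ((u * (1 + s)) ^ size A * (\<Prod>l\<in>#A. 1 + beta * l))"
      using 1 IH a us by (intro mult_mono) auto
    moreover have "(1 + beta * a) * (\<Prod>l\<in>#A. 1 + beta * l) \<le> (1 + beta * a + u * s) * (\<Prod>l\<in>#A. 1 + beta * l + u * s)"
      using IH a us by (intro mult_mono) auto
    moreover have "1 * 1 \<le> (1 + beta * a) * (\<Prod>l\<in>#A. 1 + beta * l)"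
      using IH a by (intro mult_mono) auto
    ultimately show ?case by (simp add: mult_ac)
  qed simp
  then show "(\<Prod>l\<in>#A. 1 + beta * l + u * s) \<le> (u * (1 + s)) ^ size A * (\<Prod>l\<in>#A. 1 + beta * l)"
    "(\<Prod>l\<in>#A. 1 + beta * l) \<le> (\<Prod>l\<in>#A. 1 + beta * l + u * s)"
    "(\<Prod>l\<in>#A. 1 + beta * l) \<ge> 1" by auto
qed

text \<open>The bound \<open>1 + beta * l + u * s \<le> u * (1 + s) * (1 + beta * l)\<close> removes the side information
  from the outage condition.\<close>
lemma hda_outage_imp:
  assumes M: "min Mt Mr \<ge> 1" and pos: "rho \<ge> 0" "rs \<ge> 0" "g \<ge> 0" "s2 > 0"
    and out: "hda_outage Mt Mr b rho rs s2 (nz_eigs Mr Mt H) g"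
  shows "eigprod Mr Mt (rho / real (min Mt Mr)) H powr (b * real (min Mt Mr) - 1) \<le> (1 + 1 / s2) ^ min Mt Mr"
proof -
  define m where "m = min Mt Mr"
  define beta where "beta = rho / real m"
  define u where "u = 1 + rs * g"
  let ?A = "nz_eigs Mr Mt H"
  define f where "f = (\<Prod>l\<in>#?A. 1 + beta * l)"
  define F where "F = (\<Prod>l\<in>#?A. 1 + beta * l + u * s2)"
  have bu: "beta \<ge> 0" "u \<ge> 1" using pos by (auto simp: beta_def u_def)
  have sz: "size ?A = m" using size_nz_eigs[of Mr Mt H] by (simp add: m_def min.commute)
  have A0: "\<forall>l\<in>#?A. l \<ge> 0" using nz_eigs_nonneg by blast
  note sb = prod_shift_bounds[OF A0 bu less_imp_le[OF pos(4)], folded f_def F_def, unfolded sz]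
  have f1: "f \<ge> 1" by (rule sb(3))
  have F1: "F > 0" using sb(2) f1 by simp
  have w: "(u * (1 + s2)) ^ m > 0" using bu pos by (intro zero_less_power mult_pos_pos) auto
  have "(\<Prod>l\<in>#?A. (1 + beta * l) powr (b * real m)) = f powr (b * real m)"
    unfolding f_def using nz_eigs_nonneg bu(1) by (intro prod_powr_mset) auto
  then have "(u * (1 + s2)) ^ m * f powr (b * real m) / F \<le> (1 + 1 / s2) ^ m"
    using out unfolding hda_outage_def Let_def m_def[symmetric] beta_def[symmetric] u_def[symmetric] F_def by simp
  then have "(u * (1 + s2)) ^ m * f powr (b * real m) \<le> (1 + 1 / s2) ^ m * F"
    using F1 by (simp add: field_simps)
  also have "\<dots> \<le> (1 + 1 / s2) ^ m * ((u * (1 + s2)) ^ m * f)"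
    using sb(1) pos by (intro mult_left_mono) auto
  finally have "(u * (1 + s2)) ^ m * f powr (b * real m) \<le> (u * (1 + s2)) ^ m * ((1 + 1 / s2) ^ m * f)" by (simp add: mult_ac)
  then have "f powr (b * real m) \<le> (1 + 1 / s2) ^ m * f"
    using w mult_le_cancel_left_pos by blast
  moreover have "f powr (b * real m) = f powr (b * real m - 1) * f"
    using f1 by (simp add: powr_diff)
  ultimately have "f powr (b * real m - 1) \<le> (1 + 1 / s2) ^ m"
    using f1 by (simp add: mult_le_cancel_right)
  then show ?thesis by (simp add: eigprod_def f_def m_def beta_def)
qed

text \<open>A converse of \<open>hda_outage_imp\<close> up to a constant, for weak side information.
  Dropping \<open>u * s2\<close> from the denominator only enlarges the quotient, and
  \<open>u \<le> 2\<close>, \<open>s2 \<le> 1\<close> bound the remaining factor by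
  \<open>4 ^ m\<close>.\<close>

lemma hda_outage_if:
  assumes pos: "rho \<ge> 0" "rs \<ge> 0" "g \<ge> 0" "s2 > 0" "1 + rs * g \<le> 2" "s2 \<le> 1"
    and le: "4 ^ min Mt Mr * eigprod Mr Mt (rho / real (min Mt Mr)) H powr (b * real (min Mt Mr) - 1) \<le> (1 + 1 / s2) ^ min Mt Mr"
  shows "hda_outage Mt Mr b rho rs s2 (nz_eigs Mr Mt H) g"
proof -
  define m where "m = min Mt Mr"
  define beta where "beta = rho / real m"
  define u where "u = 1 + rs * g"
  let ?A = "nz_eigs Mr Mt H"
  define f where "f = (\<Prod>l\<in>#?A. 1 + beta * l)"
  define F where "F = (\<Prod>l\<in>#?A. 1 + beta * l + u * s2)"
  have bu: "beta \<ge> 0" "u \<ge> 1" using pos by (auto simp: beta_def u_def)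
  have sz: "size ?A = m" using size_nz_eigs[of Mr Mt H] by (simp add: m_def min.commute)
  have A0: "\<forall>l\<in>#?A. l \<ge> 0" using nz_eigs_nonneg by blast
  note sb = prod_shift_bounds[OF A0 bu less_imp_le[OF pos(4)], folded f_def F_def, unfolded sz]
  have f1: "f \<ge> 1" by (rule sb(3))
  have F1: "F > 0" using sb(2) f1 by simp
  have "u * (1 + s2) \<le> 2 * 2" using pos bu by (intro mult_mono) (auto simp: u_def)
  then have w: "(u * (1 + s2)) ^ m \<le> 4 ^ m" using bu pos by (intro power_mono) auto
  have fe: "(\<Prod>l\<in>#?A. (1 + beta * l) powr (b * real m)) = f powr (b * real m)"
    unfolding f_def using nz_eigs_nonneg bu(1) by (intro prod_powr_mset) auto
  have "(u * (1 + s2)) ^ m * f powr (b * real m) / F \<le> 4 ^ m * f powr (b * real m) / f"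
    using w sb(2) f1 F1 bu pos by (intro frac_le mult_right_mono) auto
  also have "\<dots> = 4 ^ m * f powr (b * real m - 1)" using f1 by (simp add: powr_diff)
  also have "\<dots> \<le> (1 + 1 / s2) ^ m"
    using le by (simp add: eigprod_def f_def m_def beta_def)
  finally show ?thesis
    unfolding hda_outage_def Let_def m_def[symmetric] beta_def[symmetric] u_def[symmetric] F_def fe by simp
qed

lemma sum_mset_bounds:
  fixes h :: "real \<Rightarrow> real"
  assumes "\<forall>l\<in>#A. c \<le> h l \<and> h l \<le> d"
  shows "real (size A) * c \<le> (\<Sum>l\<in>#A. h l)" "(\<Sum>l\<in>#A. h l) \<le> real (size A) * d"
  using assms by (induction A) (auto simp: algebra_simps intro: add_mono)

lemma sum_mset_le_scaled:
  fixes p q :: "real \<Rightarrow> real"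
  assumes "\<forall>l\<in>#A. 0 \<le> p l \<and> p l \<le> c * q l"
  shows "(\<Sum>l\<in>#A. p l) \<le> c * (\<Sum>l\<in>#A. q l)" "0 \<le> (\<Sum>l\<in>#A. p l)"
  using assms by (induction A) (auto simp: distrib_left intro: add_mono)

context
  fixes Mt Mr :: nat and b rho rs s2 :: real
  assumes M: "min Mt Mr \<ge> 1" and rho: "rho > 0" and rs: "rs > 0" and s2: "s2 > 0"
begin

definition hda_avg :: "(nat \<times> nat \<Rightarrow> complex) \<Rightarrow> real \<Rightarrow> real" where
  "hda_avg H g = (1 / real (min Mt Mr)) * (\<Sum>l\<in>#nz_eigs Mr Mt H. 1 / (1 + rs * g + (1 / s2) * (1 + rho / real (min Mt Mr) * l)))"

lemma hda_D_eq:
  "hda_D Mt Mr b rho rs s2 (nz_eigs Mr Mt H) g = (if hda_outage Mt Mr b rho rs s2 (nz_eigs Mr Mt H) g then 1 / (1 + rs * g) else hda_avg H g)"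
  unfolding hda_D_def hda_avg_def Let_def ..

lemma hda_avg_le:
  assumes "g \<ge> 0"
  shows "hda_avg H g \<le> 1 / (1 + rs * g)" "hda_avg H g \<ge> 0"
proof -
  have sz: "size (nz_eigs Mr Mt H) = min Mt Mr" using size_nz_eigs[of Mr Mt H] by (simp add: min.commute)
  have u: "1 + rs * g > 0" using assms rs by (simp add: add_pos_nonneg)
  have b': "0 \<le> 1 / (1 + rs * g + (1 / s2) * (1 + rho / real (min Mt Mr) * l)) \<and>
      1 / (1 + rs * g + (1 / s2) * (1 + rho / real (min Mt Mr) * l)) \<le> 1 / (1 + rs * g)" if "l \<in># nz_eigs Mr Mt H" for l
  proof -
    have v: "(1 / s2) * (1 + rho / real (min Mt Mr) * l) \<ge> 0" using nz_eigs_nonneg[OF that] s2 rho by auto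
    then have "1 / (1 + rs * g + (1 / s2) * (1 + rho / real (min Mt Mr) * l)) \<le> 1 / (1 + rs * g)"
      using u by (intro divide_left_mono mult_pos_pos) auto
    then show ?thesis using v u by auto
  qed
  have b: "\<forall>l\<in>#nz_eigs Mr Mt H. 0 \<le> 1 / (1 + rs * g + (1 / s2) * (1 + rho / real (min Mt Mr) * l)) \<and>
      1 / (1 + rs * g + (1 / s2) * (1 + rho / real (min Mt Mr) * l)) \<le> 1 / (1 + rs * g)"
    using b' by blast
  note sb = sum_mset_bounds[OF b, unfolded sz]
  have "hda_avg H g \<le> (1 / real (min Mt Mr)) * (real (min Mt Mr) * (1 / (1 + rs * g)))"
    unfolding hda_avg_def by (intro mult_left_mono sb(2)) auto
  also have "\<dots> = 1 / (1 + rs * g)"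
  proof -
    have "1 / real k * (real k * c) = c" if "k \<ge> 1" for k and c :: real using that by simp
    then show ?thesis using M by blast
  qed
  finally show "hda_avg H g \<le> 1 / (1 + rs * g)" .
  show "hda_avg H g \<ge> 0" unfolding hda_avg_def using sb(1) by (intro mult_nonneg_nonneg) auto
qed

lemma hda_D_bounds:
  assumes "g \<ge> 0"
  shows "hda_D Mt Mr b rho rs s2 (nz_eigs Mr Mt H) g \<le> 1 / (1 + rs * g)"
    "hda_avg H g \<le> hda_D Mt Mr b rho rs s2 (nz_eigs Mr Mt H) g"
    "0 \<le> hda_D Mt Mr b rho rs s2 (nz_eigs Mr Mt H) g"
    "hda_D Mt Mr b rho rs s2 (nz_eigs Mr Mt H) g \<le> 1"
proof -
  have u: "1 + rs * g \<ge> 1" using assms rs by simp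
  show 1: "hda_D Mt Mr b rho rs s2 (nz_eigs Mr Mt H) g \<le> 1 / (1 + rs * g)"
    unfolding hda_D_eq using hda_avg_le[OF assms, of H] by simp
  show "hda_avg H g \<le> hda_D Mt Mr b rho rs s2 (nz_eigs Mr Mt H) g"
    unfolding hda_D_eq using hda_avg_le[OF assms, of H] by simp
  show "0 \<le> hda_D Mt Mr b rho rs s2 (nz_eigs Mr Mt H) g"
    unfolding hda_D_eq using hda_avg_le[OF assms, of H] u by simp
  have "1 / (1 + rs * g) \<le> 1" using u by simp
  then show "hda_D Mt Mr b rho rs s2 (nz_eigs Mr Mt H) g \<le> 1" using 1 by linarith
qed

text \<open>This yields the term \<open>r + 1\<close> of the exponent: \<open>s2\<close> has order
  \<open>rho powr (- r)\<close>, and the expectation of the sum has almost order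
  \<open>rho powr (- 1)\<close> by \<open>expected_inverse_eigs\<close>.\<close>

lemma hda_avg_le_inverse_eigs:
  assumes "g \<ge> 0"
  shows "hda_avg H g \<le> s2 * (\<Sum>l\<in>#nz_eigs Mr Mt H. 1 / (1 + rho / real (min Mt Mr) * l))"
proof -
  let ?p = "\<lambda>l. 1 / (1 + rs * g + (1 / s2) * (1 + rho / real (min Mt Mr) * l))"
  let ?q = "\<lambda>l. 1 / (1 + rho / real (min Mt Mr) * l)"
  have "\<forall>l\<in>#nz_eigs Mr Mt H. 0 \<le> ?p l \<and> ?p l \<le> s2 * ?q l"
  proof
    fix l assume l: "l \<in># nz_eigs Mr Mt H"
    define v where "v = 1 + rho / real (min Mt Mr) * l"
    have v: "v > 0" using nz_eigs_nonneg[OF l] rho by (simp add: v_def add_pos_nonneg)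
    have q: "(1 / s2) * v > 0" using v s2 by simp
    have w: "1 + rs * g \<ge> 0" using assms rs by simp
    have "1 / (1 + rs * g + (1 / s2) * v) \<le> 1 / ((1 / s2) * v)"
      by (rule divide_left_mono) (use q w in \<open>simp_all only: mult_pos_pos add_nonneg_pos le_add_same_cancel2 zero_le_one\<close>)
    also have "1 / ((1 / s2) * v) = s2 * (1 / v)" by simp
    finally have "1 / (1 + rs * g + (1 / s2) * v) \<le> s2 * (1 / v)" .
    moreover have "0 \<le> 1 / (1 + rs * g + (1 / s2) * v)" using q w by (intro divide_nonneg_nonneg) linarith+
    ultimately show "0 \<le> ?p l \<and> ?p l \<le> s2 * ?q l" unfolding v_def by blast
  qed
  note 1 = sum_mset_le_scaled[OF this]
  have "1 / real (min Mt Mr) \<le> 1" using M by simp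
  then have "hda_avg H g \<le> 1 * (\<Sum>l\<in>#nz_eigs Mr Mt H. 1 / (1 + rs * g + (1 / s2) * (1 + rho / real (min Mt Mr) * l)))"
    unfolding hda_avg_def using 1(2) by (intro mult_right_mono)
  then show ?thesis using 1(1) by simp
qed

text \<open>Clipping \<open>g\<close> at \<open>0\<close> keeps all eigenvalue sums in the range where they are logarithmic
  derivatives of determinants; the exponential law does not see the difference.\<close>
lemma measurable_hda_D_joint:
  "(\<lambda>w. hda_D Mt Mr b rho rs s2 (nz_eigs Mr Mt (fst w)) (max (snd w) 0)) \<in> borel_measurable (chan_measure Mr Mt \<Otimes>\<^sub>M gamma_measure)"
proof -
  let ?N = "chan_measure Mr Mt \<Otimes>\<^sub>M gamma_measure"
  let ?m = "min Mt Mr" and ?beta = "rho / real (min Mt Mr)"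
  have beta: "?beta > 0" using M rho by simp
  have h: "fst \<in> ?N \<rightarrow>\<^sub>M leb ({..<Mr} \<times> {..<Mt})"
    using measurable_fst[of "chan_measure Mr Mt" gamma_measure] sets_chan_measure[of Mr Mt]
    by (simp cong: measurable_cong_sets)
  have g: "(\<lambda>w. max (snd w) 0) \<in> borel_measurable ?N" by measurable
  have u: "(\<lambda>w. 1 + rs * max (snd w) 0) \<in> borel_measurable ?N" using g by measurable
  have up: "1 + rs * max (snd w) 0 > 0" for w :: "(nat \<times> nat \<Rightarrow> complex) \<times> real"
    using rs by (intro add_pos_nonneg) auto
  have avg: "(\<lambda>w. hda_avg (fst w) (max (snd w) 0)) \<in> borel_measurable ?N"
  proof -
    have "(\<lambda>w. \<Sum>l\<in>#nz_eigs Mr Mt (fst w). 1 / ((1 + rs * max (snd w) 0 + 1 / s2) + (?beta / s2) * l)) \<in> borel_measurable ?N"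
      using u by (intro measurable_sum_inverse_eigs h borel_measurable_add borel_measurable_const add_pos_pos up divide_pos_pos[OF beta s2])
        (use s2 in auto)
    then have "(\<lambda>w. 1 / real ?m * (\<Sum>l\<in>#nz_eigs Mr Mt (fst w). 1 / ((1 + rs * max (snd w) 0 + 1 / s2) + (?beta / s2) * l))) \<in> borel_measurable ?N"
      by (intro borel_measurable_times borel_measurable_const)
    moreover have "hda_avg H g = 1 / real ?m * (\<Sum>l\<in>#nz_eigs Mr Mt H. 1 / ((1 + rs * g + 1 / s2) + (?beta / s2) * l))" for H g
      unfolding hda_avg_def by (simp add: algebra_simps)
    ultimately show ?thesis by simp
  qed
  have f: "(\<lambda>w. eigprod Mr Mt ?beta (fst w)) \<in> borel_measurable ?N"
    using beta by (intro measurable_eigprod_joint h) auto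
  have F: "(\<lambda>w. \<Prod>l\<in>#nz_eigs Mr Mt (fst w). 1 + ?beta * l + (1 + rs * max (snd w) 0) * s2) \<in> borel_measurable ?N"
  proof -
    let ?x = "\<lambda>w. 1 + (1 + rs * max (snd w) 0) * s2"
    have xp: "?x w > 0" for w :: "(nat \<times> nat \<Rightarrow> complex) \<times> real" using up[of w] s2 by (simp add: add_pos_pos)
    have "(\<lambda>w. ?x w ^ min Mr Mt * eigprod Mr Mt (?beta / ?x w) (fst w)) \<in> borel_measurable ?N"
      using u beta xp by (intro borel_measurable_times borel_measurable_power measurable_eigprod_joint h borel_measurable_divide
         borel_measurable_add borel_measurable_const divide_pos_pos[OF beta xp]) auto
    moreover have "(\<Prod>l\<in>#nz_eigs Mr Mt (fst w). 1 + ?beta * l + (1 + rs * max (snd w) 0) * s2) = ?x w ^ min Mr Mt * eigprod Mr Mt (?beta / ?x w) (fst w)"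
      for w :: "(nat \<times> nat \<Rightarrow> complex) \<times> real"
    proof -
      have "(\<Prod>l\<in>#nz_eigs Mr Mt (fst w). 1 + ?beta * l + (1 + rs * max (snd w) 0) * s2) = (\<Prod>l\<in>#nz_eigs Mr Mt (fst w). ?x w + ?beta * l)"
        by (simp add: add_ac)
      then show ?thesis unfolding prod_nz_eigs_scale[OF xp] .
    qed
    ultimately show ?thesis by simp
  qed
  have out: "Measurable.pred ?N (\<lambda>w. hda_outage Mt Mr b rho rs s2 (nz_eigs Mr Mt (fst w)) (max (snd w) 0))"
  proof -
    have "(\<Prod>l\<in>#nz_eigs Mr Mt H. (1 + ?beta * l) powr (b * real ?m)) = eigprod Mr Mt ?beta H powr (b * real ?m)" for H
      unfolding eigprod_def
    proof (rule prod_powr_mset)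
      fix l assume "l \<in># nz_eigs Mr Mt H"
      then have "0 \<le> ?beta * l" using beta nz_eigs_nonneg[of l Mr Mt H] by (intro mult_nonneg_nonneg) auto
      then show "0 \<le> 1 + ?beta * l" by linarith
    qed
    then have "hda_outage Mt Mr b rho rs s2 (nz_eigs Mr Mt (fst w)) (max (snd w) 0) \<longleftrightarrow>
      ((1 + rs * max (snd w) 0) * (1 + s2)) ^ ?m * eigprod Mr Mt ?beta (fst w) powr (b * real ?m) /
      (\<Prod>l\<in>#nz_eigs Mr Mt (fst w). 1 + ?beta * l + (1 + rs * max (snd w) 0) * s2) \<le> (1 + 1 / s2) ^ ?m"
      for w :: "(nat \<times> nat \<Rightarrow> complex) \<times> real"
      unfolding hda_outage_def Let_def by simp
    then show ?thesis
      using f F u by (simp only: pred_def) (intro borel_measurable_le borel_measurable_divide borel_measurable_times borel_measurable_power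
         powr_real_measurable borel_measurable_const)
  qed
  show ?thesis unfolding hda_D_eq
    using out avg u by (intro measurable_If borel_measurable_divide borel_measurable_const) (auto simp: pred_def)
qed

text \<open>With the eigenvalues fixed, measurability in \<open>g\<close> holds without clipping.
  This is what lets the inner integral of \<open>hda_ED\<close> be replaced by its clipped version,
  which agrees with it almost everywhere.\<close>

lemma measurable_hda_D_side:
  "(\<lambda>g. hda_D Mt Mr b rho rs s2 A g) \<in> borel_measurable borel"
proof -
  have 1: "(\<lambda>g. \<Prod>l\<in>#A. 1 + rho / real (min Mt Mr) * l + (1 + rs * g) * s2) \<in> borel_measurable borel"
    by (induction A) auto
  have 2: "(\<lambda>g. \<Sum>l\<in>#A. 1 / (1 + rs * g + 1 / s2 * (1 + rho / real (min Mt Mr) * l))) \<in> borel_measurable borel"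
    by (induction A) auto
  have "Measurable.pred borel (hda_outage Mt Mr b rho rs s2 A)"
    unfolding hda_outage_def Let_def using 1 by measurable
  then show ?thesis unfolding hda_D_def Let_def using 2 by measurable
qed

text \<open>A Bochner integral is 0 by convention when the integrand is not integrable.
  Measurability and the bounds 0 and 1 exclude this case for both integrals, and all later estimates
  can use nonnegative integrals.\<close>

lemma ennreal_hda_integral:
  "ennreal (\<integral>H. (\<integral>g. hda_D Mt Mr b rho rs s2 (nz_eigs Mr Mt H) g \<partial>gamma_measure) \<partial>chan_measure Mr Mt)
   = (\<integral>\<^sup>+H. (\<integral>\<^sup>+g. ennreal (hda_D Mt Mr b rho rs s2 (nz_eigs Mr Mt H) (max g 0)) \<partial>gamma_measure) \<partial>chan_measure Mr Mt)"
proof -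
  interpret G: prob_space gamma_measure by (rule prob_space_gamma)
  interpret C: prob_space "chan_measure Mr Mt" by (rule prob_space_chan_measure)
  let ?D = "\<lambda>H g. hda_D Mt Mr b rho rs s2 (nz_eigs Mr Mt H) g"
  have Db: "0 \<le> ?D H (max g 0)" "?D H (max g 0) \<le> 1" for H g
    using hda_D_bounds(3,4)[of "max g 0" H] by auto
  have mD: "(\<lambda>g. ?D H g) \<in> borel_measurable gamma_measure" for H
    using measurable_hda_D_side[of "nz_eigs Mr Mt H"] by simp
  have mD': "(\<lambda>g. ?D H (max g 0)) \<in> borel_measurable gamma_measure" for H
    using measurable_compose[OF _ measurable_hda_D_side[of "nz_eigs Mr Mt H"], of "\<lambda>g. max g 0" gamma_measure] by simp
  have int: "integrable gamma_measure (\<lambda>g. ?D H (max g 0))" for H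
    by (rule G.integrable_const_bound[of _ 1]) (use Db mD' in auto)
  have inner: "(\<integral>g. ?D H g \<partial>gamma_measure) = (\<integral>g. ?D H (max g 0) \<partial>gamma_measure)" for H
    by (rule integral_cong_AE[OF mD mD']) (use AE_gamma_nonneg in eventually_elim, simp add: max_def)
  have inn: "ennreal (\<integral>g. ?D H (max g 0) \<partial>gamma_measure) = (\<integral>\<^sup>+g. ennreal (?D H (max g 0)) \<partial>gamma_measure)" for H
    by (rule nn_integral_eq_integral[symmetric, OF int]) (use Db in auto)
  have mO: "(\<lambda>H. \<integral>g. ?D H (max g 0) \<partial>gamma_measure) \<in> borel_measurable (chan_measure Mr Mt)"
    using G.borel_measurable_lebesgue_integral[of "\<lambda>H g. ?D H (max g 0)" "chan_measure Mr Mt"] measurable_hda_D_joint by (simp add: split_def)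
  have b1: "0 \<le> (\<integral>g. ?D H (max g 0) \<partial>gamma_measure)" "(\<integral>g. ?D H (max g 0) \<partial>gamma_measure) \<le> 1" for H
  proof -
    show "0 \<le> (\<integral>g. ?D H (max g 0) \<partial>gamma_measure)" using Db by (intro Bochner_Integration.integral_nonneg) auto
    have "(\<integral>g. ?D H (max g 0) \<partial>gamma_measure) \<le> (\<integral>g. 1 \<partial>gamma_measure)"
      using int Db by (intro integral_mono) auto
    then show "(\<integral>g. ?D H (max g 0) \<partial>gamma_measure) \<le> 1" by (simp add: G.prob_space)
  qed
  have intO: "integrable (chan_measure Mr Mt) (\<lambda>H. \<integral>g. ?D H (max g 0) \<partial>gamma_measure)"
    by (rule C.integrable_const_bound[of _ 1]) (use b1 mO in auto)
  show ?thesis unfolding inner inn[symmetric]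
    by (rule nn_integral_eq_integral[symmetric, OF intO]) (use b1 in auto)
qed

end

section \<open>Bounds on the expected distortion at fixed parameters\<close>

context
  fixes Mt Mr :: nat and b rho rs s2 :: real
  assumes M: "min Mt Mr \<ge> 1" and rho: "rho > 0" and rs: "rs > 0" and s2: "s2 > 0"
begin

definition hda_dist :: ennreal where
  "hda_dist = ennreal (\<integral>H. (\<integral>g. hda_D Mt Mr b rho rs s2 (nz_eigs Mr Mt H) g \<partial>gamma_measure) \<partial>chan_measure Mr Mt)"

definition hda_side :: ennreal where
  "hda_side = (\<integral>\<^sup>+g. ennreal (1 / (1 + rs * g)) * indicator {0..} g \<partial>gamma_measure)"

lemma hda_dist_nn:
  "hda_dist = (\<integral>\<^sup>+H. (\<integral>\<^sup>+g. ennreal (hda_D Mt Mr b rho rs s2 (nz_eigs Mr Mt H) (max g 0)) \<partial>gamma_measure) \<partial>chan_measure Mr Mt)"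
  unfolding hda_dist_def by (rule ennreal_hda_integral[OF M rho rs s2])

lemma hda_side_eq: "(\<integral>\<^sup>+g. ennreal (1 / (1 + rs * max g 0)) \<partial>gamma_measure) = hda_side"
  unfolding hda_side_def
  by (rule nn_integral_cong_AE) (use AE_gamma_nonneg in eventually_elim, simp add: max_def)

lemma hda_dist_le_side: "hda_dist \<le> hda_side"
proof -
  interpret C: prob_space "chan_measure Mr Mt" by (rule prob_space_chan_measure)
  have "hda_dist \<le> (\<integral>\<^sup>+H. (\<integral>\<^sup>+g. ennreal (1 / (1 + rs * max g 0)) \<partial>gamma_measure) \<partial>chan_measure Mr Mt)"
    unfolding hda_dist_nn by (intro nn_integral_mono ennreal_leI hda_D_bounds(1)[OF M rho rs s2]) simp
  also have "\<dots> = hda_side" unfolding hda_side_eq by (simp add: C.emeasure_space_1)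
  finally show ?thesis .
qed

text \<open>By \<open>hda_outage_imp\<close> outage lies in an event on the channel alone, so its
  contribution factors into the mean side-information distortion and a tail probability: the
  exponents \<open>nu\<close> and \<open>dmt\<close> add. Without outage the side information is
  dropped.\<close>

lemma hda_dist_le:
  "hda_dist \<le> hda_side * emeasure (chan_measure Mr Mt) {H \<in> space (chan_measure Mr Mt).
      eigprod Mr Mt (rho / real (min Mt Mr)) H powr (b * real (min Mt Mr) - 1) \<le> (1 + 1 / s2) ^ min Mt Mr}
    + ennreal s2 * (\<integral>\<^sup>+H. ennreal (\<Sum>l\<in>#nz_eigs Mr Mt H. 1 / (1 + rho / real (min Mt Mr) * l)) \<partial>chan_measure Mr Mt)"
proof -
  interpret G: prob_space gamma_measure by (rule prob_space_gamma)
  let ?E = "{H \<in> space (chan_measure Mr Mt). eigprod Mr Mt (rho / real (min Mt Mr)) H powr (b * real (min Mt Mr) - 1) \<le> (1 + 1 / s2) ^ min Mt Mr}"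
  let ?T = "\<lambda>H. \<Sum>l\<in>#nz_eigs Mr Mt H. 1 / (1 + rho / real (min Mt Mr) * l)"
  have beta: "rho / real (min Mt Mr) > 0" using M rho by simp
  have f: "eigprod Mr Mt (rho / real (min Mt Mr)) \<in> borel_measurable (chan_measure Mr Mt)"
    unfolding measurable_chan_iff using beta by (rule measurable_eigprod_chan)
  then have E: "?E \<in> sets (chan_measure Mr Mt)"
    by (intro borel_measurable_le powr_real_measurable borel_measurable_const)
  have T: "?T \<in> borel_measurable (chan_measure Mr Mt)"
    unfolding measurable_chan_iff using beta by (intro measurable_sum_inverse_eigs) auto
  have T0: "?T H \<ge> 0" for H
  proof (rule sum_mset_le_scaled(2)[where c = 1 and q = "\<lambda>l. 1 / (1 + rho / real (min Mt Mr) * l)"], intro ballI conjI)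
    fix l assume "l \<in># nz_eigs Mr Mt H"
    then have "0 \<le> rho / real (min Mt Mr) * l" using beta nz_eigs_nonneg[of l Mr Mt H] by (intro mult_nonneg_nonneg) auto
    then show "0 \<le> 1 / (1 + rho / real (min Mt Mr) * l)" by (intro divide_nonneg_nonneg) linarith+
  qed simp
  have "hda_dist \<le> (\<integral>\<^sup>+H. (\<integral>\<^sup>+g. ennreal (1 / (1 + rs * max g 0)) * indicator ?E H + ennreal s2 * ennreal (?T H) \<partial>gamma_measure) \<partial>chan_measure Mr Mt)"
    unfolding hda_dist_nn
  proof (intro nn_integral_mono)
    fix H g assume H: "H \<in> space (chan_measure Mr Mt)"
    let ?g = "max g (0::real)"
    have g: "?g \<ge> 0" by simp
    show "ennreal (hda_D Mt Mr b rho rs s2 (nz_eigs Mr Mt H) ?g) \<le> ennreal (1 / (1 + rs * ?g)) * indicator ?E H + ennreal s2 * ennreal (?T H)"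
    proof (cases "hda_outage Mt Mr b rho rs s2 (nz_eigs Mr Mt H) ?g")
      case True
      have "H \<in> ?E"
        by (intro CollectI conjI H hda_outage_imp[OF M less_imp_le[OF rho] less_imp_le[OF rs] g s2 True])
      then have ind: "indicator ?E H = (1::ennreal)" by (rule indicator_simps(1))
      have "ennreal (hda_D Mt Mr b rho rs s2 (nz_eigs Mr Mt H) ?g) \<le> ennreal (1 / (1 + rs * ?g))"
        by (intro ennreal_leI hda_D_bounds(1)[OF M rho rs s2 g])
      then show ?thesis unfolding ind mult_1_right by (rule add_increasing2[OF zero_le])
    next
      case False
      then have "hda_D Mt Mr b rho rs s2 (nz_eigs Mr Mt H) ?g = hda_avg Mt Mr rho rs s2 H ?g"
        unfolding hda_D_eq[OF M rho rs s2] by (simp only: if_False)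
      then have "hda_D Mt Mr b rho rs s2 (nz_eigs Mr Mt H) ?g \<le> s2 * ?T H"
        using hda_avg_le_inverse_eigs[OF M rho rs s2 g, of H] by (simp only:)
      then have "ennreal (hda_D Mt Mr b rho rs s2 (nz_eigs Mr Mt H) ?g) \<le> ennreal (s2 * ?T H)" by (rule ennreal_leI)
      also have "\<dots> = ennreal s2 * ennreal (?T H)" by (rule ennreal_mult'[OF less_imp_le[OF s2]])
      finally show ?thesis by (rule add_increasing[OF zero_le])
    qed
  qed
  also have "\<dots> = (\<integral>\<^sup>+H. hda_side * indicator ?E H + ennreal s2 * ennreal (?T H) \<partial>chan_measure Mr Mt)"
  proof (intro nn_integral_cong)
    fix H
    have m: "(\<lambda>g. ennreal (1 / (1 + rs * max g 0))) \<in> borel_measurable gamma_measure" by measurable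
    show "(\<integral>\<^sup>+g. ennreal (1 / (1 + rs * max g 0)) * indicator ?E H + ennreal s2 * ennreal (?T H) \<partial>gamma_measure) = hda_side * indicator ?E H + ennreal s2 * ennreal (?T H)"
    proof -
      have "(\<integral>\<^sup>+g. ennreal (1 / (1 + rs * max g 0)) * indicator ?E H + ennreal s2 * ennreal (?T H) \<partial>gamma_measure)
        = (\<integral>\<^sup>+g. ennreal (1 / (1 + rs * max g 0)) * indicator ?E H \<partial>gamma_measure) + (\<integral>\<^sup>+g. ennreal s2 * ennreal (?T H) \<partial>gamma_measure)"
        by (rule nn_integral_add) (intro borel_measurable_times_ennreal m borel_measurable_const)+
      also have "(\<integral>\<^sup>+g. ennreal (1 / (1 + rs * max g 0)) * indicator ?E H \<partial>gamma_measure) = hda_side * indicator ?E H"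
        unfolding nn_integral_multc[OF m] hda_side_eq ..
      also have "(\<integral>\<^sup>+g. ennreal s2 * ennreal (?T H) \<partial>gamma_measure) = ennreal s2 * ennreal (?T H)"
        unfolding nn_integral_const G.emeasure_space_1 by (rule mult_1_right)
      finally show ?thesis .
    qed
  qed
  also have "\<dots> = (\<integral>\<^sup>+H. hda_side * indicator ?E H \<partial>chan_measure Mr Mt) + (\<integral>\<^sup>+H. ennreal s2 * ennreal (?T H) \<partial>chan_measure Mr Mt)"
    by (intro nn_integral_add borel_measurable_times_ennreal borel_measurable_const borel_measurable_indicator E
        measurable_compose[OF T measurable_ennreal])
  also have "\<dots> = hda_side * emeasure (chan_measure Mr Mt) ?E + ennreal s2 * (\<integral>\<^sup>+H. ennreal (?T H) \<partial>chan_measure Mr Mt)"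
    unfolding nn_integral_cmult_indicator[OF E] nn_integral_cmult[OF measurable_compose[OF T measurable_ennreal]] ..
  finally show ?thesis .
qed

lemma hda_dist_ge:
  assumes A: "A \<in> sets (chan_measure Mr Mt)" and t: "t \<ge> 0" and v: "v \<ge> 0"
    and D: "\<And>H g. H \<in> A \<Longrightarrow> 0 \<le> g \<Longrightarrow> g \<le> t \<Longrightarrow> v \<le> hda_D Mt Mr b rho rs s2 (nz_eigs Mr Mt H) g"
  shows "ennreal v * emeasure gamma_measure {0..t} * emeasure (chan_measure Mr Mt) A \<le> hda_dist"
proof -
  have "ennreal v * emeasure gamma_measure {0..t} * emeasure (chan_measure Mr Mt) A
    = (\<integral>\<^sup>+H. (\<integral>\<^sup>+g. ennreal v * indicator {0..t} g \<partial>gamma_measure) * indicator A H \<partial>chan_measure Mr Mt)"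
    using A by (subst nn_integral_cmult_indicator; simp add: nn_integral_cmult_indicator)
  also have "\<dots> = (\<integral>\<^sup>+H. (\<integral>\<^sup>+g. ennreal v * indicator {0..t} g * indicator A H \<partial>gamma_measure) \<partial>chan_measure Mr Mt)"
    by (intro nn_integral_cong nn_integral_multc[symmetric]) auto
  also have "\<dots> \<le> hda_dist"
    unfolding hda_dist_nn
  proof (intro nn_integral_mono)
    fix H g
    show "ennreal v * indicator {0..t} g * indicator A H \<le> ennreal (hda_D Mt Mr b rho rs s2 (nz_eigs Mr Mt H) (max g 0))"
    proof (cases "H \<in> A \<and> g \<in> {0..t}")
      case True
      then have "max g 0 = g" by simp
      then show ?thesis using True D[of H g] by (simp add: ennreal_leI)
    next
      case False
      then have "ennreal v * indicator {0..t} g * indicator A H = 0" by (auto simp: indicator_def)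
      then show ?thesis by (simp only: zero_le)
    qed
  qed
  finally show ?thesis .
qed

text \<open>If \<open>rs * g \<le> 1\<close>, the side information is useless up to a factor 2. The
  event \<open>g \<le> t\<close> with \<open>t\<close> about \<open>1 / rs\<close> has probability
  of that order, which supplies the summand \<open>nu\<close>; outage then leaves distortion at
  least 1/2.\<close>

lemma hda_dist_ge_outage:
  assumes t: "t \<ge> 0" "rs * t \<le> 1" and s21: "s2 \<le> 1"
  shows "ennreal (1/2) * emeasure gamma_measure {0..t} * emeasure (chan_measure Mr Mt) {H \<in> space (chan_measure Mr Mt).
      4 ^ min Mt Mr * eigprod Mr Mt (rho / real (min Mt Mr)) H powr (b * real (min Mt Mr) - 1) \<le> (1 + 1 / s2) ^ min Mt Mr} \<le> hda_dist"
proof (rule hda_dist_ge)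
  have beta: "rho / real (min Mt Mr) > 0" using M rho by simp
  have f: "eigprod Mr Mt (rho / real (min Mt Mr)) \<in> borel_measurable (chan_measure Mr Mt)"
    unfolding measurable_chan_iff using beta by (rule measurable_eigprod_chan)
  then show "{H \<in> space (chan_measure Mr Mt).
      4 ^ min Mt Mr * eigprod Mr Mt (rho / real (min Mt Mr)) H powr (b * real (min Mt Mr) - 1) \<le> (1 + 1 / s2) ^ min Mt Mr} \<in> sets (chan_measure Mr Mt)"
    by (intro borel_measurable_le powr_real_measurable borel_measurable_const borel_measurable_times)
  fix H g assume H: "H \<in> {H \<in> space (chan_measure Mr Mt).
      4 ^ min Mt Mr * eigprod Mr Mt (rho / real (min Mt Mr)) H powr (b * real (min Mt Mr) - 1) \<le> (1 + 1 / s2) ^ min Mt Mr}" and g: "0 \<le> g" "g \<le> t"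
  have "rs * g \<le> rs * t" using g rs by (intro mult_left_mono) auto
  then have u: "1 + rs * g \<le> 2" using t by linarith
  have "hda_outage Mt Mr b rho rs s2 (nz_eigs Mr Mt H) g"
    by (rule hda_outage_if[OF less_imp_le[OF rho] less_imp_le[OF rs] g(1) s2 u s21]) (use H in blast)
  then have "hda_D Mt Mr b rho rs s2 (nz_eigs Mr Mt H) g = 1 / (1 + rs * g)"
    unfolding hda_D_eq[OF M rho rs s2] by (simp only: if_True)
  moreover have "1 / 2 \<le> 1 / (1 + rs * g)" using u g rs by (intro divide_left_mono) (auto intro!: add_pos_nonneg)
  ultimately show "1/2 \<le> hda_D Mt Mr b rho rs s2 (nz_eigs Mr Mt H) g" by simp
qed (use t in auto)

text \<open>For entries of modulus at most 1 the eigenvalues are at most \<open>Mr * Mt\<close>, and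
  this channel event has a positive probability independent of \<open>rho\<close>. Outage is
  irrelevant here, since the distortion is at least \<open>hda_avg\<close> in either case.\<close>

lemma hda_dist_ge_typical:
  "ennreal (1 / (1 + rs + (1 / s2) * (1 + rho * real (Mr * Mt)))) * emeasure gamma_measure {0..1} *
    emeasure (chan_measure Mr Mt) (Pi\<^sub>E ({..<Mr} \<times> {..<Mt}) (\<lambda>_. {z. cmod z \<le> 1})) \<le> hda_dist"
proof (rule hda_dist_ge)
  show "Pi\<^sub>E ({..<Mr} \<times> {..<Mt}) (\<lambda>_. {z. cmod z \<le> 1}) \<in> sets (chan_measure Mr Mt)"
    unfolding sets_chan_measure by (intro sets_PiM_I_finite) auto
  have w: "0 \<le> (1 / s2) * (1 + rho * real (Mr * Mt))" using s2 rho by (intro mult_nonneg_nonneg) auto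
  then show "0 \<le> 1 / (1 + rs + (1 / s2) * (1 + rho * real (Mr * Mt)))"
    using rs by (intro divide_nonneg_nonneg) linarith+
  fix H g assume H: "H \<in> Pi\<^sub>E ({..<Mr} \<times> {..<Mt}) (\<lambda>_. {z. cmod z \<le> 1})" and g: "0 \<le> g" "g \<le> (1::real)"
  have sz: "size (nz_eigs Mr Mt H) = min Mt Mr" using size_nz_eigs[of Mr Mt H] by (simp add: min.commute)
  have "sqnorm ({..<Mr}\<times>{..<Mt}) H \<le> (\<Sum>p\<in>{..<Mr}\<times>{..<Mt}. 1)"
    using H by (intro sum_mono) (auto simp: PiE_iff power_le_one)
  then have S: "sqnorm ({..<Mr}\<times>{..<Mt}) H \<le> real (Mr * Mt)" by (simp add: card_cartesian_product)
  let ?w = "1 / (1 + rs + (1 / s2) * (1 + rho * real (Mr * Mt)))"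
  let ?p = "\<lambda>l. 1 / (1 + rs * g + (1 / s2) * (1 + rho / real (min Mt Mr) * l))"
  have each: "?w \<le> ?p l" if l: "l \<in># nz_eigs Mr Mt H" for l
  proof -
    have l0: "0 \<le> l" "l \<le> real (Mr * Mt)" using nz_eigs_nonneg[OF l] nz_eigs_le[OF l] S by linarith+
    have "rho / real (min Mt Mr) \<le> rho / 1"
      using rho M by (intro divide_left_mono) auto
    then have "rho / real (min Mt Mr) * l \<le> rho * real (Mr * Mt)"
      using l0 rho by (intro mult_mono) auto
    then have "(1 / s2) * (1 + rho / real (min Mt Mr) * l) \<le> (1 / s2) * (1 + rho * real (Mr * Mt))"
      using s2 by (intro mult_left_mono) auto
    moreover have "rs * g \<le> rs * 1" using g rs by (intro mult_left_mono) auto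
    moreover have "0 \<le> rs * g" using g rs by simp
    moreover have "0 \<le> rho / real (min Mt Mr) * l" using l0 rho by (intro mult_nonneg_nonneg) auto
    then have "0 \<le> (1 / s2) * (1 + rho / real (min Mt Mr) * l)" using s2 by (intro mult_nonneg_nonneg) auto
    ultimately have "1 + rs * g + (1 / s2) * (1 + rho / real (min Mt Mr) * l) \<le> 1 + rs + (1 / s2) * (1 + rho * real (Mr * Mt))"
      "0 < 1 + rs * g + (1 / s2) * (1 + rho / real (min Mt Mr) * l)" by linarith+
    then show ?thesis by (intro divide_left_mono mult_pos_pos) linarith+
  qed
  have "(\<Sum>l\<in>#nz_eigs Mr Mt H. ?w) \<le> (\<Sum>l\<in>#nz_eigs Mr Mt H. ?p l)"
    using each by (rule sum_mset_mono)
  then have "real (min Mt Mr) * ?w \<le> (\<Sum>l\<in>#nz_eigs Mr Mt H. ?p l)"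
    by (simp only: sum_mset_constant sz)
  then have "(1 / real (min Mt Mr)) * (real (min Mt Mr) * ?w) \<le> hda_avg Mt Mr rho rs s2 H g"
    unfolding hda_avg_def[OF M rho rs s2] by (intro mult_left_mono) auto
  moreover have "(1 / real k) * (real k * c) = c" if "k \<ge> 1" for k and c :: real using that by simp
  from this[OF M] have "(1 / real (min Mt Mr)) * (real (min Mt Mr) * ?w) = ?w" .
  ultimately have "?w \<le> hda_avg Mt Mr rho rs s2 H g" by (simp only:)
  also have "\<dots> \<le> hda_D Mt Mr b rho rs s2 (nz_eigs Mr Mt H) g" by (rule hda_D_bounds(2)[OF M rho rs s2 g(1)])
  finally show "?w \<le> hda_D Mt Mr b rho rs s2 (nz_eigs Mr Mt H) g" .
qed simp

end

section \<open>Distortion exponent\<close>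

lemma eventually_const_le_powr:
  fixes C d :: real
  assumes "d > 0"
  shows "eventually (\<lambda>rho. C \<le> rho powr d) at_top"
proof -
  define K where "K = max C 1"
  have "eventually (\<lambda>rho. rho \<ge> K powr (1 / d)) at_top" by (rule eventually_ge_at_top)
  then show ?thesis
  proof eventually_elim
    case (elim rho)
    have "C \<le> K" by (simp add: K_def)
    also have "K = (K powr (1 / d)) powr d" using assms by (simp add: powr_powr K_def)
    also have "\<dots> \<le> rho powr d" using elim assms by (intro powr_mono2) auto
    finally show ?case .
  qed
qed

text \<open>Multiplicative constants are absorbed by an extra power \<open>rho powr (d/4)\<close>,
  so a slack of \<open>d/4\<close> in both bounds becomes \<open>d/2\<close>. The lower bound also
  makes the logarithm meaningful.\<close>

lemma exponent_limit:
  fixes F :: "real \<Rightarrow> real"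
  assumes up: "\<And>d. d > 0 \<Longrightarrow> \<exists>C. eventually (\<lambda>rho. F rho \<le> C * rho powr (- (e - d))) at_top"
    and lo: "\<And>d. d > 0 \<Longrightarrow> \<exists>c>0. eventually (\<lambda>rho. c * rho powr (- (e + d)) \<le> F rho) at_top"
  shows "((\<lambda>rho. - log 2 (F rho) / log 2 rho) \<longlongrightarrow> e) at_top"
proof (rule tendstoI)
  fix d :: real assume d: "d > 0"
  obtain C where C: "eventually (\<lambda>rho. F rho \<le> C * rho powr (- (e - d/4))) at_top" using up[of "d/4"] d by auto
  obtain c where c: "c > 0" "eventually (\<lambda>rho. c * rho powr (- (e + d/4)) \<le> F rho) at_top" using lo[of "d/4"] d by auto
  have "eventually (\<lambda>rho. C \<le> rho powr (d/4)) at_top" "eventually (\<lambda>rho. 1 / c \<le> rho powr (d/4)) at_top" "eventually (\<lambda>rho. rho > (1::real)) at_top"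
    using d by (auto intro: eventually_const_le_powr eventually_gt_at_top)
  with C c(2) show "eventually (\<lambda>rho. dist (- log 2 (F rho) / log 2 rho) e < d) at_top"
  proof eventually_elim
    case (elim rho)
    have L: "log 2 rho > 0" using elim by simp
    have "C * rho powr (- (e - d/4)) \<le> rho powr (d/4) * rho powr (- (e - d/4))"
      using elim by (intro mult_right_mono) auto
    also have "\<dots> = rho powr (- (e - d/2))" by (simp flip: powr_add)
    finally have 1: "F rho \<le> rho powr (- (e - d/2))" using elim by linarith
    have "1 \<le> c * rho powr (d/4)" using elim c by (simp add: field_simps)
    then have "1 * rho powr (- (e + d/2)) \<le> (c * rho powr (d/4)) * rho powr (- (e + d/2))"
      by (intro mult_right_mono) auto
    also have "\<dots> = c * rho powr (d/4 + - (e + d/2))" by (simp only: powr_add mult.assoc)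
    also have "d/4 + - (e + d/2) = - (e + d/4)" by simp
    finally have 2: "rho powr (- (e + d/2)) \<le> F rho" using elim by linarith
    have pos: "rho powr (- (e + d/2)) > 0" using elim by simp
    then have Fp: "F rho > 0" using 2 by linarith
    have "log 2 (F rho) \<le> log 2 (rho powr (- (e - d/2)))" using 1 Fp elim by simp
    then have 3: "log 2 (F rho) \<le> - (e - d/2) * log 2 rho" using elim by (simp add: log_powr)
    have "log 2 (rho powr (- (e + d/2))) \<le> log 2 (F rho)" using 2 Fp pos by simp
    then have 4: "- (e + d/2) * log 2 rho \<le> log 2 (F rho)" using elim by (simp add: log_powr)
    have "- log 2 (F rho) / log 2 rho \<ge> e - d/2" using 3 L by (simp add: field_simps)
    moreover have "- log 2 (F rho) / log 2 rho \<le> e + d/2" using 4 L by (simp add: field_simps)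
    ultimately show ?case using d by (simp add: dist_real_def abs_le_iff)
  qed
qed

lemma emeasure_cgauss_disc_pos: "emeasure cgauss {z. cmod z \<le> 1} > 0"
proof -
  have "0 < ennreal (exp (-1) / pi) * ennreal (1\<^sup>2 / 4)" by (simp flip: ennreal_mult')
  also have "\<dots> \<le> ennreal (exp (-1) / pi) * emeasure lborel {z. cmod z \<le> 1}"
    by (intro mult_left_mono emeasure_complex_disc_ge) auto
  also have "\<dots> = (\<integral>\<^sup>+z. ennreal (exp (-1) / pi) * indicator {z. cmod z \<le> 1} z \<partial>lborel)"
    by (rule nn_integral_cmult_indicator[symmetric]) measurable
  also have "\<dots> \<le> (\<integral>\<^sup>+z. ennreal (exp (- (cmod z * cmod z)) / pi) * indicator {z. cmod z \<le> 1} z \<partial>lborel)"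
  proof (intro nn_integral_mono)
    fix z :: complex
    show "ennreal (exp (-1) / pi) * indicator {z. cmod z \<le> 1} z \<le> ennreal (exp (- (cmod z * cmod z)) / pi) * indicator {z. cmod z \<le> 1} z"
    proof (cases "cmod z \<le> 1")
      case True
      then have "cmod z * cmod z \<le> 1" by (simp add: mult_le_one)
      then have "exp (-1) / pi \<le> exp (- (cmod z * cmod z)) / pi" by (intro divide_right_mono) auto
      then show ?thesis using True by (simp add: ennreal_leI)
    qed simp
  qed
  also have "\<dots> = emeasure cgauss {z. cmod z \<le> 1}"
    unfolding cgauss_def by (rule emeasure_density[symmetric]) auto
  finally show ?thesis .
qed

lemma emeasure_chan_box_pos:
  "emeasure (chan_measure Mr Mt) (Pi\<^sub>E ({..<Mr} \<times> {..<Mt}) (\<lambda>_. {z. cmod z \<le> 1})) > 0"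
proof -
  interpret product_sigma_finite "\<lambda>_. cgauss" by (rule product_sigma_finite_cgauss)
  have "emeasure (chan_measure Mr Mt) (Pi\<^sub>E ({..<Mr} \<times> {..<Mt}) (\<lambda>_. {z. cmod z \<le> 1})) = (\<Prod>p\<in>{..<Mr} \<times> {..<Mt}. emeasure cgauss {z. cmod z \<le> 1})"
    unfolding chan_measure_def by (intro emeasure_PiM) auto
  also have "\<dots> > 0"
  proof -
    have "emeasure cgauss {z. cmod z \<le> 1} ^ n > 0" for n
      using emeasure_cgauss_disc_pos by (induction n) (auto simp: ennreal_zero_less_mult_iff)
    then show ?thesis by (simp only: prod_constant)
  qed
  finally show ?thesis .
qed

text \<open>The rate is \<open>r * log 2 rho\<close> with \<open>r > 0\<close>; at
  \<open>r = 0\<close> the quantity \<open>2 powr (- eps) - 1\<close>, and with it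
  \<open>hda_sigma2\<close>, is negative. The limit assumption on \<open>rs\<close> is the equality
  of exponential order with \<open>rho powr nu\<close>.\<close>

locale hda_exponent =
  fixes Mt Mr :: nat and b nu eps r :: real and rs :: "real \<Rightarrow> real"
  assumes M: "min Mt Mr \<ge> 1" and b: "b * real (min Mt Mr) > 1" and nu: "nu \<ge> 0" and eps: "eps > 0" and r: "r > 0"
    and rs: "\<And>rho. rho > 0 \<Longrightarrow> rs rho > 0"
    and rs_lim: "((\<lambda>rho. log 2 (rs rho) / log 2 rho) \<longlongrightarrow> nu) at_top"
begin

abbreviation (input) "m \<equiv> min Mt Mr"
text \<open>Outage asks that the determinant to the power \<open>b * m - 1\<close> be at most
  \<open>(1 + 1 / sig rho) ^ m\<close>, which is of order \<open>rho powr (r * m)\<close>. Thus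
  \<open>x0\<close> is the critical exponent of the determinant.\<close>

abbreviation (input) "x0 \<equiv> r * real (min Mt Mr) / (b * real (min Mt Mr) - 1)"
abbreviation (input) "sig rho \<equiv> hda_sigma2 eps (r * log 2 rho)"
abbreviation (input) "ED rho \<equiv> hda_ED Mt Mr b eps rho (rs rho) (r * log 2 rho)"

lemma rs_bounds:
  assumes "d > 0"
  shows "eventually (\<lambda>rho. rho powr (nu - d) \<le> rs rho \<and> rs rho \<le> rho powr (nu + d)) at_top"
proof -
  have "eventually (\<lambda>rho. dist (log 2 (rs rho) / log 2 rho) nu < d) at_top" using tendstoD[OF rs_lim assms] .
  moreover have "eventually (\<lambda>rho. rho > (1::real)) at_top" by (rule eventually_gt_at_top)
  ultimately show ?thesis
  proof eventually_elim
    case (elim rho)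
    have L: "log 2 rho > 0" using elim by simp
    have p: "rs rho > 0" using rs elim by simp
    have "log 2 (rs rho) / log 2 rho < nu + d" "nu - d < log 2 (rs rho) / log 2 rho" using elim by (auto simp: dist_real_def)
    then have "log 2 (rs rho) < (nu + d) * log 2 rho" "(nu - d) * log 2 rho < log 2 (rs rho)" using L by (auto simp: field_simps)
    then have "log 2 (rs rho) < log 2 (rho powr (nu + d))" "log 2 (rho powr (nu - d)) < log 2 (rs rho)" using elim by (auto simp: log_powr)
    then show ?case using p elim by simp
  qed
qed

lemma sig_facts:
  "eventually (\<lambda>rho. rho \<ge> 1 \<and> sig rho > 0 \<and> sig rho \<le> 1 \<and> sig rho \<le> 2 * 2 powr eps * rho powr (- r)
     \<and> 1 + 1 / sig rho = rho powr r * 2 powr (- eps) \<and> 1 / sig rho \<le> rho powr r) at_top"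
proof -
  have "eventually (\<lambda>rho. 2 * 2 powr eps \<le> rho powr r) at_top" using r by (rule eventually_const_le_powr)
  moreover have "eventually (\<lambda>rho. rho \<ge> (1::real)) at_top" by (rule eventually_ge_at_top)
  ultimately show ?thesis
  proof eventually_elim
    case (elim rho)
    define G where "G = rho powr r * 2 powr (- eps)"
    have "2 powr (r * log 2 rho) = (2 powr log 2 rho) powr r" by (simp add: powr_powr mult.commute)
    also have "\<dots> = rho powr r" using elim by simp
    finally have G: "2 powr (r * log 2 rho - eps) = G"
      unfolding G_def diff_conv_add_uminus powr_add by simp
    have G2: "G \<ge> 2" using elim(1) unfolding G_def powr_minus by (simp add: field_simps)
    have s: "sig rho = 1 / (G - 1)" by (simp add: hda_sigma2_def G)
    have "G \<le> rho powr r * 1"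
      unfolding G_def using eps powr_mono[of "- eps" 0 2] by (intro mult_left_mono) auto
    then have f1: "1 / (1 / (G - 1)) \<le> rho powr r" by simp
    \<comment> \<open>For large \<open>rho\<close> the quantity \<open>G\<close> is at least 2, so
      the 1 subtracted in \<open>hda_sigma2\<close> costs at most a factor 2.\<close>
    have "1 / (G - 1) \<le> 2 / G" using G2 by (simp add: field_simps)
    also have "2 / G = 2 * 2 powr eps * rho powr (- r)" using elim by (simp add: G_def powr_minus field_simps)
    finally have f2: "1 / (G - 1) \<le> 2 * 2 powr eps * rho powr (- r)" .
    have f3: "1 / (G - 1) > 0" "1 / (G - 1) \<le> 1" "1 + 1 / (1 / (G - 1)) = G" using G2 by auto
    show ?case unfolding s G_def[symmetric] using elim(2) f1 f2 f3 by blast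
  qed
qed

lemma ED_eq: "rho > 0 \<Longrightarrow> sig rho > 0 \<Longrightarrow> ennreal (ED rho) = hda_dist Mt Mr b rho (rs rho) (sig rho)"
  using M rs by (simp add: hda_dist_def hda_ED_def)

lemma side_bound:
  assumes d: "d > 0"
  shows "\<exists>C\<ge>0. eventually (\<lambda>rho. hda_side (rs rho) \<le> ennreal (C * rho powr (- (nu - d)))) at_top"
proof -
  \<comment> \<open>Using the exponent \<open>1 - e\<close> instead of 1 loses about
    \<open>e * nu\<close> in \<open>rho\<close>; this choice keeps it below \<open>d / 2\<close>,
    and the other half covers the uncertainty of \<open>rs\<close>. The \<open>+ 1\<close> keeps the
    quotient defined at \<open>nu = 0\<close>.\<close>
  define e where "e = min (1/2) (d / (2 * (nu + 1)))"
  have e: "e > 0" "e < 1" "e * nu \<le> d / 2"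
  proof -
    show "e > 0" "e < 1" using d nu by (auto simp: e_def)
    have "e * nu \<le> d / (2 * (nu + 1)) * nu" using nu by (intro mult_right_mono) (auto simp: e_def)
    also have "\<dots> = d / 2 * (nu / (nu + 1))" using nu by (simp add: field_simps)
    also have "\<dots> \<le> d / 2 * 1" using nu d by (intro mult_left_mono) auto
    finally show "e * nu \<le> d / 2" by simp
  qed
  obtain C where C: "C \<ge> 0" and Cb: "\<And>t. t > 0 \<Longrightarrow> (\<integral>\<^sup>+g. ennreal (1 / (1 + t * g)) * indicator {0..} g \<partial>gamma_measure) \<le> ennreal (C * t powr (- (1 - e)))"
    using gamma_tail_side_information[of "1 - e"] e by auto
  have "eventually (\<lambda>rho. rho powr (nu - d/2) \<le> rs rho \<and> rs rho \<le> rho powr (nu + d/2)) at_top" using d by (intro rs_bounds) auto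
  moreover have "eventually (\<lambda>rho. rho \<ge> (1::real)) at_top" by (rule eventually_ge_at_top)
  ultimately have "eventually (\<lambda>rho. hda_side (rs rho) \<le> ennreal (C * rho powr (- (nu - d)))) at_top"
  proof eventually_elim
    case (elim rho)
    have p: "rs rho > 0" using rs elim by simp
    have "rs rho powr (- (1 - e)) \<le> (rho powr (nu - d/2)) powr (- (1 - e))"
      using elim e by (intro powr_mono2') auto
    also have "\<dots> = rho powr ((nu - d/2) * (- (1 - e)))" by (simp add: powr_powr)
    also have "\<dots> \<le> rho powr (- (nu - d))"
    proof (rule powr_mono)
      have "e * (d/2) \<ge> 0" using e d by simp
      moreover have "(nu - d/2) * (- (1 - e)) = - nu + e * nu + d/2 - e * (d/2)" by (simp add: field_simps)
      ultimately show "(nu - d/2) * (- (1 - e)) \<le> - (nu - d)" using e(3) by linarith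
    qed (use elim in simp)
    finally have "rs rho powr (- (1 - e)) \<le> rho powr (- (nu - d))" .
    then have "ennreal (C * rs rho powr (- (1 - e))) \<le> ennreal (C * rho powr (- (nu - d)))"
      using C by (intro ennreal_leI mult_left_mono) auto
    then show ?case using Cb[OF p] M p elim by (simp add: hda_side_def)
  qed
  then show ?thesis using C by blast
qed

lemma ED_upper_side:
  assumes d: "d > 0"
  shows "\<exists>C. eventually (\<lambda>rho. ED rho \<le> C * rho powr (- (nu - d))) at_top"
proof -
  obtain C where C: "C \<ge> 0" "eventually (\<lambda>rho. hda_side (rs rho) \<le> ennreal (C * rho powr (- (nu - d)))) at_top"
    using side_bound[OF d] by blast
  from C(2) sig_facts have "eventually (\<lambda>rho. ED rho \<le> C * rho powr (- (nu - d))) at_top"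
  proof eventually_elim
    case (elim rho)
    have p: "rho > 0" "rs rho > 0" using rs elim by auto
    have "ennreal (ED rho) \<le> hda_side (rs rho)"
      using ED_eq[of rho] hda_dist_le_side[OF M p, of "sig rho" b] elim p by simp
    also have "\<dots> \<le> ennreal (C * rho powr (- (nu - d)))" using elim by simp
    finally show ?case using C(1) by simp
  qed
  then show ?thesis by blast
qed

text \<open>Outage contributes \<open>nu + dmt Mr Mt x0\<close> and the uncoded layer
  \<open>r + 1\<close>; the slower decay wins. The errors in the first product are
  \<open>d/2\<close> each.\<close>

lemma ED_upper_coded:
  assumes d: "d > 0"
  shows "\<exists>C. eventually (\<lambda>rho. ED rho \<le> C * rho powr (- (min (nu + dmt Mr Mt x0) (r + 1) - d))) at_top"
proof -
  define ee where "ee = b * real m - 1"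
  have ee: "ee > 0" using b by (simp add: ee_def)
  have x0: "x0 = r * real m / ee" by (simp add: ee_def)
  have x0p: "x0 \<ge> 0" unfolding x0 using r ee by simp
  \<comment> \<open>What \<open>eps\<close> leaves behind when the outage inequality is solved for
    the determinant by taking the power \<open>1 / ee\<close>.\<close>
  define K where "K = (2 powr (- eps)) powr (real m / ee)"
  have K: "K > 0" by (simp add: K_def)
  have c: "1 / real m > 0" using M by simp
  have d2: "d / 2 > 0" using d by simp
  have m': "min Mr Mt \<ge> 1" using M by (simp add: min.commute)
  obtain C1 where C1: "C1 \<ge> 0" "eventually (\<lambda>rho. hda_side (rs rho) \<le> ennreal (C1 * rho powr (- (nu - d/2)))) at_top"
    using side_bound[OF d2] by blast
  obtain C2 where C2: "C2 \<ge> 0" and C2b: "\<And>rho. rho \<ge> 1 \<Longrightarrow> emeasure (chan_measure Mr Mt) {H \<in> space (chan_measure Mr Mt). eigprod Mr Mt (1 / real m * rho) H \<le> K * rho powr x0}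
    \<le> ennreal (C2 * rho powr (- (dmt Mr Mt x0 - d/2)))"
    using eigprod_tail_le[OF c K x0p d2] by blast
  obtain C3 where C3: "C3 \<ge> 0" and C3b: "\<And>rho. rho \<ge> 1 \<Longrightarrow> (\<integral>\<^sup>+H. ennreal (\<Sum>l\<in>#nz_eigs Mr Mt H. 1 / (1 + (1 / real m * rho) * l)) \<partial>chan_measure Mr Mt)
    \<le> ennreal (C3 * rho powr (- (1 - d)))"
    using expected_inverse_eigs[OF c d m'] by blast
  define C where "C = C1 * C2 + 2 * 2 powr eps * C3"
  have C: "C \<ge> 0" using C1 C2 C3 by (simp add: C_def)
  let ?E = "min (nu + dmt Mr Mt x0) (r + 1) - d"
  from C1(2) sig_facts have "eventually (\<lambda>rho. ED rho \<le> C * rho powr (- ?E)) at_top"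
  proof eventually_elim
    case (elim rho)
    have p: "rho > 0" "rs rho > 0" using rs elim by auto
    have rm: "1 / real m * rho = rho / real m" by simp
    have fp: "eigprod Mr Mt (rho / real m) H > 0" for H using p by (intro eigprod_pos) simp
    let ?A = "{H \<in> space (chan_measure Mr Mt). eigprod Mr Mt (rho / real m) H powr (b * real m - 1) \<le> (1 + 1 / sig rho) ^ m}"
    let ?B = "{H \<in> space (chan_measure Mr Mt). eigprod Mr Mt (rho / real m) H \<le> K * rho powr x0}"
    have "?A \<subseteq> ?B"
    proof (intro subsetI CollectI conjI)
      fix H assume H: "H \<in> ?A"
      then show "H \<in> space (chan_measure Mr Mt)" by blast
      let ?f = "eigprod Mr Mt (rho / real m) H"
      have "?f = (?f powr ee) powr (1 / ee)" using fp[of H] ee by (simp add: powr_powr)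
      also have "\<dots> \<le> ((1 + 1 / sig rho) ^ m) powr (1 / ee)"
        using H ee by (intro powr_mono2) (auto simp: ee_def)
      also have "(1 + 1 / sig rho) ^ m = (rho powr r * 2 powr (- eps)) powr real m"
        using elim p by (simp add: powr_realpow)
      also have "\<dots> powr (1 / ee) = (rho powr r * 2 powr (- eps)) powr (real m / ee)"
        by (simp add: powr_powr)
      also have "\<dots> = (rho powr r) powr (real m / ee) * K" unfolding K_def by (rule powr_mult)
      also have "(rho powr r) powr (real m / ee) = rho powr x0" unfolding x0 by (simp add: powr_powr)
      finally show "?f \<le> K * rho powr x0" by (simp add: mult.commute)
    qed
    moreover have "?B \<in> sets (chan_measure Mr Mt)"
    proof -
      have "eigprod Mr Mt (rho / real m) \<in> borel_measurable (chan_measure Mr Mt)"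
        unfolding measurable_chan_iff using p M by (intro measurable_eigprod_chan) auto
      then show ?thesis by (intro borel_measurable_le borel_measurable_const)
    qed
    ultimately have "emeasure (chan_measure Mr Mt) ?A \<le> emeasure (chan_measure Mr Mt) ?B" by (rule emeasure_mono)
    also have "\<dots> \<le> ennreal (C2 * rho powr (- (dmt Mr Mt x0 - d/2)))" using C2b[of rho] elim unfolding rm by simp
    finally have A: "emeasure (chan_measure Mr Mt) ?A \<le> ennreal (C2 * rho powr (- (dmt Mr Mt x0 - d/2)))" .
    have "ennreal (ED rho) \<le> hda_side (rs rho) * emeasure (chan_measure Mr Mt) ?A + ennreal (sig rho) * (\<integral>\<^sup>+H. ennreal (\<Sum>l\<in>#nz_eigs Mr Mt H. 1 / (1 + rho / real m * l)) \<partial>chan_measure Mr Mt)"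
      using ED_eq[of rho] hda_dist_le[OF M p, of "sig rho" b] elim p by simp
    also have "\<dots> \<le> ennreal (C1 * rho powr (- (nu - d/2))) * ennreal (C2 * rho powr (- (dmt Mr Mt x0 - d/2))) + ennreal (2 * 2 powr eps * rho powr (- r)) * ennreal (C3 * rho powr (- (1 - d)))"
      using elim A C3b[of rho] unfolding rm by (intro add_mono mult_mono ennreal_leI) auto
    also have "\<dots> = ennreal (C1 * rho powr (- (nu - d/2)) * (C2 * rho powr (- (dmt Mr Mt x0 - d/2))) + 2 * 2 powr eps * rho powr (- r) * (C3 * rho powr (- (1 - d))))"
      using C1 C2 C3 by (simp add: ennreal_mult ennreal_plus)
    also have "C1 * rho powr (- (nu - d/2)) * (C2 * rho powr (- (dmt Mr Mt x0 - d/2))) + 2 * 2 powr eps * rho powr (- r) * (C3 * rho powr (- (1 - d)))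
       = C1 * C2 * rho powr (- (nu + dmt Mr Mt x0 - d)) + 2 * 2 powr eps * C3 * rho powr (- (r + 1 - d))"
    proof -
      have pa: "rho powr A * rho powr B = rho powr D" if "A + B = D" for A B D
        using that by (simp only: powr_add[symmetric])
      have pm: "(c1 * p1) * (c2 * p2) = c1 * c2 * (p1 * p2)" for c1 c2 p1 p2 :: real by simp
      have "rho powr (- (nu - d/2)) * rho powr (- (dmt Mr Mt x0 - d/2)) = rho powr (- (nu + dmt Mr Mt x0 - d))"
      proof (rule pa)
        have "- (nu - d/2) + - (D - d/2) = - (nu + D - d)" for D by (simp add: field_simps)
        then show "- (nu - d/2) + - (dmt Mr Mt x0 - d/2) = - (nu + dmt Mr Mt x0 - d)" .
      qed
      moreover have "rho powr (- r) * rho powr (- (1 - d)) = rho powr (- (r + 1 - d))"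
        by (rule pa) simp
      ultimately show ?thesis unfolding pm by (simp only:)
    qed
    also have "\<dots> \<le> C1 * C2 * rho powr (- ?E) + 2 * 2 powr eps * C3 * rho powr (- ?E)"
      using elim C1 C2 C3 by (intro add_mono mult_left_mono powr_mono) auto
    also have "\<dots> = C * rho powr (- ?E)" by (simp add: C_def algebra_simps)
    finally have "ennreal (ED rho) \<le> ennreal (C * rho powr (- ?E))" by (simp add: ennreal_leI)
    then show ?case using C by (subst (asm) ennreal_le_iff) auto
  qed
  then show ?thesis by blast
qed

lemma ED_lower_typical:
  assumes d: "d > 0"
  shows "\<exists>c>0. eventually (\<lambda>rho. c * rho powr (- (max nu (r + 1) + d)) \<le> ED rho) at_top"
proof -
  interpret P: prob_space "chan_measure Mr Mt" by (rule prob_space_chan_measure)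
  let ?B = "Pi\<^sub>E ({..<Mr} \<times> {..<Mt}) (\<lambda>_. {z. cmod z \<le> 1})"
  define p0 where "p0 = measure (chan_measure Mr Mt) ?B"
  have p0: "emeasure (chan_measure Mr Mt) ?B = ennreal p0" by (simp add: p0_def P.emeasure_eq_measure)
  have p0p: "p0 > 0" using emeasure_chan_box_pos[of Mr Mt] unfolding p0 by simp
  define N where "N = real (Mr * Mt)"
  have N: "N \<ge> 0" by (simp add: N_def)
  \<comment> \<open>The denominator consists of 1, \<open>rs rho\<close> and the eigenvalue term, at
    most \<open>?X\<close>, \<open>?X\<close> and \<open>(1 + N) * ?X\<close>. The other factors
    come from \<open>gamma_small_ge\<close> on the unit interval and from the probability
    \<open>p0\<close> of the channel box.\<close>
  define c where "c = exp (-1) * p0 / (3 + N)"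
  have c: "c > 0" using p0p N by (simp add: c_def)
  have "eventually (\<lambda>rho. rho powr (nu - d) \<le> rs rho \<and> rs rho \<le> rho powr (nu + d)) at_top" by (rule rs_bounds[OF d])
  then have "eventually (\<lambda>rho. c * rho powr (- (max nu (r + 1) + d)) \<le> ED rho) at_top" using sig_facts
  proof eventually_elim
    case (elim rho)
    have p: "rho > 0" "rs rho > 0" using rs elim by auto
    define W where "W = 1 + rs rho + (1 / sig rho) * (1 + rho * real (Mr * Mt))"
    let ?X = "rho powr (max nu (r + 1) + d)"
    have W0: "W > 0" using p elim N unfolding W_def N_def[symmetric] by (intro add_pos_nonneg add_pos_pos mult_nonneg_nonneg add_nonneg_nonneg) auto
    have "1 \<le> ?X" using elim nu d by (intro ge_one_powr_ge_zero) auto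
    moreover have "rs rho \<le> ?X"
    proof -
      have "rho powr (nu + d) \<le> ?X" using elim by (intro powr_mono) auto
      then show ?thesis using elim by linarith
    qed
    moreover have "(1 / sig rho) * (1 + rho * N) \<le> (1 + N) * ?X"
    proof -
      have "1 + rho * N \<le> rho * (1 + N)" using elim by (simp add: algebra_simps)
      then have "(1 / sig rho) * (1 + rho * N) \<le> rho powr r * (rho * (1 + N))"
        using elim N by (intro mult_mono) auto
      also have "\<dots> = (1 + N) * rho powr (r + 1)" using p by (simp add: powr_add)
      also have "\<dots> \<le> (1 + N) * ?X" using elim N d by (intro mult_left_mono powr_mono) auto
      finally show ?thesis .
    qed
    ultimately have "W \<le> 1 * ?X + 1 * ?X + (1 + N) * ?X" unfolding W_def N_def[symmetric] by linarith
    then have W: "W \<le> (3 + N) * ?X" by (simp add: algebra_simps)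
    have "c * rho powr (- (max nu (r + 1) + d)) = (1 * exp (-1) * p0) * (1 / ((3 + N) * ?X))"
      unfolding c_def powr_minus by (simp add: field_simps)
    also have "\<dots> \<le> (1 * exp (-1) * p0) * (1 / W)"
      using W W0 p0p N elim by (intro mult_left_mono divide_left_mono mult_pos_pos) auto
    finally have 1: "c * rho powr (- (max nu (r + 1) + d)) \<le> 1 / W * (1 * exp (-1)) * p0" by simp
    have "ennreal (1 / W * (1 * exp (-1)) * p0) = ennreal (1 / W) * ennreal (1 * exp (-1)) * ennreal p0"
    proof -
      have em: "ennreal (x * y * z) = ennreal x * ennreal y * ennreal z" if "x \<ge> 0" "y \<ge> 0" "z \<ge> 0" for x y z
        using that by (simp add: ennreal_mult)
      show ?thesis by (rule em) (use W0 p0p in auto)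
    qed
    also have "\<dots> \<le> ennreal (1 / W) * emeasure gamma_measure {0..1} * ennreal p0"
      by (intro mult_right_mono mult_left_mono gamma_small_ge) auto
    also have "\<dots> \<le> ennreal (ED rho)"
      using hda_dist_ge_typical[OF M p, of "sig rho" b] ED_eq[of rho] elim p unfolding W_def p0 by simp
    finally have "ennreal (1 / W * (1 * exp (-1)) * p0) \<le> ennreal (ED rho)" .
    moreover have "1 / W * (1 * exp (-1)) * p0 > 0" using W0 p0p by simp
    ultimately have "1 / W * (1 * exp (-1)) * p0 \<le> ED rho" by (metis ennreal_le_iff2 less_le_not_le)
    then show ?case using 1 by linarith
  qed
  then show ?thesis using c by blast
qed

text \<open>At the exponent \<open>x0\<close> itself the constant \<open>K\<close> of the tail bound
  need not fit the outage threshold. For \<open>x\<close> slightly below \<open>x0\<close> a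
  positive power of \<open>rho\<close> absorbs all constants, and continuity of the tradeoff curve
  limits the loss.\<close>

lemma ED_lower_outage:
  assumes d: "d > 0"
  shows "\<exists>c>0. eventually (\<lambda>rho. c * rho powr (- (nu + dmt Mr Mt x0 + d)) \<le> ED rho) at_top"
proof -
  define ee where "ee = b * real m - 1"
  have ee: "ee > 0" using b by (simp add: ee_def)
  have x0: "x0 = r * real m / ee" by (simp add: ee_def)
  have x0p: "x0 > 0" unfolding x0 using r ee M by simp
  have "\<exists>x. 0 \<le> x \<and> x < X \<and> dmt Mr Mt x \<le> dmt Mr Mt X + d/2" if X: "X > 0" for X
  proof -
    have "isCont (dmt Mr Mt) X" using continuous_on_dmt[of Mr Mt] by (simp add: continuous_on_eq_continuous_at)
    then obtain h where h: "h > 0" "\<And>y. dist y X < h \<Longrightarrow> dist (dmt Mr Mt y) (dmt Mr Mt X) < d/2"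
      using d unfolding continuous_at_eps_delta by (meson half_gt_zero)
    let ?y = "max 0 (X - h/2)"
    have "dist ?y X < h" using h(1) X by (auto simp: dist_real_def max_def)
    then have "dist (dmt Mr Mt ?y) (dmt Mr Mt X) < d/2" by (rule h(2))
    then have "dmt Mr Mt ?y \<le> dmt Mr Mt X + d/2" unfolding dist_real_def by linarith
    then show ?thesis using h(1) X by (intro exI[of _ ?y]) auto
  qed
  from this[OF x0p] obtain x where x: "0 \<le> x" "x < x0" "dmt Mr Mt x \<le> dmt Mr Mt x0 + d/2" by blast
  have c: "1 / real m > 0" using M by simp
  obtain K C where K: "K > 0" and C: "C > 0" and Cb: "\<And>rho. rho \<ge> 1 \<Longrightarrow> ennreal (C * rho powr (- dmt Mr Mt x)) \<le>
     emeasure (chan_measure Mr Mt) {H \<in> space (chan_measure Mr Mt). eigprod Mr Mt (1 / real m * rho) H \<le> K * rho powr x}"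
    using eigprod_tail_ge[OF c x(1)] by blast
  define K' where "K' = 4 ^ m * K powr ee * (2 powr eps) ^ m"
  have xe: "(x0 - x) * ee > 0" using x ee by simp
  define c' where "c' = 1/2 * exp (-1) * C"
  have c': "c' > 0" using C by (simp add: c'_def)
  have "eventually (\<lambda>rho. K' \<le> rho powr ((x0 - x) * ee)) at_top" by (rule eventually_const_le_powr[OF xe])
  moreover have "eventually (\<lambda>rho. rho powr (nu - d/2) \<le> rs rho \<and> rs rho \<le> rho powr (nu + d/2)) at_top" by (rule rs_bounds) (use d in simp)
  ultimately have "eventually (\<lambda>rho. c' * rho powr (- (nu + dmt Mr Mt x0 + d)) \<le> ED rho) at_top" using sig_facts
  proof eventually_elim
    case (elim rho)
    have p: "rho > 0" "rs rho > 0" using rs elim by auto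
    have rm: "1 / real m * rho = rho / real m" by simp
    have fp: "eigprod Mr Mt (rho / real m) H > 0" for H using p by (intro eigprod_pos) simp
    let ?f = "eigprod Mr Mt (rho / real m)"
    let ?A = "{H \<in> space (chan_measure Mr Mt). 4 ^ m * ?f H powr (b * real m - 1) \<le> (1 + 1 / sig rho) ^ m}"
    let ?B = "{H \<in> space (chan_measure Mr Mt). ?f H \<le> K * rho powr x}"
    have fm: "?f \<in> borel_measurable (chan_measure Mr Mt)"
      unfolding measurable_chan_iff using p M by (intro measurable_eigprod_chan) auto
    have "?B \<subseteq> ?A"
    proof (intro subsetI CollectI conjI)
      fix H assume H: "H \<in> ?B"
      then show "H \<in> space (chan_measure Mr Mt)" by blast
      have "?f H powr ee \<le> (K * rho powr x) powr ee" using H fp[of H] ee by (intro powr_mono2) auto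
      also have "\<dots> = K powr ee * rho powr (x * ee)" by (simp add: powr_mult powr_powr)
      finally have "4 ^ m * ?f H powr ee \<le> 4 ^ m * (K powr ee * rho powr (x * ee))" by (intro mult_left_mono) auto
      also have "\<dots> = K' * ((2 powr (- eps)) ^ m * rho powr (x * ee))"
        unfolding K'_def powr_minus by (simp add: power_inverse field_simps)
      also have "\<dots> \<le> rho powr ((x0 - x) * ee) * ((2 powr (- eps)) ^ m * rho powr (x * ee))"
        using elim by (intro mult_right_mono) auto
      also have "\<dots> = (2 powr (- eps)) ^ m * rho powr (x0 * ee)"
        by (simp add: mult.left_commute powr_add[symmetric] left_diff_distrib)
      also have "rho powr (x0 * ee) = (rho powr r) ^ m"
        unfolding x0 using ee p by (simp add: powr_realpow[symmetric] powr_powr)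
      also have "(2 powr (- eps)) ^ m * (rho powr r) ^ m = (1 + 1 / sig rho) ^ m"
        using elim by (simp add: power_mult_distrib)
      finally show "4 ^ m * ?f H powr (b * real m - 1) \<le> (1 + 1 / sig rho) ^ m" unfolding ee_def .
    qed
    moreover have "?A \<in> sets (chan_measure Mr Mt)"
      using fm by (intro borel_measurable_le powr_real_measurable borel_measurable_const borel_measurable_times)
    ultimately have "emeasure (chan_measure Mr Mt) ?B \<le> emeasure (chan_measure Mr Mt) ?A" by (rule emeasure_mono)
    then have A: "ennreal (C * rho powr (- dmt Mr Mt x)) \<le> emeasure (chan_measure Mr Mt) ?A"
      using Cb[of rho] elim unfolding rm by (meson order_trans)
    \<comment> \<open>The largest power of \<open>rho\<close> for which
      \<open>rs rho \<le> rho powr (nu + d/2)\<close> guarantees \<open>rs rho * t \<le> 1\<close>,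
      as \<open>hda_dist_ge_outage\<close> requires.\<close>
    define t where "t = rho powr (- (nu + d/2))"
    have t: "0 \<le> t" "t \<le> 1" "rs rho * t \<le> 1"
    proof -
      show "0 \<le> t" by (simp add: t_def)
      have "t \<le> rho powr 0" unfolding t_def using elim nu d by (intro powr_mono) auto
      then show "t \<le> 1" using p by simp
      have "rs rho * t \<le> rho powr (nu + d/2) * t" using elim by (intro mult_right_mono) (auto simp: t_def)
      also have "\<dots> = 1" unfolding t_def using p by (simp add: powr_add[symmetric])
      finally show "rs rho * t \<le> 1" .
    qed
    have "c' * rho powr (- (nu + dmt Mr Mt x0 + d)) \<le> c' * rho powr (- (nu + d/2) + - dmt Mr Mt x)"
      using elim c' x(3) by (intro mult_left_mono powr_mono) auto
    also have "\<dots> = 1/2 * (t * exp (-1)) * (C * rho powr (- dmt Mr Mt x))"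
      unfolding powr_add c'_def t_def by simp
    finally have 1: "c' * rho powr (- (nu + dmt Mr Mt x0 + d)) \<le> 1/2 * (t * exp (-1)) * (C * rho powr (- dmt Mr Mt x))" .
    have "ennreal (1/2 * (t * exp (-1)) * (C * rho powr (- dmt Mr Mt x))) = ennreal (1/2) * ennreal (t * exp (-1)) * ennreal (C * rho powr (- dmt Mr Mt x))"
      using t C by (simp only: ennreal_mult mult_nonneg_nonneg exp_ge_zero powr_ge_zero less_imp_le zero_le_divide_1_iff zero_le_numeral)
    also have "\<dots> \<le> ennreal (1/2) * emeasure gamma_measure {0..t} * emeasure (chan_measure Mr Mt) ?A"
      by (intro mult_mono gamma_small_ge A t) auto
    also have "\<dots> \<le> ennreal (ED rho)"
      using hda_dist_ge_outage[OF M p, of "sig rho" t b] ED_eq[of rho] elim p t by simp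
    finally have 2: "ennreal (1/2 * (t * exp (-1)) * (C * rho powr (- dmt Mr Mt x))) \<le> ennreal (ED rho)" .
    have "1/2 * (t * exp (-1)) * (C * rho powr (- dmt Mr Mt x)) > 0" using C p by (simp add: t_def)
    then have "1/2 * (t * exp (-1)) * (C * rho powr (- dmt Mr Mt x)) \<le> ED rho" using 2 by (metis ennreal_le_iff2 less_le_not_le)
    then show ?case using 1 by linarith
  qed
  then show ?thesis using c' by blast
qed

text \<open>As \<open>dmt\<close> is nonnegative, the exponent equals \<open>nu\<close> or
  \<open>min (nu + dmt Mr Mt x0) (r + 1)\<close>, and each alternative has its own upper bound on
  the distortion. Being a minimum it also equals one of its two arguments, each with its own lower
  bound.\<close>

lemma ED_exponent:
  "((\<lambda>rho. - log 2 (ED rho) / log 2 rho) \<longlongrightarrow> min (max nu (r + 1)) (nu + dmt Mr Mt x0)) at_top"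
proof (rule exponent_limit)
  fix d :: real assume d: "d > 0"
  let ?e = "min (max nu (r + 1)) (nu + dmt Mr Mt x0)"
  have "?e = nu \<or> ?e = min (nu + dmt Mr Mt x0) (r + 1)"
    using dmt_nonneg[of Mr Mt x0] by (auto simp: min_def max_def)
  then show "\<exists>C. eventually (\<lambda>rho. ED rho \<le> C * rho powr (- (?e - d))) at_top"
    using ED_upper_side[OF d] ED_upper_coded[OF d] by (elim disjE) simp_all
  have "?e = max nu (r + 1) \<or> ?e = nu + dmt Mr Mt x0" by (auto simp: min_def)
  then show "\<exists>c>0. eventually (\<lambda>rho. c * rho powr (- (?e + d)) \<le> ED rho) at_top"
    using ED_lower_typical[OF d] ED_lower_outage[OF d] by (elim disjE) simp_all
qed

end

section \<open>Segments of the tradeoff curve and its crossing point\<close>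

lemma dmt_segment:
  assumes k: "k < min Mr Mt" and x: "real k \<le> x" "x \<le> real k + 1"
  shows "dmt Mr Mt x = Phi Mt Mr k - (x - real k) * Upsilon Mt Mr k"
proof -
  define W where "W l = real Mr + real Mt - 1 - 2 * real l" for l
  have mm: "real (max Mt Mr) + real (min Mt Mr) = real Mr + real Mt" by (auto simp: max_def min_def)
  have U: "Upsilon Mt Mr l = W l" for l using mm by (simp add: Upsilon_def W_def)
  \<comment> \<open>The weights are the drops between consecutive corner values, so their partial
    sums telescope.\<close>
  have sumW: "(\<Sum>l<j. W l) = Phi Mt Mr 0 - Phi Mt Mr j" for j
  proof (induction j)
    case (Suc j)
    have "Phi Mt Mr j - Phi Mt Mr (Suc j) = real (max Mt Mr) + real (min Mt Mr) - 1 - 2 * real j"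
      by (simp add: Phi_def algebra_simps)
    then show ?case using Suc unfolding mm by (simp add: W_def)
  qed simp
  have full: "(\<Sum>l<min Mr Mt. W l) = Phi Mt Mr 0"
    unfolding sumW by (simp add: Phi_def min.commute)
  have "(\<Sum>l<min Mr Mt. clamp01 (x - real l) * W l) = (\<Sum>l<Suc k. clamp01 (x - real l) * W l)"
  proof (rule sum.mono_neutral_right)
    show "\<forall>l\<in>{..<min Mr Mt} - {..<Suc k}. clamp01 (x - real l) * W l = 0"
    proof
      fix l assume "l \<in> {..<min Mr Mt} - {..<Suc k}"
      then have "real k + 1 \<le> real l" by simp
      then show "clamp01 (x - real l) * W l = 0" using x by (simp add: clamp01_def)
    qed
  qed (use k in auto)
  also have "\<dots> = (\<Sum>l<k. W l) + (x - real k) * W k"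
  proof -
    have "(\<Sum>l<k. clamp01 (x - real l) * W l) = (\<Sum>l<k. W l)"
    proof (intro sum.cong refl)
      fix l assume "l \<in> {..<k}"
      then have "real l + 1 \<le> real k" by simp
      then show "clamp01 (x - real l) * W l = W l" using x by (simp add: clamp01_def)
    qed
    moreover have "clamp01 (x - real k) = x - real k" using x by (simp add: clamp01_def)
    ultimately show ?thesis by simp
  qed
  finally have "(\<Sum>l<min Mr Mt. clamp01 (x - real l) * W l) = Phi Mt Mr 0 - Phi Mt Mr k + (x - real k) * W k"
    unfolding sumW .
  moreover have "dmt Mr Mt x = (\<Sum>l<min Mr Mt. W l) - (\<Sum>l<min Mr Mt. clamp01 (x - real l) * W l)"
    unfolding dmt_def W_def by (simp add: left_diff_distrib sum_subtractf)
  ultimately show ?thesis unfolding full U by simp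
qed

lemma Phi_Suc: "Phi Mt Mr (k + 1) = Phi Mt Mr k - Upsilon Mt Mr k"
  by (simp add: Phi_def Upsilon_def algebra_simps)

lemma Upsilon_ge_1:
  assumes "k < min Mt Mr"
  shows "Upsilon Mt Mr k \<ge> 1"
proof -
  have "real k + 1 \<le> real (min Mt Mr)" "real (min Mt Mr) \<le> real (max Mt Mr)" using assms by auto
  then show ?thesis by (simp only: Upsilon_def)
qed

text \<open>On a segment of the curve the equation between the two terms is linear, with solution
  \<open>r0\<close> at abscissa \<open>x\<close>. The two conditions on \<open>b\<close> say that
  \<open>x\<close> lies between \<open>k\<close> and \<open>k + 1\<close>, so that the solution
  belongs to the segment on which it was computed.\<close>

lemma crossing_formula:
  fixes Mt Mr :: nat and b nu :: real
  defines "m \<equiv> min Mt Mr"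
  assumes nu: "nu \<ge> 0" and b: "b * real m > 1" and k: "k < m"
    and lo: "(Phi Mt Mr (k+1) - 1 + nu) / real (k+1) + 1 / real m \<le> b"
    and hi: "k = 0 \<or> b < (Phi Mt Mr k - 1 + nu) / real k + 1 / real m"
  defines "r0 \<equiv> (b * real m - 1) * (Phi Mt Mr k + real k * Upsilon Mt Mr k - 1 + nu) / (b * real m - 1 + real m * Upsilon Mt Mr k)"
  shows "r0 + 1 = nu + dmt Mr Mt (r0 * real m / (b * real m - 1))"
proof -
  define D where "D = b * real m - 1"
  define U where "U = Upsilon Mt Mr k"
  define P where "P = Phi Mt Mr k + real k * U - 1 + nu"
  define x where "x = real m * P / (D + real m * U)"
  have m: "real m > 0" using k by simp
  have D: "D > 0" using b by (simp add: D_def)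
  have U: "U \<ge> 1" using Upsilon_ge_1[of k Mt Mr] k by (simp add: U_def m_def)
  have den: "D + real m * U > 0" using D U m by (intro add_pos_nonneg) auto
  have r0: "r0 = D * P / (D + real m * U)" by (simp add: r0_def D_def P_def U_def)
  have xr: "r0 * real m / D = x" using D by (simp add: r0 x_def)
  have bD: "b = (D + 1) / real m" using m by (simp add: D_def)
  have xk: "real k \<le> x"
  proof -
    have "real k * D \<le> real m * (Phi Mt Mr k - 1 + nu)"
    proof (cases "k = 0")
      case True
      \<comment> \<open>For \<open>k = 0\<close> there is no upper condition on \<open>b\<close>;
        nonnegativity of \<open>x\<close> comes from \<open>Phi Mt Mr 0 \<ge> 1\<close>.\<close>
      have "1 * 1 \<le> real (max Mt Mr) * real (min Mt Mr)" using k unfolding m_def by (intro mult_mono) auto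
      then have "Phi Mt Mr k \<ge> 1" unfolding True Phi_def by simp
      then have "0 \<le> Phi Mt Mr k - 1 + nu" using nu by linarith
      then show ?thesis using m True by simp
    next
      case False
      then have kp: "real k > 0" by simp
      have "(D + 1) / real m < (Phi Mt Mr k - 1 + nu) / real k + 1 / real m" using hi False bD by simp
      then have "D / real m < (Phi Mt Mr k - 1 + nu) / real k" by (simp add: add_divide_distrib)
      then show ?thesis using m kp by (simp add: field_simps)
    qed
    then have "real k * (D + real m * U) \<le> real m * P" by (simp add: P_def algebra_simps)
    then show ?thesis unfolding x_def using den by (simp add: pos_le_divide_eq)
  qed
  have xk1: "x \<le> real k + 1"
  proof -
    have kp: "real (k + 1) > 0" by simp
    have "(Phi Mt Mr k - U - 1 + nu) / real (k + 1) + 1 / real m \<le> (D + 1) / real m"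
      using lo unfolding Phi_Suc U_def bD .
    then have "(Phi Mt Mr k - U - 1 + nu) / real (k + 1) \<le> D / real m" by (simp add: add_divide_distrib)
    then have "real m * (Phi Mt Mr k - U - 1 + nu) \<le> D * real (k + 1)" using m kp by (simp add: divide_le_eq le_divide_eq mult.commute)
    then have "real m * P \<le> (real k + 1) * (D + real m * U)" by (simp add: P_def algebra_simps)
    then show ?thesis unfolding x_def using den by (simp add: pos_divide_le_eq)
  qed
  have "dmt Mr Mt x = Phi Mt Mr k - (x - real k) * U"
    unfolding U_def using k xk xk1 by (intro dmt_segment) (auto simp: m_def)
  then have "nu + dmt Mr Mt x = P + 1 - U * x" by (simp add: P_def algebra_simps)
  also have "\<dots> = r0 + 1"
  proof -
    have "P - U * x = r0" unfolding x_def r0 using den by (simp add: field_simps)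
    then show ?thesis by simp
  qed
  finally show ?thesis using xr by (simp add: D_def)
qed

text \<open>This separates the two cases of the final formula: below \<open>nu / m\<close> none of
  the intervals for \<open>k\<close> can apply. Clearing denominators leaves the product of
  \<open>m - j\<close> and \<open>m * (n - j) + nu - 1\<close> to be shown nonnegative.\<close>

lemma breakpoint_ge:
  fixes nu :: real
  assumes "nu \<ge> 0" "k < min Mt Mr"
  shows "nu / real (min Mt Mr) \<le> (Phi Mt Mr (k+1) - 1 + nu) / real (k+1) + 1 / real (min Mt Mr)"
proof -
  define m where "m = real (min Mt Mr)"
  define n where "n = real (max Mt Mr)"
  define j where "j = real (k + 1)"
  have j: "1 \<le> j" "j \<le> m" "m \<le> n" using assms(2) by (auto simp: j_def m_def n_def)
  \<comment> \<open>Integrality matters: a gap between \<open>j\<close> and \<open>m\<close> is at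
    least 1, so \<open>m * (n - j)\<close> outweighs the \<open>- 1\<close>.\<close>
  have "j = m \<or> j + 1 \<le> m"
  proof -
    have "k + 1 = min Mt Mr \<or> k + 1 + 1 \<le> min Mt Mr" using assms(2) by linarith
    then show ?thesis
    proof
      assume "k + 1 + 1 \<le> min Mt Mr"
      then have "real (k + 1 + 1) \<le> real (min Mt Mr)" by (simp only: of_nat_le_iff)
      then show ?thesis by (simp add: j_def m_def)
    qed (simp add: j_def m_def)
  qed
  then have "0 \<le> (m - j) * (m * (n - j) + nu - 1)"
  proof
    assume a: "j + 1 \<le> m"
    have "1 * 1 \<le> m * (n - j)" using a j by (intro mult_mono) auto
    then show ?thesis using a assms(1) by (intro mult_nonneg_nonneg) auto
  qed simp
  also have "\<dots> = m * ((n - j) * (m - j) - 1 + nu) - j * (nu - 1)" by (simp add: algebra_simps)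
  finally have "j * (nu - 1) \<le> m * ((n - j) * (m - j) - 1 + nu)" by simp
  then have "(nu - 1) / m \<le> ((n - j) * (m - j) - 1 + nu) / j"
    using j by (simp add: divide_le_eq le_divide_eq mult.commute)
  moreover have "Phi Mt Mr (k+1) = (n - j) * (m - j)" by (simp add: Phi_def n_def m_def j_def)
  ultimately show ?thesis unfolding m_def[symmetric] j_def[symmetric] by (simp add: diff_divide_distrib)
qed

theorem theorem3:
  fixes Mt Mr :: nat and b nu eps :: real and rs :: "real \<Rightarrow> real"
  assumes "Mt \<ge> 1" and "Mr \<ge> 1"
    and "b * real (min Mt Mr) > 1"
    and "nu \<ge> 0"
    and "eps > 0"
    and "\<forall>rho>0. rs rho > 0"
    and "((\<lambda>rho. log 2 (rs rho) / log 2 rho) \<longlongrightarrow> nu) at_top"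
  shows "\<exists>E Delta.
     (\<forall>r>0. ((\<lambda>rho. - log 2 (hda_ED Mt Mr b eps rho (rs rho) (r * log 2 rho)) / log 2 rho)
               \<longlongrightarrow> E r) at_top)
     \<and> (\<forall>r>0. E r \<le> Delta) \<and> (\<forall>d>0. \<exists>r>0. E r > Delta - d)
     \<and> (1 / real (min Mt Mr) \<le> b \<and> b < nu / real (min Mt Mr) \<longrightarrow> Delta = nu)
     \<and> (\<forall>k<min Mt Mr.
          (Phi Mt Mr (k+1) - 1 + nu) / real (k+1) + 1 / real (min Mt Mr) \<le> b \<and>
          (k = 0 \<or> b < (Phi Mt Mr k - 1 + nu) / real k + 1 / real (min Mt Mr)) \<longrightarrow>
          Delta = 1 + (b * real (min Mt Mr) - 1) * (Phi Mt Mr k + real k * Upsilon Mt Mr k - 1 + nu)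
                      / (b * real (min Mt Mr) - 1 + real (min Mt Mr) * Upsilon Mt Mr k))"
proof -
  define m where "m = min Mt Mr"
  define D where "D = b * real m - 1"
  have M: "min Mt Mr \<ge> 1" using assms(1,2) by simp
  have m: "real m \<ge> 1" using M by (simp add: m_def)
  have D: "D > 0" using assms(3) by (simp add: D_def m_def)
  define h where "h r = nu + dmt Mr Mt (r * real m / D)" for r
  define E where "E r = min (max nu (r + 1)) (h r)" for r
  have h_nu: "nu \<le> h r" for r using dmt_nonneg[of Mr Mt] by (simp add: h_def)
  have h_anti: "h r' \<le> h r" if "r \<le> r'" for r r'
    unfolding h_def using that D by (intro add_left_mono dmt_antimono divide_right_mono mult_right_mono) auto
  have h_cont: "continuous_on UNIV h"
    unfolding h_def using D by (intro continuous_intros continuous_on_compose2[OF continuous_on_dmt]) auto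
  have lim: "((\<lambda>rho. - log 2 (hda_ED Mt Mr b eps rho (rs rho) (r * log 2 rho)) / log 2 rho) \<longlongrightarrow> E r) at_top"
    if "r > 0" for r
  proof -
    have "hda_exponent Mt Mr b nu eps r rs"
      using M assms(3-7) that by (intro hda_exponent.intro) auto
    then show ?thesis unfolding E_def h_def D_def m_def by (rule hda_exponent.ED_exponent)
  qed
  show ?thesis
  proof (cases "b < nu / real m")
    case True
    \<comment> \<open>Either \<open>r + 1 \<le> nu\<close> and the first term equals
      \<open>nu\<close>, or \<open>r + 1 > nu > b * m\<close>. In the second case
      \<open>r \<ge> D\<close>, the curve is evaluated at or beyond its zero, and the second term
      equals \<open>nu\<close>.\<close>
    have E: "E r = nu" for r
    proof (cases "r + 1 \<le> nu")
      case True
      then show ?thesis using h_nu[of r] by (simp add: E_def)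
    next
      case False
      have "b * real m < nu" using True m by (simp add: field_simps)
      then have "D \<le> r" using False by (simp add: D_def)
      then have "real (min Mr Mt) \<le> r * real m / D" using D m by (simp add: m_def min.commute field_simps mult_right_mono)
      then have "h r = nu" by (simp add: h_def dmt_eq_0)
      then show ?thesis using False by (simp add: E_def)
    qed
    have "\<not> (Phi Mt Mr (k+1) - 1 + nu) / real (k+1) + 1 / real (min Mt Mr) \<le> b" if "k < min Mt Mr" for k
      using breakpoint_ge[OF assms(4) that] True unfolding m_def by linarith
    moreover have "\<exists>r>0. E r > nu - d" if "d > 0" for d
      unfolding E using that by (intro exI[of _ 1]) simp
    ultimately show ?thesis
      using lim E by (intro exI[of _ E] exI[of _ nu]) auto
  next
    case False
    \<comment> \<open>At 0 the curve has the value \<open>Mt * Mr\<close>, which is at least 1. At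
      \<open>D\<close> its argument is \<open>m\<close>, so \<open>h D = nu\<close>, and
      \<open>nu \<le> b * m = D + 1\<close> in this case.\<close>
    have "\<exists>r\<ge>0. r \<le> D \<and> r + 1 - h r = 0"
    proof (rule IVT')
      have "1 * 1 \<le> real (max Mt Mr) * real (min Mt Mr)" using assms(1,2) by (intro mult_mono) auto
      moreover have "dmt Mr Mt 0 = real (max Mt Mr) * real (min Mt Mr)"
        using dmt_segment[of 0 Mr Mt 0] M by (simp add: Phi_def)
      ultimately show "0 + 1 - h 0 \<le> 0" using assms(4) by (simp add: h_def)
      have "nu \<le> b * real m" using False m by (simp add: field_simps)
      moreover have "h D = nu" using D by (simp add: h_def dmt_eq_0 m_def min.commute)
      ultimately show "0 \<le> D + 1 - h D" by (simp add: D_def)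
      show "continuous_on {0..D} (\<lambda>r. r + 1 - h r)"
        by (intro continuous_intros continuous_on_subset[OF h_cont]) auto
    qed (use D in simp)
    then obtain r0 where r0: "r0 \<ge> 0" "r0 + 1 = h r0" by auto
    \<comment> \<open>\<open>r + 1\<close> increases strictly and \<open>h\<close> does not
      increase, so they meet once. The explicit solution of \<open>crossing_formula\<close> is
      therefore \<open>r0\<close> for every admissible \<open>k\<close>.\<close>
    have uniq: "r = r0" if "r + 1 = h r" for r
      using that r0 h_anti[of r r0] h_anti[of r0 r] by linarith
    have E_le: "E r \<le> 1 + r0" for r
    proof (cases "r \<le> r0")
      case True
      then show ?thesis using h_nu[of r0] r0 by (simp add: E_def min_le_iff_disj)
    next
      case False
      then show ?thesis using h_anti[of r0 r] r0 by (simp add: E_def min_le_iff_disj)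
    qed
    have E_r0: "E r0 = 1 + r0" using h_nu[of r0] r0 by (simp add: E_def)
    have E_cont: "continuous_on UNIV E"
      unfolding E_def by (intro continuous_intros h_cont)
    have approx: "\<exists>r>0. E r > 1 + r0 - d" if d: "d > 0" for d
    proof -
      have "isCont E r0" using E_cont by (simp add: continuous_on_eq_continuous_at)
      then obtain s where s: "s > 0" "\<And>y. dist y r0 < s \<Longrightarrow> dist (E y) (E r0) < d"
        using d unfolding continuous_at_eps_delta by blast
      have "dist (E (r0 + s/2)) (E r0) < d" using s by (intro s(2)) (simp add: dist_real_def)
      then have "E (r0 + s/2) > 1 + r0 - d" unfolding E_r0 dist_real_def by linarith
      then show ?thesis using s(1) r0(1) by (intro exI[of _ "r0 + s/2"]) auto
    qed
    have "1 + r0 = 1 + (b * real (min Mt Mr) - 1) * (Phi Mt Mr k + real k * Upsilon Mt Mr k - 1 + nu)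
                      / (b * real (min Mt Mr) - 1 + real (min Mt Mr) * Upsilon Mt Mr k)"
      if k: "k < min Mt Mr" "(Phi Mt Mr (k+1) - 1 + nu) / real (k+1) + 1 / real (min Mt Mr) \<le> b"
        "k = 0 \<or> b < (Phi Mt Mr k - 1 + nu) / real k + 1 / real (min Mt Mr)" for k
      using uniq[unfolded h_def D_def m_def, OF crossing_formula[OF assms(4,3) k]] by simp
    then show ?thesis
      using lim E_le approx False by (intro exI[of _ E] exI[of _ "1 + r0"]) (auto simp: m_def)
  qed
qed

end
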